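(* Let $v$ be an object of an admissible component of the root groupoid, and regard the skeleton $\mathrm{Sk}(v)$ as a marked graph: its vertices are the objects of $\mathrm{Sk}(v)$ and its edges are the reflexions $r_x$, marked by $x\in X$. Then: (1) $\mathrm{Sk}(v)$ is a Coxeter graph. (2) Nontrivial Coxeter loops may have length $2m$ where $m=2,3,4$ or $6$.
   Context: Root groupoid. Fix a finite set $X$. A root datum is a quadruple $v=(\mathfrak h,a,b,p)$ with $\mathfrak h$ a finite-dimensional complex vector space, $a:X\to\mathfrak h$, $b:X\to\mathfrak h^*$ such that the families $(a(x))_{x\in X}$ and $(b(x))_{x\in X}$ are linearly independent, and $p:X\to\mathbb Z_2$; we write $\mathfrak h(v),a_v,b_v,p_v$. Its Cartan matrix is $a_{xy}=\langle a(x),b(y)\rangle$. An element $x\in X$ is reflectable at $v$ if: $a_{xx}=0$ implies $p(x)=1$; if $a_{xx}\ne 0$ and $p(x)=0$ then $2a_{xy}/a_{xx}\in\mathbb Z_{\le 0}$ for all $y\ne x$; if $a_{xx}\neq 0$ and $p(x)=1$ then $a_{xy}/a_{xx}\in\mathbb Z_{\le 0}$ for all $y\ne x$. For $x$ reflectable at $v$ the reflexion $r_x:v\to v'=(\mathfrak h,a',b',p')$ is defined as follows. Anisotropic case $a_{xx}\ne0$: $p'=p$, $a'(y)=a(y)-2\frac{a_{yx}}{a_{xx}}a(x)$, $b'(y)=b(y)-2\frac{a_{xy}}{a_{xx}}b(x)$. Isotropic case $a_{xx}=0$: $(a'(x),b'(x),p'(x))=(-a(x),-b(x),p(x))$; for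 $y\neq x$ with $a_{xy}=0$, $(a'(y),b'(y),p'(y))=(a(y),b(y),p(y))$; for $y$ with $a_{xy}\ne0$, $(a'(y),b'(y),p'(y))=(a(y)+\frac{a_{yx}}{a_{xy}}a(x),\,b(y)+b(x),\,1+p(y))$. Reflexions satisfy $r_x^2=\mathrm{id}$. The root groupoid $\mathcal R$ has the root data as objects; its arrows are generated by reflexions, tautological arrows $t_\theta:(\mathfrak h,a,b,p)\to(\mathfrak h',\theta\circ a,(\theta^* )^{-1}\circ b,p)$ for linear isomorphisms $\theta:\mathfrak h\to\mathfrak h'$, and homotheties $h_\lambda:(\mathfrak h,a,b,p)\to(\mathfrak h,\lambda a,b,p)$ for $\lambda:X\to\mathbb C^*$. Each generator induces a linear isomorphism of the spaces $\mathfrak h$ (the identity for reflexions and homotheties, $\theta$ for $t_\theta$), and two compositions of generators $v\to v'$ are identified iff they induce the same isomorphism $\mathfrak h(v)\to\mathfrak h(v')$. A component is a connected component of $\mathcal R$. The skeleton $\mathrm{Sk}(v)$ is the connected component of $v$ in the subgroupoid of $\mathcal R$ whose arrows are the compositions of reflexions; its objects are those obtained from $v$ by chains of reflexions. Admissibility. The half-baked Lie superalgebra $\tilde{\mathfrak g}(v)$ is generated by $\mathfrak h(v)$ (even) and $\tilde e_x,\tilde f_x$ ($x\in X$, of parity $p(x)$) with relations $[\mathfrak h,\mathfrak h]=0$, $[h,\tilde e_x]=\langle b(x),h\rangle\tilde e_x$, $[h,\tilde f_x]=-\langle b(x),h\rangle\tilde f_x$, $[\tilde e_x,\tilde f_y]=0$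 for $x\ne y$, $[\tilde e_x,\tilde f_x]=a(x)$. A component $\mathcal R_0$ is admissible if there is a collection of quotients $\mathfrak g(v)=\tilde{\mathfrak g}(v)/I(v)$, $v\in\mathcal R_0$, with $I(v)\cap\mathfrak h(v)=0$, such that for each arrow $v\to v'$ in $\mathcal R_0$ the induced isomorphism $\mathfrak h(v)\to\mathfrak h(v')$ extends to an isomorphism $\mathfrak g(v)\to\mathfrak g(v')$. Coxeter graphs. Let $G$ be a connected graph whose edges are marked by elements of a finite set $X$ so that edges having a common end have different markings. Write $r_x:v\to v'$ for the edge marked $x$ connecting $v$ and $v'$, traversed from $v$ to $v'$. A path $v\to v'$ is a sequence of consecutive arrows $v=v_0\xrightarrow{r_{x_1}}\dots\xrightarrow{r_{x_n}}v_n=v'$, and $n$ is its length; $\phi^{-1}$ is obtained from $\phi$ by changing the direction of all arrows. A Coxeter loop $\phi:v\to v$ is one of the following: $\phi=r_x^2$ (these are called the trivial loops), or $\phi=(r_y\circ r_x)^m$ (these are called the loops of length $2m$). For paths $\phi,\psi:v\to v'$ there is an elementary Coxeter modification $\phi\Rightarrow\psi$ if the concatenation $\psi^{-1}\circ\phi$ is a Coxeter loop. A Coxeter modification from $\phi$ to $\psi$ is a presentation $\phi=\phi_1\circ\phi_2\circ\phi_3$, $\psi=\psi_1\circ\psi_2\circ\psi_3$ with $\phi_1=\psi_1$, $\phi_3=\psi_3$ and an elementary Coxeter modification $\phi_2\Rightarrow\psi_2$. The marked graph is called Coxeter if any pair of paths from $v$ to $v'$ can be connected by a sequence of Coxeter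 modifications.
   Formalization: Part (2) is stated for Coxeter loops that are not proper powers of shorter loops (powers of a loop are again Coxeter loops, of arbitrarily large length), and "may have length" is read as: 2m with m=2,3,4,6 are the only possible lengths. *)

theory Defs
  imports
    Complex_Main
    "HOL-Library.FuncSet"
    "HOL-Library.Z2"
    "HOL-Library.Nonpos_Ints"
    "HOL-Library.Poly_Mapping"
    "HOL-Algebra.QuotRing"
    "HOL-Algebra.Module"
begin

section \<open>Complex vector spaces\<close>

class complex_vector = ab_group_add +
  fixes scaleC :: "complex \<Rightarrow> 'a \<Rightarrow> 'a"  (infixr \<open>*\<^sub>C\<close> 75)
  assumes scaleC_add_right: "c *\<^sub>C (x + y) = c *\<^sub>C x + c *\<^sub>C y"
    and scaleC_add_left: "(c + d) *\<^sub>C x = c *\<^sub>C x + d *\<^sub>C x"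
    and scaleC_scaleC: "c *\<^sub>C (d *\<^sub>C x) = (c * d) *\<^sub>C x"
    and scaleC_one: "1 *\<^sub>C x = x"

interpretation complex_vector: vector_space "scaleC :: complex \<Rightarrow> 'a \<Rightarrow> 'a::complex_vector"
  by unfold_locales (simp_all add: scaleC_add_right scaleC_add_left scaleC_scaleC scaleC_one)

instantiation complex :: complex_vector
begin

definition scaleC_complex :: "complex \<Rightarrow> complex \<Rightarrow> complex"
  where "scaleC_complex c z = c * z"

instance
  by standard (simp_all add: scaleC_complex_def algebra_simps)

end

text \<open>
  The spaces \<open>\<hh>(v)\<close> vary over the objects of the root groupoid. They are taken to be the
  finite-dimensional subspaces of an arbitrary ambient complex vector space, the type \<open>'h\<close>;
  linear maps between them are extensional functions (value \<open>undefined\<close> off the domain), so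
  that equality of functions is equality of maps.
\<close>

definition fin_dim_subspace :: "'h::complex_vector set \<Rightarrow> bool" where
  "fin_dim_subspace H \<longleftrightarrow> (\<exists>B. finite B \<and> H = complex_vector.span B)"

definition clinear_on :: "'h::complex_vector set \<Rightarrow> ('h \<Rightarrow> 'k::complex_vector) \<Rightarrow> bool" where
  "clinear_on H f \<longleftrightarrow> f \<in> extensional H
     \<and> (\<forall>h\<in>H. \<forall>k\<in>H. f (h + k) = f h + f k) \<and> (\<forall>c. \<forall>h\<in>H. f (c *\<^sub>C h) = c *\<^sub>C f h)"

definition dual_space :: "'h::complex_vector set \<Rightarrow> ('h \<Rightarrow> complex) set" where
  "dual_space H = {f. clinear_on H f}"

definition clinear_iso :: "'h::complex_vector set \<Rightarrow> 'h set \<Rightarrow> ('h \<Rightarrow> 'h) \<Rightarrow> bool" where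
  "clinear_iso H H' \<theta> \<longleftrightarrow> clinear_on H \<theta> \<and> bij_betw \<theta> H H'"


section \<open>The root groupoid\<close>

record ('h, 'x) root_datum =
  rd_space :: "'h set"
  rd_a :: "'x \<Rightarrow> 'h"
  rd_b :: "'x \<Rightarrow> 'h \<Rightarrow> complex"
  rd_p :: "'x \<Rightarrow> bit"

definition root_data :: "'x set \<Rightarrow> ('h::complex_vector, 'x) root_datum set" where
  "root_data X = {v.
      fin_dim_subspace (rd_space v)
    \<and> rd_a v \<in> X \<rightarrow>\<^sub>E rd_space v
    \<and> rd_b v \<in> X \<rightarrow>\<^sub>E dual_space (rd_space v)
    \<and> rd_p v \<in> X \<rightarrow>\<^sub>E UNIV
    \<and> (\<forall>c. (\<Sum>x\<in>X. c x *\<^sub>C rd_a v x) = 0 \<longrightarrow> (\<forall>x\<in>X. c x = 0))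
    \<and> (\<forall>c. (\<forall>h\<in>rd_space v. (\<Sum>x\<in>X. c x * rd_b v x h) = 0) \<longrightarrow> (\<forall>x\<in>X. c x = 0))}"

definition cartan :: "('h, 'x) root_datum \<Rightarrow> 'x \<Rightarrow> 'x \<Rightarrow> complex" where
  "cartan v x y = rd_b v y (rd_a v x)"

definition reflectable :: "'x set \<Rightarrow> ('h, 'x) root_datum \<Rightarrow> 'x \<Rightarrow> bool" where
  "reflectable X v x \<longleftrightarrow> x \<in> X
    \<and> (cartan v x x = 0 \<longrightarrow> rd_p v x = 1)
    \<and> (cartan v x x \<noteq> 0 \<and> rd_p v x = 0 \<longrightarrow>
         (\<forall>y\<in>X. y \<noteq> x \<longrightarrow> 2 * cartan v x y / cartan v x x \<in> \<int>\<^sub>\<le>\<^sub>0))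
    \<and> (cartan v x x \<noteq> 0 \<and> rd_p v x = 1 \<longrightarrow>
         (\<forall>y\<in>X. y \<noteq> x \<longrightarrow> cartan v x y / cartan v x x \<in> \<int>\<^sub>\<le>\<^sub>0))"

definition anisotropic_reflexion ::
  "'x set \<Rightarrow> ('h::complex_vector, 'x) root_datum \<Rightarrow> 'x \<Rightarrow> ('h, 'x) root_datum" where
  "anisotropic_reflexion X v x = v\<lparr>
     rd_a := (\<lambda>y\<in>X. rd_a v y - (2 * cartan v y x / cartan v x x) *\<^sub>C rd_a v x),
     rd_b := (\<lambda>y\<in>X. \<lambda>h\<in>rd_space v. rd_b v y h - 2 * cartan v x y / cartan v x x * rd_b v x h)\<rparr>"

definition isotropic_reflexion ::
  "'x set \<Rightarrow> ('h::complex_vector, 'x) root_datum \<Rightarrow> 'x \<Rightarrow> ('h, 'x) root_datum" where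
  "isotropic_reflexion X v x = v\<lparr>
     rd_a := (\<lambda>y\<in>X. if y = x then - rd_a v x
                     else if cartan v x y = 0 then rd_a v y
                     else rd_a v y + (cartan v y x / cartan v x y) *\<^sub>C rd_a v x),
     rd_b := (\<lambda>y\<in>X. \<lambda>h\<in>rd_space v.
                     if y = x then - rd_b v x h
                     else if cartan v x y = 0 then rd_b v y h
                     else rd_b v y h + rd_b v x h),
     rd_p := (\<lambda>y\<in>X. if y = x \<or> cartan v x y = 0 then rd_p v y else 1 + rd_p v y)\<rparr>"

definition reflexion ::
  "'x set \<Rightarrow> ('h::complex_vector, 'x) root_datum \<Rightarrow> 'x \<Rightarrow> ('h, 'x) root_datum" where
  "reflexion X v x =
     (if cartan v x x \<noteq> 0 then anisotropic_reflexion X v x else isotropic_reflexion X v x)"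

definition taut_image ::
  "'x set \<Rightarrow> ('h::complex_vector, 'x) root_datum \<Rightarrow> ('h \<Rightarrow> 'h) \<Rightarrow> 'h set \<Rightarrow> ('h, 'x) root_datum" where
  "taut_image X v \<theta> H' = \<lparr>
     rd_space = H',
     rd_a = (\<lambda>x\<in>X. \<theta> (rd_a v x)),
     rd_b = (\<lambda>x\<in>X. \<lambda>h\<in>H'. rd_b v x (inv_into (rd_space v) \<theta> h)),
     rd_p = rd_p v\<rparr>"

definition homothety_image ::
  "'x set \<Rightarrow> ('h::complex_vector, 'x) root_datum \<Rightarrow> ('x \<Rightarrow> complex) \<Rightarrow> ('h, 'x) root_datum" where
  "homothety_image X v l = v\<lparr>rd_a := (\<lambda>x\<in>X. l x *\<^sub>C rd_a v x)\<rparr>"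

text \<open>
  \<open>rg_generator X v \<phi> w\<close>: there is a generating arrow \<open>v \<rightarrow> w\<close> inducing
  \<open>\<phi> : \<hh>(v) \<rightarrow> \<hh>(w)\<close>.
\<close>

inductive rg_generator ::
  "'x set \<Rightarrow> ('h::complex_vector, 'x) root_datum \<Rightarrow> ('h \<Rightarrow> 'h) \<Rightarrow> ('h, 'x) root_datum \<Rightarrow> bool"
  for X where
  reflexion: "\<lbrakk>v \<in> root_data X; reflectable X v x\<rbrakk> \<Longrightarrow>
    rg_generator X v (\<lambda>h\<in>rd_space v. h) (reflexion X v x)"
| tautological: "\<lbrakk>v \<in> root_data X; fin_dim_subspace H'; clinear_iso (rd_space v) H' \<theta>\<rbrakk> \<Longrightarrow>
    rg_generator X v \<theta> (taut_image X v \<theta> H')"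
| homothety: "\<lbrakk>v \<in> root_data X; \<forall>x\<in>X. l x \<noteq> 0\<rbrakk> \<Longrightarrow>
    rg_generator X v (\<lambda>h\<in>rd_space v. h) (homothety_image X v l)"

text \<open>
  Compositions of generators with the same ends are identified when they induce the same
  isomorphism, so an arrow is a triple \<open>(v, \<phi>, w)\<close> with \<open>\<phi>\<close> induced by some composition.
  The generators of each of the three kinds are closed under inverses, so no formal inverses
  are needed.
\<close>

inductive rg_arrow ::
  "'x set \<Rightarrow> ('h::complex_vector, 'x) root_datum \<Rightarrow> ('h \<Rightarrow> 'h) \<Rightarrow> ('h, 'x) root_datum \<Rightarrow> bool"
  for X where
  identity: "v \<in> root_data X \<Longrightarrow> rg_arrow X v (\<lambda>h\<in>rd_space v. h) v"
| step: "\<lbrakk>rg_arrow X u \<phi> v; rg_generator X v \<psi> w\<rbrakk> \<Longrightarrow>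
    rg_arrow X u (compose (rd_space u) \<psi> \<phi>) w"

definition rg_component :: "'x set \<Rightarrow> ('h::complex_vector, 'x) root_datum set \<Rightarrow> bool" where
  "rg_component X R0 \<longleftrightarrow> (\<exists>u\<in>root_data X. R0 = {w. \<exists>\<phi>. rg_arrow X u \<phi> w})"


section \<open>Half-baked Lie superalgebras and admissibility\<close>

text \<open>
  A superalgebra is a module record over the complex numbers whose multiplication \<open>\<otimes>\<close> is the
  Lie bracket, together with its homogeneous parts. The unit field of the record is not used.
\<close>

record 'g superalgebra = "(complex, 'g) module" +
  part :: "bit \<Rightarrow> 'g set"

definition graded_ideal :: "'g superalgebra \<Rightarrow> 'g set \<Rightarrow> bool" where
  "graded_ideal L I \<longleftrightarrow> additive_subgroup I L
    \<and> (\<forall>c. \<forall>x\<in>I. c \<odot>\<^bsub>L\<^esub> x \<in> I)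
    \<and> (\<forall>x\<in>I. \<forall>y\<in>carrier L. x \<otimes>\<^bsub>L\<^esub> y \<in> I \<and> y \<otimes>\<^bsub>L\<^esub> x \<in> I)
    \<and> (\<forall>x\<in>I. \<exists>x0\<in>I \<inter> part L 0. \<exists>x1\<in>I \<inter> part L 1. x = x0 \<oplus>\<^bsub>L\<^esub> x1)"

definition quotient_superalgebra ::
  "'g superalgebra \<Rightarrow> 'g set \<Rightarrow> 'g set superalgebra" where
  "quotient_superalgebra L I = \<lparr>
     carrier = a_rcosets\<^bsub>L\<^esub> I,
     mult = rcoset_mult L I,
     one = I +>\<^bsub>L\<^esub> \<one>\<^bsub>L\<^esub>,
     zero = I,
     add = set_add L,
     smult = (\<lambda>c A. \<Union>a\<in>A. I +>\<^bsub>L\<^esub> (c \<odot>\<^bsub>L\<^esub> a)),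
     part = (\<lambda>d. (\<lambda>x. I +>\<^bsub>L\<^esub> x) ` part L d)\<rparr>"

definition superalgebra_iso ::
  "'g superalgebra \<Rightarrow> 'k superalgebra \<Rightarrow> ('g \<Rightarrow> 'k) \<Rightarrow> bool" where
  "superalgebra_iso L M f \<longleftrightarrow> bij_betw f (carrier L) (carrier M)
    \<and> (\<forall>x\<in>carrier L. \<forall>y\<in>carrier L. f (x \<oplus>\<^bsub>L\<^esub> y) = f x \<oplus>\<^bsub>M\<^esub> f y)
    \<and> (\<forall>c. \<forall>x\<in>carrier L. f (c \<odot>\<^bsub>L\<^esub> x) = c \<odot>\<^bsub>M\<^esub> f x)
    \<and> (\<forall>x\<in>carrier L. \<forall>y\<in>carrier L. f (x \<otimes>\<^bsub>L\<^esub> y) = f x \<otimes>\<^bsub>M\<^esub> f y)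
    \<and> (\<forall>d. f ` part L d = part M d)"

text \<open>
  Nonassociative words in the generators: \<open>Gen_h h\<close> for \<open>h \<in> \<hh>(v)\<close>, and \<open>Gen_e x\<close>,
  \<open>Gen_f x\<close> for the generators attached to \<open>x \<in> X\<close>.
\<close>

datatype (word_hs: 'h, word_xs: 'x) word =
  Gen_h 'h | Gen_e 'x | Gen_f 'x | Br "('h, 'x) word" "('h, 'x) word"

fun word_parity :: "('x \<Rightarrow> bit) \<Rightarrow> ('h, 'x) word \<Rightarrow> bit" where
  "word_parity p (Gen_h h) = 0"
| "word_parity p (Gen_e x) = p x"
| "word_parity p (Gen_f x) = p x"
| "word_parity p (Br u w) = word_parity p u + word_parity p w"

definition words :: "'x set \<Rightarrow> ('h, 'x) root_datum \<Rightarrow> ('h, 'x) word set" where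
  "words X v = {w. word_hs w \<subseteq> rd_space v \<and> word_xs w \<subseteq> X}"

definition free_bracket ::
  "(('h, 'x) word \<Rightarrow>\<^sub>0 complex) \<Rightarrow> (('h, 'x) word \<Rightarrow>\<^sub>0 complex) \<Rightarrow> (('h, 'x) word \<Rightarrow>\<^sub>0 complex)" where
  "free_bracket s t = (\<Sum>u\<in>Poly_Mapping.keys s. \<Sum>w\<in>Poly_Mapping.keys t.
     Poly_Mapping.single (Br u w) (Poly_Mapping.lookup s u * Poly_Mapping.lookup t w))"

definition free_superalgebra ::
  "'x set \<Rightarrow> ('h, 'x) root_datum \<Rightarrow> (('h, 'x) word \<Rightarrow>\<^sub>0 complex) superalgebra" where
  "free_superalgebra X v = \<lparr>
     carrier = {t. Poly_Mapping.keys t \<subseteq> words X v},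
     mult = free_bracket,
     one = 0,
     zero = 0,
     add = (+),
     smult = (\<lambda>c. Poly_Mapping.map ((*) c)),
     part = (\<lambda>d. {t. Poly_Mapping.keys t \<subseteq> {w \<in> words X v. word_parity (rd_p v) w = d}})\<rparr>"

definition koszul_sign :: "bit \<Rightarrow> bit \<Rightarrow> complex" where
  "koszul_sign d e = (if d = 1 \<and> e = 1 then -1 else 1)"

text \<open>
  The first two rules make \<open>h \<mapsto> Gen_h h\<close> linear; \<open>skew\<close> and \<open>jacobi\<close> are the Lie
  superalgebra identities, which need only be imposed on words since these are homogeneous and
  the bracket is bilinear; the remaining rules are the defining relations.
\<close>

inductive_set relators ::
  "'x set \<Rightarrow> ('h::complex_vector, 'x) root_datum \<Rightarrow> (('h, 'x) word \<Rightarrow>\<^sub>0 complex) set"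
  for X v where
  h_add: "\<lbrakk>h \<in> rd_space v; k \<in> rd_space v\<rbrakk> \<Longrightarrow>
    Poly_Mapping.single (Gen_h (h + k)) 1 - Poly_Mapping.single (Gen_h h) 1
      - Poly_Mapping.single (Gen_h k) 1 \<in> relators X v"
| h_scale: "h \<in> rd_space v \<Longrightarrow>
    Poly_Mapping.single (Gen_h (c *\<^sub>C h)) 1 - Poly_Mapping.single (Gen_h h) c \<in> relators X v"
| skew: "\<lbrakk>u \<in> words X v; w \<in> words X v\<rbrakk> \<Longrightarrow>
    Poly_Mapping.single (Br u w) 1
      + Poly_Mapping.single (Br w u)
          (koszul_sign (word_parity (rd_p v) u) (word_parity (rd_p v) w)) \<in> relators X v"
| jacobi: "\<lbrakk>u \<in> words X v; w \<in> words X v; t \<in> words X v\<rbrakk> \<Longrightarrow>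
    Poly_Mapping.single (Br u (Br w t)) 1 - Poly_Mapping.single (Br (Br u w) t) 1
      - Poly_Mapping.single (Br w (Br u t))
          (koszul_sign (word_parity (rd_p v) u) (word_parity (rd_p v) w)) \<in> relators X v"
| hh: "\<lbrakk>h \<in> rd_space v; k \<in> rd_space v\<rbrakk> \<Longrightarrow>
    Poly_Mapping.single (Br (Gen_h h) (Gen_h k)) 1 \<in> relators X v"
| he: "\<lbrakk>h \<in> rd_space v; x \<in> X\<rbrakk> \<Longrightarrow>
    Poly_Mapping.single (Br (Gen_h h) (Gen_e x)) 1
      - Poly_Mapping.single (Gen_e x) (rd_b v x h) \<in> relators X v"
| hf: "\<lbrakk>h \<in> rd_space v; x \<in> X\<rbrakk> \<Longrightarrow>
    Poly_Mapping.single (Br (Gen_h h) (Gen_f x)) 1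
      + Poly_Mapping.single (Gen_f x) (rd_b v x h) \<in> relators X v"
| ef: "\<lbrakk>x \<in> X; y \<in> X; x \<noteq> y\<rbrakk> \<Longrightarrow>
    Poly_Mapping.single (Br (Gen_e x) (Gen_f y)) 1 \<in> relators X v"
| ef_same: "x \<in> X \<Longrightarrow>
    Poly_Mapping.single (Br (Gen_e x) (Gen_f x)) 1
      - Poly_Mapping.single (Gen_h (rd_a v x)) 1 \<in> relators X v"

definition relation_ideal ::
  "'x set \<Rightarrow> ('h::complex_vector, 'x) root_datum \<Rightarrow> (('h, 'x) word \<Rightarrow>\<^sub>0 complex) set" where
  "relation_ideal X v =
     \<Inter>{J. graded_ideal (free_superalgebra X v) J \<and> relators X v \<subseteq> J}"

definition half_baked ::
  "'x set \<Rightarrow> ('h::complex_vector, 'x) root_datum \<Rightarrow> (('h, 'x) word \<Rightarrow>\<^sub>0 complex) set superalgebra" where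
  "half_baked X v = quotient_superalgebra (free_superalgebra X v) (relation_ideal X v)"

definition half_baked_h ::
  "'x set \<Rightarrow> ('h::complex_vector, 'x) root_datum \<Rightarrow> 'h \<Rightarrow> (('h, 'x) word \<Rightarrow>\<^sub>0 complex) set" where
  "half_baked_h X v h =
     relation_ideal X v +>\<^bsub>free_superalgebra X v\<^esub> Poly_Mapping.single (Gen_h h) 1"

text \<open>
  The condition \<open>I(v) \<inter> \<hh>(v) = 0\<close> regards \<open>\<hh>(v)\<close> as a subspace of the half-baked algebra
  via \<open>half_baked_h\<close>. Every ideal of the half-baked algebra is stable under the adjoint action
  of \<open>\<hh>(v)\<close>, hence homogeneous, so requiring \<open>graded_ideal\<close> is no restriction.
\<close>

definition admissible :: "'x set \<Rightarrow> ('h::complex_vector, 'x) root_datum set \<Rightarrow> bool" where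
  "admissible X R0 \<longleftrightarrow> (\<exists>I.
     (\<forall>v\<in>R0. graded_ideal (half_baked X v) (I v)
        \<and> (\<forall>h\<in>rd_space v. half_baked_h X v h \<in> I v \<longrightarrow> h = 0))
   \<and> (\<forall>v\<in>R0. \<forall>w \<phi>. rg_arrow X v \<phi> w \<longrightarrow>
        (\<exists>\<Phi>. superalgebra_iso (quotient_superalgebra (half_baked X v) (I v))
                 (quotient_superalgebra (half_baked X w) (I w)) \<Phi>
           \<and> (\<forall>h\<in>rd_space v. \<Phi> (I v +>\<^bsub>half_baked X v\<^esub> half_baked_h X v h)
                = I w +>\<^bsub>half_baked X w\<^esub> half_baked_h X w (\<phi> h)))))"


section \<open>Coxeter graphs\<close>

text \<open>
  An edge marked \<open>x\<close> connecting \<open>u\<close> and \<open>w\<close> is represented by its two orientations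
  \<open>(u, x, w)\<close> and \<open>(w, x, u)\<close>.
\<close>

record ('v, 'x) mgraph =
  verts :: "'v set"
  arrows :: "('v \<times> 'x \<times> 'v) set"

fun is_path :: "('v, 'x) mgraph \<Rightarrow> 'v \<Rightarrow> ('v \<times> 'x \<times> 'v) list \<Rightarrow> 'v \<Rightarrow> bool" where
  "is_path G u [] w \<longleftrightarrow> u \<in> verts G \<and> u = w"
| "is_path G u ((u', x, v) # es) w \<longleftrightarrow> u' = u \<and> (u, x, v) \<in> arrows G \<and> is_path G v es w"

definition connected_marked_graph :: "'x set \<Rightarrow> ('v, 'x) mgraph \<Rightarrow> bool" where
  "connected_marked_graph X G \<longleftrightarrow>
     arrows G \<subseteq> verts G \<times> X \<times> verts G
   \<and> (\<forall>u x w. (u, x, w) \<in> arrows G \<longrightarrow> (w, x, u) \<in> arrows G \<and> u \<noteq> w)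
   \<and> (\<forall>u x w w'. (u, x, w) \<in> arrows G \<longrightarrow> (u, x, w') \<in> arrows G \<longrightarrow> w = w')
   \<and> verts G \<noteq> {} \<and> (\<forall>u\<in>verts G. \<forall>w\<in>verts G. \<exists>es. is_path G u es w)"

definition path_marks :: "('v \<times> 'x \<times> 'v) list \<Rightarrow> 'x list" where
  "path_marks es = map (\<lambda>(u, x, w). x) es"

definition path_inverse :: "('v \<times> 'x \<times> 'v) list \<Rightarrow> ('v \<times> 'x \<times> 'v) list" where
  "path_inverse es = rev (map (\<lambda>(u, x, w). (w, x, u)) es)"

text \<open>
  Paths are listed in the order of traversal, so the composition \<open>\<psi> \<circ> \<phi>\<close> is \<open>\<phi> @ \<psi>\<close>.
\<close>

definition trivial_coxeter_loop :: "('v, 'x) mgraph \<Rightarrow> 'v \<Rightarrow> ('v \<times> 'x \<times> 'v) list \<Rightarrow> bool" where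
  "trivial_coxeter_loop G u es \<longleftrightarrow> is_path G u es u \<and> (\<exists>x. path_marks es = [x, x])"

definition nontrivial_coxeter_loop ::
  "('v, 'x) mgraph \<Rightarrow> nat \<Rightarrow> 'v \<Rightarrow> ('v \<times> 'x \<times> 'v) list \<Rightarrow> bool" where
  "nontrivial_coxeter_loop G m u es \<longleftrightarrow> is_path G u es u
     \<and> m \<ge> 1 \<and> (\<exists>x y. x \<noteq> y \<and> path_marks es = concat (replicate m [x, y]))"

definition coxeter_loop :: "('v, 'x) mgraph \<Rightarrow> 'v \<Rightarrow> ('v \<times> 'x \<times> 'v) list \<Rightarrow> bool" where
  "coxeter_loop G u es \<longleftrightarrow>
     trivial_coxeter_loop G u es \<or> (\<exists>m. nontrivial_coxeter_loop G m u es)"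

definition elementary_coxeter_modification ::
  "('v, 'x) mgraph \<Rightarrow> 'v \<Rightarrow> 'v \<Rightarrow> ('v \<times> 'x \<times> 'v) list \<Rightarrow> ('v \<times> 'x \<times> 'v) list \<Rightarrow> bool" where
  "elementary_coxeter_modification G u w \<phi> \<psi> \<longleftrightarrow>
     is_path G u \<phi> w \<and> is_path G u \<psi> w \<and> coxeter_loop G u (\<phi> @ path_inverse \<psi>)"

definition coxeter_modification ::
  "('v, 'x) mgraph \<Rightarrow> 'v \<Rightarrow> 'v \<Rightarrow> ('v \<times> 'x \<times> 'v) list \<Rightarrow> ('v \<times> 'x \<times> 'v) list \<Rightarrow> bool" where
  "coxeter_modification G u w \<phi> \<psi> \<longleftrightarrow>
     (\<exists>\<alpha> \<phi>' \<psi>' \<beta> s t. \<phi> = \<alpha> @ \<phi>' @ \<beta> \<and> \<psi> = \<alpha> @ \<psi>' @ \<beta>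
        \<and> is_path G u \<alpha> s \<and> elementary_coxeter_modification G s t \<phi>' \<psi>' \<and> is_path G t \<beta> w)"

definition coxeter_graph :: "'x set \<Rightarrow> ('v, 'x) mgraph \<Rightarrow> bool" where
  "coxeter_graph X G \<longleftrightarrow> connected_marked_graph X G
     \<and> (\<forall>u w \<phi> \<psi>. is_path G u \<phi> w \<longrightarrow> is_path G u \<psi> w \<longrightarrow>
          (coxeter_modification G u w)\<^sup>*\<^sup>* \<phi> \<psi>)"

text \<open>
  If \<open>(r\<^sub>y \<circ> r\<^sub>x)\<^sup>m\<close> is a loop then so are all its powers, which are Coxeter loops as
  well. A statement about the possible lengths therefore has to refer to loops traversed once,
  i.e. those that are not proper powers (equivalently, \<open>m\<close> is minimal).
\<close>

definition traversed_once :: "('v \<times> 'x \<times> 'v) list \<Rightarrow> bool" where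
  "traversed_once es \<longleftrightarrow> \<not> (\<exists>k ds. k \<ge> 2 \<and> es = concat (replicate k ds))"


section \<open>The skeleton\<close>

definition skeleton ::
  "'x set \<Rightarrow> ('h::complex_vector, 'x) root_datum \<Rightarrow> (('h, 'x) root_datum, 'x) mgraph" where
  "skeleton X v = (let V = {w. (\<lambda>u w. \<exists>x. reflectable X u x \<and> w = reflexion X u x)\<^sup>*\<^sup>* v w} in
     \<lparr>verts = V, arrows = {(u, x, w). u \<in> V \<and> reflectable X u x \<and> w = reflexion X u x}\<rparr>)"

end

theory Submission
  imports Defs "HOL-Library.Multiset_Order"
begin

text \<open>
  Admissibility enters through the weights of the quotients. For \<open>u\<close>, \<open>w\<close> in the skeleton
  the identity of \<open>\<hh>\<close> extends to \<open>\<gg>(u) \<cong> \<gg>(w)\<close>, and \<open>\<gg>(u)\<close> is spanned by \<open>\<hh>\<close> and by words in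
  the \<open>e\<close>'s alone or in the \<open>f\<close>'s alone. Hence every real root \<open>b\<^sub>w(x)\<close> has coordinates of one
  sign in the basis \<open>b\<^sub>u\<close>; the weight space of \<open>b\<^sub>u(x)\<close> is one-dimensional, so that a real root
  determines \<open>a\<close> up to a scalar, the parity, and (by \<open>\<ss>\<ll>\<^sub>2\<close> or \<open>\<oo>\<ss>\<pp>(1|2)\<close> theory) reflectability; and
  \<open>a\<^sub>x\<^sub>y = 0\<close> forces \<open>a\<^sub>y\<^sub>x = 0\<close> for reflectable \<open>x\<close>.

  The rest is combinatorial. Fix a vertex \<open>u\<close>; the height of \<open>w\<close> is the number of real roots positive
  at \<open>u\<close> and negative at \<open>w\<close>, and it changes by one along an edge. At a peak of a closed path the
  two marks \<open>x \<noteq> y\<close> span a rank two root system whose positive roots are all negative at \<open>u\<close>, hence finite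
  in number. Its Cartan matrix \<open>(2, -k; -l, 2)\<close> does not change along the alternating path, so \<open>kl \<le> 3\<close>
  and the two descending alternating paths meet after \<open>2, 3, 4\<close> or \<open>6\<close> steps: the peak can be
  replaced by a lower path through a Coxeter loop.
\<close>

section \<open>Free nonassociative algebras modulo an ideal\<close>

text \<open>Three obstacles shape the argument. Vertices are whole root data, so closing a loop must
  bring back a as well as b, while one-dimensional root spaces give a only up to scalars. Along
  alternating marks x, y the scalars of a(x) and a(y) are fixed by a number d with a_xy = d a_yx,
  which both reflexions preserve; for a third mark z, a(z) keeps its initial vector with coefficient
  1. Secondly, an isotropic reflexion changes a_yy, so constancy of the Cartan integers is not
  formal: an integer k \<ge> 2 becomes k / (k - 1), and integrality at the new vertex forces k = 2.
  Thirdly, a descent must be able to go on: a root that is positive at its own vertex and negative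
  at u changes sign on some edge between them, where it is simple and reflectable, and termination
  of root strings carries reflectability back. No computation takes place in quotients; elements of
  the free algebra are compared modulo the kernel J. The values of m come from evaluating the six
  pairs (k, l) with kl \<le> 3 in which k and l vanish together.\<close>

definition scl :: "complex \<Rightarrow> ('w \<Rightarrow>\<^sub>0 complex) \<Rightarrow> ('w \<Rightarrow>\<^sub>0 complex)" where
  "scl c = Poly_Mapping.map ((*) c)"

abbreviation mono_word :: "'w \<Rightarrow> ('w \<Rightarrow>\<^sub>0 complex)" where
  "mono_word w \<equiv> Poly_Mapping.single w 1"

lemma lookup_scl [simp]: "Poly_Mapping.lookup (scl c t) w = c * Poly_Mapping.lookup t w"
  by (simp add: scl_def Poly_Mapping.map.rep_eq when_def)

interpretation free_vs: vector_space "scl :: complex \<Rightarrow> ('w \<Rightarrow>\<^sub>0 complex) \<Rightarrow> _"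
  by unfold_locales (auto intro!: poly_mapping_eqI simp: lookup_add algebra_simps)

lemma scl_single [simp]: "scl c (Poly_Mapping.single w d) = Poly_Mapping.single w (c * d)"
  by (simp add: scl_def)

lemma keys_scl: "Poly_Mapping.keys (scl c t) \<subseteq> Poly_Mapping.keys t"
  by (auto simp: in_keys_iff)

lemma poly_mapping_expand:
  assumes "finite A" "Poly_Mapping.keys t \<subseteq> A"
  shows "t = (\<Sum>w\<in>A. Poly_Mapping.single w (Poly_Mapping.lookup t w))"
proof (rule poly_mapping_eqI)
  fix k
  have "Poly_Mapping.lookup (\<Sum>w\<in>A. Poly_Mapping.single w (Poly_Mapping.lookup t w)) k
      = (\<Sum>w\<in>A. if w = k then Poly_Mapping.lookup t k else 0)"
    by (auto simp: lookup_sum lookup_single when_def intro: sum.cong)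
  also have "\<dots> = Poly_Mapping.lookup t k"
    using assms by (auto simp: in_keys_iff)
  finally show "Poly_Mapping.lookup t k =
    Poly_Mapping.lookup (\<Sum>w\<in>A. Poly_Mapping.single w (Poly_Mapping.lookup t w)) k" by simp
qed

lemma in_span_mono_word:
  assumes "Poly_Mapping.keys t \<subseteq> A"
  shows "t \<in> free_vs.span (mono_word ` A)"
proof -
  have "t = (\<Sum>w\<in>Poly_Mapping.keys t. scl (Poly_Mapping.lookup t w) (mono_word w))"
    using poly_mapping_expand[of "Poly_Mapping.keys t" t] by simp
  also have "\<dots> \<in> free_vs.span (mono_word ` A)"
    using assms by (intro free_vs.span_sum free_vs.span_scale free_vs.span_base) auto
  finally show ?thesis .
qed

lemma subspace_keys: "free_vs.subspace {t. Poly_Mapping.keys t \<subseteq> A}"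
proof (rule free_vs.subspaceI)
  fix s t :: "'a \<Rightarrow>\<^sub>0 complex" and c
  assume s: "s \<in> {t. Poly_Mapping.keys t \<subseteq> A}"
  then show "scl c s \<in> {t. Poly_Mapping.keys t \<subseteq> A}" using keys_scl[of c s] by blast
  assume "t \<in> {t. Poly_Mapping.keys t \<subseteq> A}"
  then show "s + t \<in> {t. Poly_Mapping.keys t \<subseteq> A}" using s keys_add[of s t] by blast
qed simp

lemma span_mono_word: "free_vs.span (mono_word ` A) = {t. Poly_Mapping.keys t \<subseteq> A}"
proof
  show "free_vs.span (mono_word ` A) \<subseteq> {t. Poly_Mapping.keys t \<subseteq> A}"
    by (rule free_vs.span_minimal[OF _ subspace_keys]) auto
qed (auto intro: in_span_mono_word)

lemma free_bracket_expand:
  assumes "finite A" "Poly_Mapping.keys s \<subseteq> A" "finite B" "Poly_Mapping.keys t \<subseteq> B"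
  shows "free_bracket s t = (\<Sum>u\<in>A. \<Sum>w\<in>B.
     Poly_Mapping.single (Br u w) (Poly_Mapping.lookup s u * Poly_Mapping.lookup t w))"
proof -
  have "free_bracket s t = (\<Sum>u\<in>Poly_Mapping.keys s. \<Sum>w\<in>B.
     Poly_Mapping.single (Br u w) (Poly_Mapping.lookup s u * Poly_Mapping.lookup t w))"
    unfolding free_bracket_def using assms
    by (intro sum.cong sum.mono_neutral_left) (auto simp: in_keys_iff)
  also have "\<dots> = (\<Sum>u\<in>A. \<Sum>w\<in>B.
     Poly_Mapping.single (Br u w) (Poly_Mapping.lookup s u * Poly_Mapping.lookup t w))"
    using assms by (intro sum.mono_neutral_left) (auto simp: in_keys_iff)
  finally show ?thesis .
qed

lemma free_bracket_add_left: "free_bracket (s + s') t = free_bracket s t + free_bracket s' t"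
proof -
  let ?A = "Poly_Mapping.keys s \<union> Poly_Mapping.keys s'" and ?B = "Poly_Mapping.keys t"
  have "Poly_Mapping.keys (s + s') \<subseteq> ?A" by (rule keys_add)
  then show ?thesis
    using free_bracket_expand[of ?A "s + s'" ?B t] free_bracket_expand[of ?A s ?B t]
      free_bracket_expand[of ?A s' ?B t]
    by (simp add: lookup_add distrib_right single_add sum.distrib)
qed

lemma free_bracket_add_right: "free_bracket t (s + s') = free_bracket t s + free_bracket t s'"
proof -
  let ?A = "Poly_Mapping.keys s \<union> Poly_Mapping.keys s'" and ?B = "Poly_Mapping.keys t"
  have "Poly_Mapping.keys (s + s') \<subseteq> ?A" by (rule keys_add)
  then show ?thesis
    using free_bracket_expand[of ?B t ?A "s + s'"] free_bracket_expand[of ?B t ?A s]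
      free_bracket_expand[of ?B t ?A s']
    by (simp add: lookup_add distrib_left single_add sum.distrib)
qed

lemma free_bracket_scl_left: "free_bracket (scl c s) t = scl c (free_bracket s t)"
proof -
  have "free_bracket (scl c s) t = (\<Sum>u\<in>Poly_Mapping.keys s. \<Sum>w\<in>Poly_Mapping.keys t.
     scl c (Poly_Mapping.single (Br u w) (Poly_Mapping.lookup s u * Poly_Mapping.lookup t w)))"
    using free_bracket_expand[of "Poly_Mapping.keys s" "scl c s" "Poly_Mapping.keys t" t]
      keys_scl[of c s]
    by (simp add: mult.assoc)
  then show ?thesis unfolding free_bracket_def by (simp only: free_vs.scale_sum_right)
qed

lemma free_bracket_scl_right: "free_bracket s (scl c t) = scl c (free_bracket s t)"
proof -
  have "free_bracket s (scl c t) = (\<Sum>u\<in>Poly_Mapping.keys s. \<Sum>w\<in>Poly_Mapping.keys t.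
     scl c (Poly_Mapping.single (Br u w) (Poly_Mapping.lookup s u * Poly_Mapping.lookup t w)))"
    using free_bracket_expand[of "Poly_Mapping.keys s" s "Poly_Mapping.keys t" "scl c t"]
      keys_scl[of c t]
    by (simp add: mult.left_commute)
  then show ?thesis unfolding free_bracket_def by (simp only: free_vs.scale_sum_right)
qed

lemma free_bracket_0 [simp]: "free_bracket 0 t = 0" "free_bracket t 0 = 0"
  by (simp_all add: free_bracket_def)

lemma free_bracket_uminus_left: "free_bracket (- s) t = - free_bracket s t"
  by (metis add_eq_0_iff free_bracket_0(1) free_bracket_add_left)

lemma free_bracket_uminus_right: "free_bracket s (- t) = - free_bracket s t"
  by (metis add_eq_0_iff free_bracket_0(2) free_bracket_add_right)

lemma free_bracket_diff_left: "free_bracket (s - s') t = free_bracket s t - free_bracket s' t"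
  using free_bracket_add_left[of s "- s'" t] by (simp add: free_bracket_uminus_left)

lemma free_bracket_diff_right: "free_bracket t (s - s') = free_bracket t s - free_bracket t s'"
  using free_bracket_add_right[of t s "- s'"] by (simp add: free_bracket_uminus_right)

lemmas free_bracket_linear =
  free_bracket_add_left free_bracket_add_right free_bracket_scl_left free_bracket_scl_right
  free_bracket_uminus_left free_bracket_uminus_right free_bracket_diff_left free_bracket_diff_right

lemma free_bracket_single [simp]:
  "free_bracket (Poly_Mapping.single u c) (Poly_Mapping.single w d) = Poly_Mapping.single (Br u w) (c * d)"
  using free_bracket_expand[of "{u}" "Poly_Mapping.single u c" "{w}" "Poly_Mapping.single w d"] by simp

lemma Br_in_words [simp]: "Br u w \<in> words X v \<longleftrightarrow> u \<in> words X v \<and> w \<in> words X v"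
  by (auto simp: words_def)

lemma Gen_in_words [simp]:
  "Gen_h h \<in> words X v \<longleftrightarrow> h \<in> rd_space v"
  "Gen_e x \<in> words X v \<longleftrightarrow> x \<in> X"
  "Gen_f x \<in> words X v \<longleftrightarrow> x \<in> X"
  by (auto simp: words_def)

lemma keys_free_bracket:
  assumes "Poly_Mapping.keys s \<subseteq> A" "Poly_Mapping.keys t \<subseteq> B"
  shows "Poly_Mapping.keys (free_bracket s t) \<subseteq> {Br u w | u w. u \<in> A \<and> w \<in> B}"
proof -
  have "free_bracket s t \<in> {r. Poly_Mapping.keys r \<subseteq> {Br u w | u w. u \<in> A \<and> w \<in> B}}"
    unfolding free_bracket_def
    using assms by (intro free_vs.subspace_sum[OF subspace_keys]) auto
  then show ?thesis by blast
qed

text \<open>Operators diagonal in the word basis. Modulo \<open>J\<close> the action of h in \<hh>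
  has this form, and so do the parity projections; products of such operators are pointwise
  products.\<close>

definition dgl :: "('w \<Rightarrow> complex) \<Rightarrow> ('w \<Rightarrow>\<^sub>0 complex) \<Rightarrow> ('w \<Rightarrow>\<^sub>0 complex)" where
  "dgl g t = Poly_Mapping.mapp (\<lambda>p c. g p * c) t"

lemma lookup_dgl [simp]: "Poly_Mapping.lookup (dgl g t) p = g p * Poly_Mapping.lookup t p"
  by (auto simp: dgl_def lookup_mapp when_def in_keys_iff)

lemma dgl_simps:
  "dgl g (s + t) = dgl g s + dgl g t" "dgl g (s - t) = dgl g s - dgl g t"
  "dgl g (scl c t) = scl c (dgl g t)" "dgl g 0 = 0"
  "dgl g (dgl g' t) = dgl (\<lambda>p. g p * g' p) t"
  "dgl (\<lambda>p. c) t = scl c t" "dgl (\<lambda>p. g p - g' p) t = dgl g t - dgl g' t"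
  "dgl (\<lambda>p. c * g p) t = scl c (dgl g t)"
  by (auto intro!: poly_mapping_eqI simp: lookup_add lookup_minus algebra_simps)

lemma keys_dgl: "Poly_Mapping.keys (dgl g t) = {p \<in> Poly_Mapping.keys t. g p \<noteq> 0}"
  by (auto simp: in_keys_iff)

lemma dgl_mono_word: "dgl g (mono_word p) = scl (g p) (mono_word p)"
  by (auto intro!: poly_mapping_eqI simp: lookup_single when_def)

section \<open>Weights of words, and words of triangular shape\<close>

fun word_weight :: "('x \<Rightarrow> 'h \<Rightarrow> complex) \<Rightarrow> ('h, 'x) word \<Rightarrow> 'h \<Rightarrow> complex" where
  "word_weight b (Gen_h k) h = 0"
| "word_weight b (Gen_e x) h = b x h"
| "word_weight b (Gen_f x) h = - b x h"
| "word_weight b (Br p q) h = word_weight b p h + word_weight b q h"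

fun e_word :: "('h, 'x) word \<Rightarrow> bool" where
  "e_word (Gen_h h) = False"
| "e_word (Gen_e x) = True"
| "e_word (Gen_f x) = False"
| "e_word (Br p q) = (e_word p \<and> e_word q)"

fun f_word :: "('h, 'x) word \<Rightarrow> bool" where
  "f_word (Gen_h h) = False"
| "f_word (Gen_e x) = False"
| "f_word (Gen_f x) = True"
| "f_word (Br p q) = (f_word p \<and> f_word q)"

abbreviation free_space :: "'x set \<Rightarrow> ('h, 'x) root_datum \<Rightarrow> (('h, 'x) word \<Rightarrow>\<^sub>0 complex) set" where
  "free_space X v \<equiv> {t. Poly_Mapping.keys t \<subseteq> words X v}"

text \<open>The pieces of a triangular decomposition. They are only shown to span modulo
  \<open>J\<close>; independence of the pieces is never claimed.\<close>

definition tri_words :: "'x set \<Rightarrow> ('h, 'x) root_datum \<Rightarrow> ('h, 'x) word set" where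
  "tri_words X v = {p \<in> words X v. e_word p \<or> f_word p \<or> (\<exists>h. p = Gen_h h)}"

text \<open>\<open>J\<close> stands for the kernel of the map from the free algebra onto a quotient
  g(v). Congruences modulo \<open>J\<close> keep all elements in one vector space of finitely
  supported functions, instead of cosets of cosets.\<close>

locale lie_ideal =
  fixes X :: "'x set" and v :: "('h::complex_vector, 'x) root_datum"
    and J :: "(('h, 'x) word \<Rightarrow>\<^sub>0 complex) set"
  assumes J_sub: "J \<subseteq> free_space X v"
    and J_subspace: "free_vs.subspace J"
    and J_left: "\<lbrakk>t \<in> J; s \<in> free_space X v\<rbrakk> \<Longrightarrow> free_bracket t s \<in> J"
    and J_right: "\<lbrakk>t \<in> J; s \<in> free_space X v\<rbrakk> \<Longrightarrow> free_bracket s t \<in> J"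
    and J_rel: "relators X v \<subseteq> J"
begin

abbreviation "ad_h h t \<equiv> free_bracket (mono_word (Gen_h h)) t"

lemmas J_add = free_vs.subspace_add[OF J_subspace]
lemmas J_diff = free_vs.subspace_diff[OF J_subspace]
lemmas J_scl = free_vs.subspace_scale[OF J_subspace]
lemmas J_0 = free_vs.subspace_0[OF J_subspace]
lemmas J_neg = free_vs.subspace_neg[OF J_subspace]

lemma J_diff_cancel: "t - s \<in> J \<Longrightarrow> t \<in> J \<longleftrightarrow> s \<in> J"
  using J_add[of "t - s" s] J_diff[of t "t - s"] by auto

lemma J_trans: "t - s \<in> J \<Longrightarrow> s - r \<in> J \<Longrightarrow> t - r \<in> J"
  using J_add[of "t - s" "s - r"] by simp

lemma J_sym: "t - s \<in> J \<Longrightarrow> s - t \<in> J"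
  using J_neg[of "t - s"] by simp

lemma free_space_bracket:
  "\<lbrakk>s \<in> free_space X v; t \<in> free_space X v\<rbrakk> \<Longrightarrow> free_bracket s t \<in> free_space X v"
  using keys_free_bracket[of s "words X v" t "words X v"] by auto

lemma free_space_ops:
  "\<lbrakk>s \<in> free_space X v; t \<in> free_space X v\<rbrakk> \<Longrightarrow> s + t \<in> free_space X v"
  "\<lbrakk>s \<in> free_space X v; t \<in> free_space X v\<rbrakk> \<Longrightarrow> s - t \<in> free_space X v"
  "s \<in> free_space X v \<Longrightarrow> scl c s \<in> free_space X v"
  using free_vs.subspace_add[OF subspace_keys[of "words X v"], of s t]
    free_vs.subspace_diff[OF subspace_keys[of "words X v"], of s t]
    free_vs.subspace_scale[OF subspace_keys[of "words X v"], of s] by auto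

lemma bracket_cong:
  assumes "s - s' \<in> J" "t - t' \<in> J" "s' \<in> free_space X v" "t \<in> free_space X v"
  shows "free_bracket s t - free_bracket s' t' \<in> J"
proof -
  have "free_bracket (s - s') t + free_bracket s' (t - t') \<in> J"
    using assms by (intro J_add J_left J_right)
  then show ?thesis by (simp add: free_bracket_linear)
qed

lemma free_space_induct [consumes 1, case_names word linear]:
  assumes "t \<in> free_space X v" "\<And>w. w \<in> words X v \<Longrightarrow> P (mono_word w)"
    and "free_vs.subspace {t. P t}"
  shows "P t"
proof -
  have "t \<in> free_vs.span (mono_word ` words X v)"
    using assms(1) by (simp add: span_mono_word)
  moreover have "free_vs.span (mono_word ` words X v) \<subseteq> {t. P t}"
    using assms(2,3) by (intro free_vs.span_minimal) auto
  ultimately show ?thesis by blast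
qed

lemma subspace_pre_J:
  assumes "\<And>s t. L (s + t) = L s + L t" "\<And>c t. L (scl c t) = scl c (L t)"
  shows "free_vs.subspace {t. L t \<in> J}"
proof -
  have "L 0 = 0" using assms(2)[of 0 0] by simp
  then show ?thesis unfolding free_vs.subspace_def by (simp add: assms J_0 J_add J_scl)
qed

lemma skew:
  assumes "u \<in> words X v" "t \<in> words X v"
  shows "mono_word (Br u t) + scl (koszul_sign (word_parity (rd_p v) u) (word_parity (rd_p v) t)) (mono_word (Br t u)) \<in> J"
  using relators.skew[OF assms] J_rel by auto

text \<open>The Koszul sign depends on the parities of the first two factors, which therefore stay
  words; the identity is linear in the third.\<close>

lemma jacobi_right:
  assumes "u \<in> words X v" "w \<in> words X v" "t \<in> free_space X v"
  shows "free_bracket (mono_word u) (free_bracket (mono_word w) t)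
    - free_bracket (mono_word (Br u w)) t
    - scl (koszul_sign (word_parity (rd_p v) u) (word_parity (rd_p v) w))
        (free_bracket (mono_word w) (free_bracket (mono_word u) t)) \<in> J"
  using assms(3)
proof (induction rule: free_space_induct)
  case (word t)
  then show ?case using relators.jacobi[OF assms(1,2) word] J_rel by auto
next
  case linear
  show ?case
    by (rule subspace_pre_J)
      (simp_all add: free_bracket_linear free_vs.scale_right_distrib
        free_vs.scale_right_diff_distrib algebra_simps)
qed

text \<open>Elements of \<hh> are even, so Jacobi carries no sign and \<open>ad_h\<close> is a
  derivation modulo \<open>J\<close>: the weights of the two halves of a bracket add.\<close>

lemma ad_h_word:
  assumes "h \<in> rd_space v" "p \<in> words X v"
  shows "mono_word (Br (Gen_h h) p) - scl (word_weight (rd_b v) p h) (mono_word p) \<in> J"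
  using assms(2)
proof (induction p)
  case (Gen_h k)
  then show ?case using relators.hh[OF assms(1), of k] J_rel by auto
next
  case (Gen_e x)
  then show ?case using relators.he[OF assms(1), of x] J_rel by auto
next
  case (Gen_f x)
  then show ?case using relators.hf[OF assms(1), of x] J_rel by (auto simp: single_uminus)
next
  case (Br p q)
  let ?h = "mono_word (Gen_h h)" and ?p = "mono_word p" and ?q = "mono_word q"
  let ?a = "word_weight (rd_b v) p h" and ?c = "word_weight (rd_b v) q h"
  have pq: "p \<in> words X v" "q \<in> words X v" using Br by auto
  have 1: "free_bracket ?h (free_bracket ?p ?q) - free_bracket (free_bracket ?h ?p) ?q
      - free_bracket ?p (free_bracket ?h ?q) \<in> J"
    using jacobi_right[of "Gen_h h" p "mono_word q"] assms(1) pq by (simp add: koszul_sign_def)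
  have 2: "free_bracket (free_bracket ?h ?p - scl ?a ?p) ?q \<in> J"
    using Br pq by (intro J_left) auto
  have 3: "free_bracket ?p (free_bracket ?h ?q - scl ?c ?q) \<in> J"
    using Br pq by (intro J_right) auto
  have "mono_word (Br (Gen_h h) (Br p q)) - scl (word_weight (rd_b v) (Br p q) h) (mono_word (Br p q))
    = (free_bracket ?h (free_bracket ?p ?q) - free_bracket (free_bracket ?h ?p) ?q
      - free_bracket ?p (free_bracket ?h ?q)) + free_bracket (free_bracket ?h ?p - scl ?a ?p) ?q
      + free_bracket ?p (free_bracket ?h ?q - scl ?c ?q)"
    by (simp add: free_bracket_linear single_add del: scl_single free_bracket_single)
      (simp add: single_add)
  then show ?case using 1 2 3 J_add by metis
qed

lemma ad_h_dgl:
  assumes "h \<in> rd_space v" "t \<in> free_space X v"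
  shows "ad_h h t - dgl (\<lambda>p. word_weight (rd_b v) p h) t \<in> J"
  using assms(2)
proof (induction rule: free_space_induct)
  case (word w)
  then show ?case using ad_h_word[OF assms(1)] by (simp add: dgl_mono_word)
next
  case linear
  show ?case
    by (rule subspace_pre_J)
      (simp_all add: free_bracket_linear dgl_simps free_vs.scale_right_diff_distrib algebra_simps)
qed

lemma J_dgl:
  assumes "h \<in> rd_space v" "t \<in> J"
  shows "dgl (\<lambda>p. word_weight (rd_b v) p h) t \<in> J"
proof -
  have "ad_h h t \<in> J" using assms by (intro J_right) auto
  moreover have "ad_h h t - dgl (\<lambda>p. word_weight (rd_b v) p h) t \<in> J"
    using assms J_sub by (intro ad_h_dgl) auto
  ultimately show ?thesis using J_diff_cancel by blast
qed

text \<open>A weight vector of the quotient, seen through a representative. The class may be zero;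
  where that matters, \<open>t \<notin> J\<close> is required separately.\<close>

definition eigen :: "('h \<Rightarrow> complex) \<Rightarrow> (('h, 'x) word \<Rightarrow>\<^sub>0 complex) \<Rightarrow> bool" where
  "eigen \<mu> t \<longleftrightarrow> t \<in> free_space X v \<and> (\<forall>h\<in>rd_space v. ad_h h t - scl (\<mu> h) t \<in> J)"

definition of_weight :: "('h \<Rightarrow> complex) \<Rightarrow> ('h, 'x) word set" where
  "of_weight \<mu> = {p. \<forall>h\<in>rd_space v. word_weight (rd_b v) p h = \<mu> h}"

lemma eigen_word: "p \<in> words X v \<Longrightarrow> eigen (word_weight (rd_b v) p) (mono_word p)"
  using ad_h_word by (auto simp: eigen_def)

lemma eigen_cong: "eigen \<mu> t \<Longrightarrow> t - s \<in> J \<Longrightarrow> eigen \<mu> s"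
proof -
  assume *: "eigen \<mu> t" "t - s \<in> J"
  have s: "s \<in> free_space X v"
    using * J_sub free_space_ops(2)[of t "t - s"] by (auto simp: eigen_def)
  have "ad_h h s - scl (\<mu> h) s \<in> J" if "h \<in> rd_space v" for h
  proof -
    have "ad_h h t - scl (\<mu> h) t - (ad_h h (t - s) - scl (\<mu> h) (t - s)) \<in> J"
      using * that J_diff[OF _ J_diff[OF J_right J_scl], of _ "t - s" _ "t - s"]
      by (auto simp: eigen_def)
    then show ?thesis by (simp add: free_bracket_linear free_vs.scale_right_diff_distrib)
  qed
  then show ?thesis using s by (simp add: eigen_def)
qed

text \<open>The projection to a weight space is a product of operators that are polynomial in
  the adjoint action of \<open>\<hh>\<close>, one factor for each competing weight.\<close>
lemma eigen_projection:
  assumes "eigen \<mu> t"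
  shows "\<exists>s. Poly_Mapping.keys s \<subseteq> Poly_Mapping.keys t \<inter> of_weight \<mu> \<and> t - s \<in> J"
proof -
  let ?w = "word_weight (rd_b v)"
  define B where "B = Poly_Mapping.keys t - of_weight \<mu>"
  have "\<forall>p\<in>B. \<exists>h\<in>rd_space v. ?w p h \<noteq> \<mu> h" by (auto simp: B_def of_weight_def)
  then obtain k where k: "\<And>p. p \<in> B \<Longrightarrow> k p \<in> rd_space v" "\<And>p. p \<in> B \<Longrightarrow> ?w p (k p) \<noteq> \<mu> (k p)"
    by metis
  \<comment> \<open>A Lagrange factor: 0 at the word \<open>p\<close> and 1 at every word of weight
    \<open>\<mu>\<close>. The element \<open>k p\<close> of \<hh> separates the weight of
    \<open>p\<close> from \<open>\<mu>\<close>.\<close>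
  define g where "g p q = (?w q (k p) - ?w p (k p)) / (\<mu> (k p) - ?w p (k p))" for p q
  have finB: "finite B" by (simp add: B_def)
  have "dgl (\<lambda>q. \<Prod>p\<in>C. g p q) t - t \<in> J" if "C \<subseteq> B" for C
    using finite_subset[OF that finB] that
  proof (induction C rule: finite_induct)
    case empty
    then show ?case by (simp add: dgl_simps J_0)
  next
    case (insert p C)
    let ?h = "k p" and ?r = "dgl (\<lambda>q. \<Prod>p\<in>C. g p q) t"
    let ?c = "inverse (\<mu> ?h - ?w p ?h)"
    have h: "?h \<in> rd_space v" and ne: "\<mu> ?h - ?w p ?h \<noteq> 0" using k[of p] insert by auto
    have IH: "?r - t \<in> J" using insert by auto
    have tF: "t \<in> free_space X v" using assms by (simp add: eigen_def)
    have D: "dgl (g p) s = scl ?c (dgl (\<lambda>q. ?w q ?h) s - scl (?w p ?h) s)" for s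
    proof -
      have "g p = (\<lambda>q. ?c * (?w q ?h - ?w p ?h))" by (auto simp: g_def field_simps)
      then show ?thesis by (simp only: dgl_simps)
    qed
    have "dgl (g p) (?r - t) \<in> J"
      unfolding D by (intro J_scl J_diff J_dgl h IH)
    \<comment> \<open>The factor is affine in the action of \<open>k p\<close>, and \<open>t\<close>
      is a weight vector for \<open>\<mu>\<close>, so it acts on \<open>t\<close> as 1 modulo
      \<open>J\<close>.\<close>
    moreover have "dgl (g p) t - t \<in> J"
    proof -
      have "dgl (\<lambda>q. ?w q ?h) t - scl (\<mu> ?h) t \<in> J"
        using J_trans[OF J_sym[OF ad_h_dgl[OF h tF]], of "scl (\<mu> ?h) t"] assms h
        unfolding eigen_def by blast
      then have "scl ?c (dgl (\<lambda>q. ?w q ?h) t - scl (\<mu> ?h) t) \<in> J" by (rule J_scl)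
      moreover have "scl ?c (dgl (\<lambda>q. ?w q ?h) t - scl (\<mu> ?h) t) = dgl (g p) t - t"
      proof -
        have "scl ?c (scl (\<mu> ?h) t) - scl ?c (scl (?w p ?h) t) = t"
          using ne by (simp flip: free_vs.scale_left_diff_distrib right_diff_distrib)
        then have *: "scl ?c (scl (?w p ?h) t) = scl ?c (scl (\<mu> ?h) t) - t"
          by (simp only: algebra_simps)
        show ?thesis unfolding D free_vs.scale_right_diff_distrib * by (simp only: algebra_simps)
      qed
      ultimately show ?thesis by simp
    qed
    ultimately have "dgl (g p) (?r - t) + (dgl (g p) t - t) \<in> J" by (rule J_add)
    moreover have "dgl (g p) (?r - t) + (dgl (g p) t - t) = dgl (\<lambda>q. \<Prod>p\<in>insert p C. g p q) t - t"
      using insert(1,2) by (simp add: dgl_simps)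
    ultimately show ?case by simp
  qed
  from this[of B] have 1: "dgl (\<lambda>q. \<Prod>p\<in>B. g p q) t - t \<in> J" by simp
  have "Poly_Mapping.keys (dgl (\<lambda>q. \<Prod>p\<in>B. g p q) t) \<subseteq> Poly_Mapping.keys t \<inter> of_weight \<mu>"
  proof -
    have "(\<Prod>p\<in>B. g p q) = 0" if "q \<in> B" for q
      using that finB by (intro prod_zero) (auto simp: g_def intro!: bexI[of _ q])
    then show ?thesis by (auto simp: keys_dgl B_def)
  qed
  then show ?thesis using 1 J_sym by blast
qed

definition mod_span :: "('h, 'x) word set \<Rightarrow> (('h, 'x) word \<Rightarrow>\<^sub>0 complex) set" where
  "mod_span A = free_vs.span (mono_word ` A \<union> J)"

lemma mod_span_subspace: "free_vs.subspace (mod_span A)"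
  by (simp add: mod_span_def)

lemma mod_span_base: "p \<in> A \<Longrightarrow> mono_word p \<in> mod_span A" "t \<in> J \<Longrightarrow> t \<in> mod_span A"
  by (auto simp: mod_span_def intro: free_vs.span_base)

lemmas mod_span_add = free_vs.subspace_add[OF mod_span_subspace]
lemmas mod_span_diff = free_vs.subspace_diff[OF mod_span_subspace]
lemmas mod_span_scl = free_vs.subspace_scale[OF mod_span_subspace]

lemma mod_span_cong: "s \<in> mod_span A \<Longrightarrow> t - s \<in> J \<Longrightarrow> t \<in> mod_span A"
  using mod_span_add mod_span_base(2) by (metis diff_add_cancel)

lemma mod_span_mono: "A \<subseteq> B \<Longrightarrow> mod_span A \<subseteq> mod_span B"
  unfolding mod_span_def by (intro free_vs.span_mono) auto

lemma mod_span_free: "A \<subseteq> words X v \<Longrightarrow> mod_span A \<subseteq> free_space X v"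
  unfolding mod_span_def using J_sub by (intro free_vs.span_minimal subspace_keys) auto

lemma mod_spanE:
  assumes "t \<in> mod_span A"
  obtains s where "Poly_Mapping.keys s \<subseteq> A" "t - s \<in> J"
proof -
  have "free_vs.span J = J" using J_subspace by simp
  then obtain s j where "t = s + j" "s \<in> free_vs.span (mono_word ` A)" "j \<in> J"
    using assms unfolding mod_span_def free_vs.span_Un by blast
  then show ?thesis using that by (auto simp: span_mono_word)
qed

lemma mod_span_bracket:
  assumes "A \<subseteq> words X v" "B \<subseteq> words X v"
    and "\<And>p q. p \<in> A \<Longrightarrow> q \<in> B \<Longrightarrow> mono_word (Br p q) \<in> mod_span C"
    and "s \<in> mod_span A" "t \<in> mod_span B"
  shows "free_bracket s t \<in> mod_span C"
proof -
  have t: "t \<in> free_space X v" using assms mod_span_free by blast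
  have "mod_span A \<subseteq> {s. free_bracket s t \<in> mod_span C}"
    unfolding mod_span_def[of A]
  proof (intro free_vs.span_minimal subsetI)
    fix s assume "s \<in> mono_word ` A \<union> J"
    then show "s \<in> {s. free_bracket s t \<in> mod_span C}"
    proof
      assume "s \<in> J" then show ?thesis using J_left t mod_span_base by blast
    next
      assume "s \<in> mono_word ` A"
      then obtain p where p: "p \<in> A" "s = mono_word p" by blast
      have "mod_span B \<subseteq> {t. free_bracket s t \<in> mod_span C}"
        unfolding mod_span_def[of B]
      proof (intro free_vs.span_minimal subsetI)
        fix t assume "t \<in> mono_word ` B \<union> J"
        then show "t \<in> {t. free_bracket s t \<in> mod_span C}"
          using assms(3)[OF p(1)] p assms(1) J_right[of t s] mod_span_base(2) by auto
      next
        show "free_vs.subspace {t. free_bracket s t \<in> mod_span C}"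
          using mod_span_subspace[of C] unfolding free_vs.subspace_def by (simp add: free_bracket_linear)
      qed
      then show ?thesis using assms(5) by blast
    qed
  next
    show "free_vs.subspace {s. free_bracket s t \<in> mod_span C}"
      using mod_span_subspace[of C] unfolding free_vs.subspace_def by (simp add: free_bracket_linear)
  qed
  then show ?thesis using assms(4) by blast
qed

lemma mod_span_skew:
  assumes "p \<in> words X v" "q \<in> words X v" "mono_word (Br p q) \<in> mod_span A"
  shows "mono_word (Br q p) \<in> mod_span A"
proof -
  let ?k = "koszul_sign (word_parity (rd_p v) q) (word_parity (rd_p v) p)"
  have "mono_word (Br q p) + scl ?k (mono_word (Br p q)) - scl ?k (mono_word (Br p q)) \<in> mod_span A"
    using skew[OF assms(2,1)] by (intro mod_span_diff mod_span_scl assms(3)) (rule mod_span_base)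
  then show ?thesis by simp
qed

lemma mod_span_h_word:
  assumes "h \<in> rd_space v" "p \<in> A" "A \<subseteq> words X v"
  shows "mono_word (Br (Gen_h h) p) \<in> mod_span A"
  using ad_h_word[OF assms(1), of p] assms
  by (intro mod_span_cong[OF mod_span_scl[OF mod_span_base(1)]]) auto

end

section \<open>Triangular decomposition modulo an ideal\<close>

locale lie_ideal_root = lie_ideal +
  assumes root: "v \<in> root_data X"
begin

lemma a_space: "x \<in> X \<Longrightarrow> rd_a v x \<in> rd_space v"
  using root by (auto simp: root_data_def PiE_def Pi_def)

definition fh_words :: "('b, 'a) word set" where
  "fh_words = {p \<in> words X v. f_word p \<or> (\<exists>h. p = Gen_h h)}"

text \<open>Jacobi pushes e_x through a product of f's until it meets one generator, where it gives
  0 or the element a(x) of \<hh>; bracketing that with the remaining f-words only rescales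
  them.\<close>

lemma e_f_word:
  assumes "x \<in> X" "q \<in> words X v" "f_word q"
  shows "mono_word (Br (Gen_e x) q) \<in> mod_span fh_words"
  using assms(2,3)
proof (induction q)
  case (Gen_f y)
  show ?case
  proof (cases "x = y")
    case True
    then show ?thesis using relators.ef_same[OF assms(1)] J_rel a_space[OF assms(1)]
      by (intro mod_span_cong[OF mod_span_base(1)[of "Gen_h (rd_a v x)"]]) (auto simp: fh_words_def)
  next
    case False
    then show ?thesis using relators.ef[OF assms(1), of y] Gen_f J_rel by (auto intro: mod_span_base)
  qed
next
  case (Br p q)
  let ?e = "mono_word (Gen_e x)"
  let ?k = "koszul_sign (word_parity (rd_p v) (Gen_e x :: ('b, 'a) word)) (word_parity (rd_p v) p)"
  have pq: "p \<in> words X v" "q \<in> words X v" "f_word p" "f_word q" using Br by auto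
  have sub: "fh_words \<subseteq> words X v" "{p \<in> words X v. f_word p} \<subseteq> words X v" by (auto simp: fh_words_def)
  have fhf: "mono_word (Br r s) \<in> mod_span fh_words"
    if "r \<in> fh_words" "s \<in> {p \<in> words X v. f_word p}" for r s
    using that unfolding fh_words_def
    by (auto intro: mod_span_base intro!: subsetD[OF mod_span_mono mod_span_h_word[OF _ _ sub(2)]])
  have ffh: "mono_word (Br s r) \<in> mod_span fh_words"
    if "r \<in> fh_words" "s \<in> {p \<in> words X v. f_word p}" for r s
    using fhf[OF that] that by (intro mod_span_skew[of r s]) (auto simp: fh_words_def)
  have 1: "free_bracket (mono_word (Br (Gen_e x) p)) (mono_word q) \<in> mod_span fh_words"
    using Br pq by (intro mod_span_bracket[OF sub fhf] mod_span_base(1)[of q]) auto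
  have 2: "free_bracket (mono_word p) (mono_word (Br (Gen_e x) q)) \<in> mod_span fh_words"
    using Br pq by (intro mod_span_bracket[OF sub(2,1) ffh] mod_span_base(1)[of p]) auto
  have "mono_word (Br (Gen_e x) (Br p q)) - (mono_word (Br (Br (Gen_e x) p) q)
      + scl ?k (mono_word (Br p (Br (Gen_e x) q)))) \<in> J"
    using jacobi_right[of "Gen_e x" p "mono_word q"] assms(1) pq by (simp add: diff_diff_eq)
  then show ?case
    using 1 2 by (elim mod_span_cong[rotated]) (auto intro!: mod_span_add mod_span_scl simp del: scl_single)
qed (auto)

lemma tri_sub: "tri_words X v \<subseteq> words X v" by (auto simp: tri_words_def)

text \<open>A generator e_x sends e-words to e-words, elements of \<hh> to multiples of e_x, and
  f-words to combinations of f-words and \<hh>. A longer e-word acts, by Jacobi, as a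
  supercommutator of shorter ones.\<close>

lemma e_word_tri:
  assumes "p \<in> words X v" "e_word p" "t \<in> mod_span (tri_words X v)"
  shows "free_bracket (mono_word p) t \<in> mod_span (tri_words X v)"
  using assms
proof (induction p arbitrary: t)
  case (Gen_e x)
  have x: "x \<in> X" using Gen_e by auto
  show ?case
  proof (rule mod_span_bracket[of "{Gen_e x}" "tri_words X v"])
    fix p q assume *: "p \<in> {Gen_e x :: ('b, 'a) word}" "q \<in> tri_words X v"
    then consider "e_word q" | "f_word q" | h where "q = Gen_h h" "h \<in> rd_space v"
      by (auto simp: tri_words_def)
    then show "mono_word (Br p q) \<in> mod_span (tri_words X v)"
    proof cases
      case 1
      then show ?thesis using * x by (intro mod_span_base(1)) (auto simp: tri_words_def)
    next
      case 2
      have "fh_words \<subseteq> tri_words X v" by (auto simp: tri_words_def fh_words_def)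
      then show ?thesis using 2 * e_f_word[OF x, of q] mod_span_mono tri_sub by blast
    next
      case 3
      have p: "p \<in> tri_words X v" using * x by (auto simp: tri_words_def)
      show ?thesis
        using mod_span_skew[of q p] mod_span_h_word[OF 3(2) p tri_sub] 3 p tri_sub * by blast
    qed
  next
    show "{Gen_e x} \<subseteq> words X v" using x by simp
  qed (simp_all add: tri_sub mod_span_base(1) Gen_e.prems)
next
  case (Br p q)
  have tF: "t \<in> free_space X v" using Br mod_span_free[OF tri_sub] by blast
  let ?k = "koszul_sign (word_parity (rd_p v) p) (word_parity (rd_p v) q)"
  have 1: "free_bracket (mono_word p) (free_bracket (mono_word q) t) \<in> mod_span (tri_words X v)"
    and 2: "free_bracket (mono_word q) (free_bracket (mono_word p) t) \<in> mod_span (tri_words X v)"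
    using Br by auto
  let ?A = "free_bracket (mono_word p) (free_bracket (mono_word q) t)"
    and ?B = "scl ?k (free_bracket (mono_word q) (free_bracket (mono_word p) t))"
    and ?C = "free_bracket (mono_word (Br p q)) t"
  have "?A - ?C - ?B \<in> J" using jacobi_right[of p q t] Br tF by auto
  then have "?C - (?A - ?B) \<in> J" using J_sym[of "?A - ?B" ?C] by (simp add: algebra_simps)
  then show ?case using mod_span_cong[OF mod_span_diff[OF 1 mod_span_scl[OF 2]]] by blast
qed auto

text \<open>After an exchange by skew symmetry the left factor is an e-word or lies in \<hh>; the
  only other case, two f-words, gives an f-word.\<close>

lemma words_tri: "p \<in> words X v \<Longrightarrow> mono_word p \<in> mod_span (tri_words X v)"
proof (induction p)
  case (Br p q)
  have "free_bracket (mono_word p) (mono_word q) \<in> mod_span (tri_words X v)"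
  proof (rule mod_span_bracket[OF tri_sub tri_sub])
    fix p q assume *: "p \<in> tri_words X v" "q \<in> tri_words X v"
    then have w: "p \<in> words X v" "q \<in> words X v" by (auto simp: tri_words_def)
    consider "e_word p" | "e_word q" | h where "p = Gen_h h" "h \<in> rd_space v"
      | h where "q = Gen_h h" "h \<in> rd_space v" | "f_word p" "f_word q"
      using * by (auto simp: tri_words_def)
    then show "mono_word (Br p q) \<in> mod_span (tri_words X v)"
    proof cases
      case 1
      then show ?thesis using e_word_tri[OF w(1) 1 mod_span_base(1)[OF *(2)]] by simp
    next
      case 2
      then show ?thesis
        using mod_span_skew[OF w(2,1)] e_word_tri[OF w(2) 2 mod_span_base(1)[OF *(1)]] by simp
    next
      case 3
      then show ?thesis using mod_span_h_word[OF _ *(2) tri_sub] by simp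
    next
      case 4
      then show ?thesis using mod_span_skew[OF w(2,1)] mod_span_h_word[OF _ *(1) tri_sub] by simp
    next
      case 5
      then show ?thesis using w by (intro mod_span_base(1)) (auto simp: tri_words_def)
    qed
  qed (use Br in auto)
  then show ?case by simp
qed (auto simp: tri_words_def intro!: mod_span_base(1))

text \<open>The source of all sign statements: e-words have weights that are nonnegative
  combinations of the b's, f-words nonpositive ones, so a weight vector that is nonzero modulo
  \<open>J\<close> has a weight of one of these kinds.\<close>

lemma eigen_tri:
  assumes "eigen \<mu> t"
  shows "\<exists>s. Poly_Mapping.keys s \<subseteq> tri_words X v \<inter> of_weight \<mu> \<and> t - s \<in> J"
proof -
  have "t \<in> free_space X v" using assms by (simp add: eigen_def)
  then have "t \<in> mod_span (tri_words X v)"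
    by (induction rule: free_space_induct) (use words_tri mod_span_subspace in auto)
  then obtain s where s: "Poly_Mapping.keys s \<subseteq> tri_words X v" "t - s \<in> J" by (rule mod_spanE)
  then have "eigen \<mu> s" using assms eigen_cong by blast
  from eigen_projection[OF this] obtain r where
    "Poly_Mapping.keys r \<subseteq> Poly_Mapping.keys s \<inter> of_weight \<mu>" "s - r \<in> J" by blast
  then show ?thesis using s J_trans by blast
qed

end

section \<open>Quotients of superalgebras\<close>

text \<open>The bracket is not associative and the unit field is a dummy, so this is not a ring. The
  laws listed are those that coset arithmetic uses, and they pass to images under
  \<open>super_epi\<close>.\<close>

locale bracket_algebra = abelian_group L for L :: "'g superalgebra" (structure) +
  assumes mult_closed: "\<lbrakk>x \<in> carrier L; y \<in> carrier L\<rbrakk> \<Longrightarrow> x \<otimes> y \<in> carrier L"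
    and mult_add_left: "\<lbrakk>x \<in> carrier L; y \<in> carrier L; z \<in> carrier L\<rbrakk> \<Longrightarrow>
      (x \<oplus> y) \<otimes> z = x \<otimes> z \<oplus> y \<otimes> z"
    and mult_add_right: "\<lbrakk>x \<in> carrier L; y \<in> carrier L; z \<in> carrier L\<rbrakk> \<Longrightarrow>
      z \<otimes> (x \<oplus> y) = z \<otimes> x \<oplus> z \<otimes> y"
    and smult_closed: "x \<in> carrier L \<Longrightarrow> c \<odot> x \<in> carrier L"
    and smult_add: "\<lbrakk>x \<in> carrier L; y \<in> carrier L\<rbrakk> \<Longrightarrow> c \<odot> (x \<oplus> y) = c \<odot> x \<oplus> c \<odot> y"
    and part_carrier: "part L d \<subseteq> carrier L"

definition super_epi :: "'g superalgebra \<Rightarrow> 'k superalgebra \<Rightarrow> ('g \<Rightarrow> 'k) \<Rightarrow> bool" where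
  "super_epi L M f \<longleftrightarrow> f ` carrier L = carrier M \<and> f \<zero>\<^bsub>L\<^esub> = \<zero>\<^bsub>M\<^esub>
    \<and> (\<forall>x\<in>carrier L. \<forall>y\<in>carrier L. f (x \<oplus>\<^bsub>L\<^esub> y) = f x \<oplus>\<^bsub>M\<^esub> f y)
    \<and> (\<forall>c. \<forall>x\<in>carrier L. f (c \<odot>\<^bsub>L\<^esub> x) = c \<odot>\<^bsub>M\<^esub> f x)
    \<and> (\<forall>x\<in>carrier L. \<forall>y\<in>carrier L. f (x \<otimes>\<^bsub>L\<^esub> y) = f x \<otimes>\<^bsub>M\<^esub> f y)
    \<and> (\<forall>d. f ` part L d = part M d)"

lemma super_epi_comp:
  assumes "super_epi L M f" "super_epi M N g"
  shows "super_epi L N (g \<circ> f)"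
proof -
  have [simp]: "f x \<in> carrier M" if "x \<in> carrier L" for x
    using assms(1) that unfolding super_epi_def by blast
  have "(g \<circ> f) ` carrier L = carrier N" "\<And>d. (g \<circ> f) ` part L d = part N d"
    using assms unfolding super_epi_def by (metis image_comp)+
  then show ?thesis using assms unfolding super_epi_def by simp
qed

lemma bracket_algebra_epi:
  assumes "bracket_algebra L" "super_epi L M f"
  shows "bracket_algebra M"
proof -
  interpret L: bracket_algebra L by fact
  have car: "carrier M = f ` carrier L" and z: "\<zero>\<^bsub>M\<^esub> = f \<zero>\<^bsub>L\<^esub>"
    and pt: "part M d = f ` part L d" for d
    using assms(2) by (auto simp: super_epi_def)
  have add: "f x \<oplus>\<^bsub>M\<^esub> f y = f (x \<oplus>\<^bsub>L\<^esub> y)" and mul: "f x \<otimes>\<^bsub>M\<^esub> f y = f (x \<otimes>\<^bsub>L\<^esub> y)"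
    if "x \<in> carrier L" "y \<in> carrier L" for x y
    using assms(2) that by (auto simp: super_epi_def)
  have sm: "c \<odot>\<^bsub>M\<^esub> f x = f (c \<odot>\<^bsub>L\<^esub> x)" if "x \<in> carrier L" for c x
    using assms(2) that by (auto simp: super_epi_def)
  interpret M: abelian_group M
  proof (rule abelian_groupI)
    fix x assume "x \<in> carrier M"
    then obtain a where a: "a \<in> carrier L" "x = f a" by (auto simp: car)
    then show "\<exists>y\<in>carrier M. y \<oplus>\<^bsub>M\<^esub> x = \<zero>\<^bsub>M\<^esub>"
      by (auto simp: car z add L.l_neg intro!: bexI[of _ "\<ominus>\<^bsub>L\<^esub> a"])
  qed (auto simp: car z add L.a_assoc L.a_comm L.a_lcomm)
  show ?thesis
  proof (unfold_locales)
    show "part M d \<subseteq> carrier M" for d using L.part_carrier[of d] by (auto simp: pt car)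
  qed (auto simp: car add mul sm L.mult_closed L.mult_add_left L.mult_add_right
      L.smult_closed L.smult_add)
qed

lemma graded_ideal_coset:
  assumes "bracket_algebra L" "graded_ideal L I"
  shows "super_epi L (quotient_superalgebra L I) (\<lambda>x. I +>\<^bsub>L\<^esub> x)"
    and "\<And>x. x \<in> carrier L \<Longrightarrow> I +>\<^bsub>L\<^esub> x = I \<longleftrightarrow> x \<in> I"
proof -
  interpret L: bracket_algebra L by fact
  have "additive_subgroup I L" using assms(2) by (simp add: graded_ideal_def)
  then interpret I: abelian_subgroup I L by (intro abelian_subgroupI3 L.abelian_group_axioms)
  note rep = L.a_repr_independence[OF _ _ I.a_subgroup]
  have Ic: "I \<subseteq> carrier L" by (rule I.a_subset)
  have mulI: "x \<otimes>\<^bsub>L\<^esub> y \<in> I" "y \<otimes>\<^bsub>L\<^esub> x \<in> I" if "x \<in> I" "y \<in> carrier L" for x y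
    using assms(2) that by (auto simp: graded_ideal_def)
  have smI: "c \<odot>\<^bsub>L\<^esub> x \<in> I" if "x \<in> I" for c x
    using assms(2) that by (auto simp: graded_ideal_def)
  have self: "x \<in> I +>\<^bsub>L\<^esub> x" if "x \<in> carrier L" for x
    using that by (rule I.a_rcos_self)
  have elem: "\<exists>i\<in>I. a = i \<oplus>\<^bsub>L\<^esub> x" if "a \<in> I +>\<^bsub>L\<^esub> x" for a x
    using that by (auto simp: a_r_coset_def')
  have shift: "I +>\<^bsub>L\<^esub> (i \<oplus>\<^bsub>L\<^esub> x) = I +>\<^bsub>L\<^esub> x" if "i \<in> I" "x \<in> carrier L" for i x
    using rep[symmetric, OF L.a_rcosI] that Ic by blast
  \<comment> \<open>\<open>rcoset_mult\<close> is a union over all pairs of representatives; the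
    ideal property makes every member of that union the same coset.\<close>
  have mult: "(I +>\<^bsub>L\<^esub> (x \<otimes>\<^bsub>L\<^esub> y)) = rcoset_mult L I (I +>\<^bsub>L\<^esub> x) (I +>\<^bsub>L\<^esub> y)"
    if xy: "x \<in> carrier L" "y \<in> carrier L" for x y
  proof -
    have "I +>\<^bsub>L\<^esub> (a \<otimes>\<^bsub>L\<^esub> b) = I +>\<^bsub>L\<^esub> (x \<otimes>\<^bsub>L\<^esub> y)"
      if a: "a \<in> I +>\<^bsub>L\<^esub> x" and b: "b \<in> I +>\<^bsub>L\<^esub> y" for a b
    proof -
      obtain i j where ij: "i \<in> I" "a = i \<oplus>\<^bsub>L\<^esub> x" "j \<in> I" "b = j \<oplus>\<^bsub>L\<^esub> y"
        using elem[OF a] elem[OF b] by blast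
      have c: "i \<in> carrier L" "j \<in> carrier L" using ij Ic by auto
      have "a \<otimes>\<^bsub>L\<^esub> b = i \<otimes>\<^bsub>L\<^esub> (j \<oplus>\<^bsub>L\<^esub> y) \<oplus>\<^bsub>L\<^esub> (x \<otimes>\<^bsub>L\<^esub> j \<oplus>\<^bsub>L\<^esub> x \<otimes>\<^bsub>L\<^esub> y)"
        using ij c xy by (simp add: L.mult_add_left L.mult_add_right L.mult_closed L.a_ac)
      moreover have "I +>\<^bsub>L\<^esub> (x \<otimes>\<^bsub>L\<^esub> j \<oplus>\<^bsub>L\<^esub> x \<otimes>\<^bsub>L\<^esub> y) = I +>\<^bsub>L\<^esub> (x \<otimes>\<^bsub>L\<^esub> y)"
        using ij xy c by (intro shift mulI L.mult_closed)
      ultimately show ?thesis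
        using shift[of "i \<otimes>\<^bsub>L\<^esub> (j \<oplus>\<^bsub>L\<^esub> y)"] ij xy c by (simp add: L.mult_closed mulI)
    qed
    then show ?thesis using self[OF xy(1)] self[OF xy(2)] unfolding rcoset_mult_def by blast
  qed
  have smult: "(I +>\<^bsub>L\<^esub> (c \<odot>\<^bsub>L\<^esub> x)) = (\<Union>a\<in>I +>\<^bsub>L\<^esub> x. I +>\<^bsub>L\<^esub> (c \<odot>\<^bsub>L\<^esub> a))"
    if x: "x \<in> carrier L" for c x
  proof -
    have "I +>\<^bsub>L\<^esub> (c \<odot>\<^bsub>L\<^esub> a) = I +>\<^bsub>L\<^esub> (c \<odot>\<^bsub>L\<^esub> x)" if a: "a \<in> I +>\<^bsub>L\<^esub> x" for a
    proof -
      obtain i where i: "i \<in> I" "a = i \<oplus>\<^bsub>L\<^esub> x" using elem[OF a] by metis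
      then have "c \<odot>\<^bsub>L\<^esub> a = c \<odot>\<^bsub>L\<^esub> i \<oplus>\<^bsub>L\<^esub> c \<odot>\<^bsub>L\<^esub> x" using Ic x by (auto simp: L.smult_add)
      then show ?thesis using i x by (simp add: shift smI L.smult_closed)
    qed
    then show ?thesis using self[OF x] by blast
  qed
  show "super_epi L (quotient_superalgebra L I) (\<lambda>x. I +>\<^bsub>L\<^esub> x)"
    unfolding super_epi_def
  proof (intro conjI allI ballI)
    fix c x assume "x \<in> carrier L"
    from smult[OF this] show "I +>\<^bsub>L\<^esub> (c \<odot>\<^bsub>L\<^esub> x) = c \<odot>\<^bsub>quotient_superalgebra L I\<^esub> (I +>\<^bsub>L\<^esub> x)"
      unfolding quotient_superalgebra_def by simp
  next
    show "(\<lambda>x. I +>\<^bsub>L\<^esub> x) ` carrier L = carrier (quotient_superalgebra L I)"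
      unfolding quotient_superalgebra_def partial_object.simps A_RCOSETS_def' by blast
  next
    show "I +>\<^bsub>L\<^esub> \<zero>\<^bsub>L\<^esub> = \<zero>\<^bsub>quotient_superalgebra L I\<^esub>"
      unfolding quotient_superalgebra_def ring.simps using Ic by simp
  next
    fix x y assume xy: "x \<in> carrier L" "y \<in> carrier L"
    show "I +>\<^bsub>L\<^esub> (x \<otimes>\<^bsub>L\<^esub> y) = (I +>\<^bsub>L\<^esub> x) \<otimes>\<^bsub>quotient_superalgebra L I\<^esub> (I +>\<^bsub>L\<^esub> y)"
      unfolding quotient_superalgebra_def monoid.simps by (rule mult[OF xy])
    show "I +>\<^bsub>L\<^esub> (x \<oplus>\<^bsub>L\<^esub> y) = (I +>\<^bsub>L\<^esub> x) \<oplus>\<^bsub>quotient_superalgebra L I\<^esub> (I +>\<^bsub>L\<^esub> y)"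
      unfolding quotient_superalgebra_def ring.simps by (rule I.a_rcos_sum[OF xy, symmetric])
  qed (simp add: quotient_superalgebra_def)
  show "I +>\<^bsub>L\<^esub> x = I \<longleftrightarrow> x \<in> I" if "x \<in> carrier L" for x
    using L.a_coset_join1[OF _ that I.a_subgroup] L.a_coset_join2[OF that I.a_subgroup] by metis
qed

text \<open>Lets g(v), a quotient of a quotient, be reached from the free algebra by a single map
  with known kernel.\<close>

lemma super_epi_kernel_pull:
  assumes L: "bracket_algebra L" and f: "super_epi L M f" and I: "graded_ideal M I"
  shows "super_epi L (quotient_superalgebra M I) (\<lambda>x. I +>\<^bsub>M\<^esub> f x)"
    and "\<And>x. x \<in> carrier L \<Longrightarrow> I +>\<^bsub>M\<^esub> f x = I \<longleftrightarrow> f x \<in> I"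
proof -
  have M: "bracket_algebra M" using bracket_algebra_epi[OF L f] .
  show "super_epi L (quotient_superalgebra M I) (\<lambda>x. I +>\<^bsub>M\<^esub> f x)"
    using super_epi_comp[OF f graded_ideal_coset(1)[OF M I]] by (simp add: comp_def)
  show "I +>\<^bsub>M\<^esub> f x = I \<longleftrightarrow> f x \<in> I" if "x \<in> carrier L" for x
    using graded_ideal_coset(2)[OF M I, of "f x"] f that by (auto simp: super_epi_def)
qed

section \<open>Graded ideals of the free superalgebra\<close>

lemma free_superalgebra_simps:
  "carrier (free_superalgebra X v) = free_space X v"
  "s \<otimes>\<^bsub>free_superalgebra X v\<^esub> t = free_bracket s t"
  "\<zero>\<^bsub>free_superalgebra X v\<^esub> = 0"
  "s \<oplus>\<^bsub>free_superalgebra X v\<^esub> t = s + t"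
  "c \<odot>\<^bsub>free_superalgebra X v\<^esub> t = scl c t"
  "part (free_superalgebra X v) d = {t. Poly_Mapping.keys t \<subseteq> {w \<in> words X v. word_parity (rd_p v) w = d}}"
  by (auto simp: free_superalgebra_def scl_def)

lemma bracket_algebra_free: "bracket_algebra (free_superalgebra X v)"
proof -
  interpret abelian_group "free_superalgebra X v"
  proof (rule abelian_groupI)
    fix s assume "s \<in> carrier (free_superalgebra X v)"
    then show "\<exists>y\<in>carrier (free_superalgebra X v).
        y \<oplus>\<^bsub>free_superalgebra X v\<^esub> s = \<zero>\<^bsub>free_superalgebra X v\<^esub>"
      using free_vs.subspace_neg[OF subspace_keys[of "words X v"]]
      by (intro bexI[of _ "- s"]) (auto simp: free_superalgebra_simps)
  qed (use free_vs.subspace_add[OF subspace_keys[of "words X v"]] in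
      \<open>auto simp: free_superalgebra_simps algebra_simps\<close>)
  show ?thesis
  proof
    fix s t assume "s \<in> carrier (free_superalgebra X v)" "t \<in> carrier (free_superalgebra X v)"
    then show "s \<otimes>\<^bsub>free_superalgebra X v\<^esub> t \<in> carrier (free_superalgebra X v)"
      using keys_free_bracket[of s "words X v" t "words X v"] by (auto simp: free_superalgebra_simps)
  next
    fix c s assume "s \<in> carrier (free_superalgebra X v)"
    then show "c \<odot>\<^bsub>free_superalgebra X v\<^esub> s \<in> carrier (free_superalgebra X v)"
      using keys_scl[of c s] by (auto simp: free_superalgebra_simps)
  qed (auto simp: free_superalgebra_simps free_bracket_linear free_vs.scale_right_distrib)
qed

abbreviation parity_part :: "('x \<Rightarrow> bit) \<Rightarrow> bit \<Rightarrow> (('h, 'x) word \<Rightarrow>\<^sub>0 complex) \<Rightarrow> (('h, 'x) word \<Rightarrow>\<^sub>0 complex)" where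
  "parity_part p d \<equiv> dgl (\<lambda>w. if word_parity p w = d then 1 else 0)"

lemma parity_part_decomp:
  assumes "Poly_Mapping.keys x0 \<subseteq> {w. word_parity p w = 0}"
    "Poly_Mapping.keys x1 \<subseteq> {w. word_parity p w = 1}"
  shows "parity_part p 0 (x0 + x1) = x0" "parity_part p 1 (x0 + x1) = x1"
proof -
  have "parity_part p 0 x0 = x0" "parity_part p 0 x1 = 0" "parity_part p 1 x0 = 0" "parity_part p 1 x1 = x1"
    using assms by (auto intro!: poly_mapping_eqI simp: in_keys_iff subset_iff)
  then show "parity_part p 0 (x0 + x1) = x0" "parity_part p 1 (x0 + x1) = x1"
    by (simp_all add: dgl_simps)
qed

text \<open>Closure under the parity projections is visibly inherited by intersections, which the
  existence of a homogeneous decomposition is not; this is how \<open>relation_ideal\<close> is seen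
  to be graded.\<close>

lemma graded_ideal_free_iff:
  "graded_ideal (free_superalgebra X v) J \<longleftrightarrow>
     free_vs.subspace J \<and> J \<subseteq> free_space X v
     \<and> (\<forall>s\<in>J. \<forall>t\<in>free_space X v. free_bracket s t \<in> J \<and> free_bracket t s \<in> J)
     \<and> (\<forall>t\<in>J. \<forall>d. parity_part (rd_p v) d t \<in> J)" (is "?L \<longleftrightarrow> ?R")
proof
  assume L: ?L
  then have sub: "additive_subgroup J (free_superalgebra X v)" by (simp add: graded_ideal_def)
  interpret F: bracket_algebra "free_superalgebra X v" by (rule bracket_algebra_free)
  interpret J: abelian_subgroup J "free_superalgebra X v"
    by (intro abelian_subgroupI3 F.abelian_group_axioms sub)
  have "free_vs.subspace J"
    using J.zero_closed J.a_closed L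
    by (intro free_vs.subspaceI) (simp_all add: free_superalgebra_simps graded_ideal_def)
  moreover have "parity_part (rd_p v) d t \<in> J" if t: "t \<in> J" for t d
  proof -
    obtain x0 x1 where x: "x0 \<in> J \<inter> part (free_superalgebra X v) 0"
      "x1 \<in> J \<inter> part (free_superalgebra X v) 1" "t = x0 + x1"
      using t L unfolding graded_ideal_def free_superalgebra_simps by blast
    then have "parity_part (rd_p v) 0 t = x0" "parity_part (rd_p v) 1 t = x1"
      using parity_part_decomp[of x0 "rd_p v" x1] by (auto simp: free_superalgebra_simps subset_iff)
    then show ?thesis using x by (cases d rule: bit.exhaust) auto
  qed
  ultimately show ?R using L J.a_subset by (simp add: graded_ideal_def free_superalgebra_simps)
next
  assume R: ?R
  interpret F: bracket_algebra "free_superalgebra X v" by (rule bracket_algebra_free)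
  have neg: "\<ominus>\<^bsub>free_superalgebra X v\<^esub> t = - t" if "t \<in> free_space X v" for t
  proof -
    have "- t \<in> free_space X v" using free_vs.subspace_neg[OF subspace_keys[of "words X v"]] that by blast
    then show ?thesis using that
      by (intro F.minus_equality) (auto simp: free_superalgebra_simps)
  qed
  have sub: "free_vs.subspace J" using R by blast
  have "subgroup J (add_monoid (free_superalgebra X v))"
  proof
    fix x assume "x \<in> J"
    then have "\<ominus>\<^bsub>free_superalgebra X v\<^esub> x \<in> J"
      using R neg[of x] free_vs.subspace_neg[OF sub] by auto
    then show "inv\<^bsub>add_monoid (free_superalgebra X v)\<^esub> x \<in> J"
      by (simp add: a_inv_def)
  next
    fix x y assume "x \<in> J" "y \<in> J"
    then show "x \<otimes>\<^bsub>add_monoid (free_superalgebra X v)\<^esub> y \<in> J"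
      using free_vs.subspace_add[OF sub] by (simp add: free_superalgebra_simps)
  next
    show "\<one>\<^bsub>add_monoid (free_superalgebra X v)\<^esub> \<in> J"
      using free_vs.subspace_0[OF sub] by (simp add: free_superalgebra_simps)
  qed (use R in \<open>simp add: free_superalgebra_simps\<close>)
  then have "additive_subgroup J (free_superalgebra X v)" by (simp add: additive_subgroup_def)
  moreover have "\<exists>x0\<in>J \<inter> part (free_superalgebra X v) 0. \<exists>x1\<in>J \<inter> part (free_superalgebra X v) 1. t = x0 + x1"
    if t: "t \<in> J" for t
  proof (intro bexI)
    show "t = parity_part (rd_p v) 0 t + parity_part (rd_p v) 1 t"
      by (auto intro!: poly_mapping_eqI simp: lookup_add)
    show "parity_part (rd_p v) 1 t \<in> J \<inter> part (free_superalgebra X v) 1"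
      "parity_part (rd_p v) 0 t \<in> J \<inter> part (free_superalgebra X v) 0"
      using R t by (auto simp: free_superalgebra_simps keys_dgl split: if_splits)
  qed
  ultimately show ?L using R free_vs.subspace_scale[OF sub]
    unfolding graded_ideal_def free_superalgebra_simps by blast
qed

lemma relators_free_space:
  assumes v: "v \<in> root_data X"
  shows "relators X v \<subseteq> free_space X v"
proof
  fix r assume "r \<in> relators X v"
  have H: "\<And>h k. h \<in> rd_space v \<Longrightarrow> k \<in> rd_space v \<Longrightarrow> h + k \<in> rd_space v"
    "\<And>c h. h \<in> rd_space v \<Longrightarrow> c *\<^sub>C h \<in> rd_space v"
    using v complex_vector.span_add complex_vector.span_scale
    by (auto simp: root_data_def fin_dim_subspace_def)
  have a: "x \<in> X \<Longrightarrow> rd_a v x \<in> rd_space v" for x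
    using v by (auto simp: root_data_def PiE_def Pi_def)
  have S: "Poly_Mapping.single w c \<in> free_space X v" if "w \<in> words X v" for w c using that by auto
  note sub = subspace_keys[of "words X v"]
  note add = free_vs.subspace_add[OF sub] and diff = free_vs.subspace_diff[OF sub]
  show "r \<in> free_space X v"
    using \<open>r \<in> relators X v\<close>
  proof cases
    case (h_add h k)
    show ?thesis unfolding h_add(1) by (intro diff S; use h_add in \<open>simp add: H a\<close>)
  next
    case (h_scale h c)
    show ?thesis unfolding h_scale(1) by (intro diff S; use h_scale in \<open>simp add: H a\<close>)
  next
    case (skew u w)
    show ?thesis unfolding skew(1) by (intro add S; use skew in \<open>simp add: H a\<close>)
  next
    case (jacobi u w t)
    show ?thesis unfolding jacobi(1) by (intro diff S; use jacobi in \<open>simp add: H a\<close>)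
  next
    case (hh h k)
    show ?thesis unfolding hh(1) by (intro S; use hh in \<open>simp add: H a\<close>)
  next
    case (he h x)
    show ?thesis unfolding he(1) by (intro diff S; use he in \<open>simp add: H a\<close>)
  next
    case (hf h x)
    show ?thesis unfolding hf(1) by (intro add S; use hf in \<open>simp add: H a\<close>)
  next
    case (ef x y)
    show ?thesis unfolding ef(1) by (intro S; use ef in \<open>simp add: H a\<close>)
  next
    case (ef_same x)
    show ?thesis unfolding ef_same(1) by (intro diff S; use ef_same in \<open>simp add: H a\<close>)
  qed
qed

lemma graded_ideal_relation_ideal:
  assumes "v \<in> root_data X"
  shows "graded_ideal (free_superalgebra X v) (relation_ideal X v)"
    and "relators X v \<subseteq> relation_ideal X v"
proof -
  let ?S = "{J. graded_ideal (free_superalgebra X v) J \<and> relators X v \<subseteq> J}"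
  have br: "free_bracket s t \<in> free_space X v" if "s \<in> free_space X v" "t \<in> free_space X v" for s t
    using keys_free_bracket[of s "words X v" t "words X v"] that by auto
  have "graded_ideal (free_superalgebra X v) (free_space X v)"
    unfolding graded_ideal_free_iff
  proof (intro conjI ballI allI subspace_keys br)
    show "parity_part (rd_p v) d t \<in> free_space X v" if "t \<in> free_space X v" for d t
      using that by (auto simp: keys_dgl)
  qed auto
  \<comment> \<open>The intersected family must be nonempty, since an empty intersection would be
    everything.\<close>
  then have F: "free_space X v \<in> ?S" using relators_free_space[OF assms] by blast
  show "graded_ideal (free_superalgebra X v) (relation_ideal X v)"
    unfolding graded_ideal_free_iff
  proof (intro conjI ballI allI)
    show "free_vs.subspace (relation_ideal X v)"
      unfolding relation_ideal_def by (rule free_vs.subspace_Inter) (auto simp: graded_ideal_free_iff)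
    show "relation_ideal X v \<subseteq> free_space X v" unfolding relation_ideal_def using F by blast
  next
    fix s t assume "s \<in> relation_ideal X v" "t \<in> free_space X v"
    then show "free_bracket s t \<in> relation_ideal X v" "free_bracket t s \<in> relation_ideal X v"
      by (auto simp: relation_ideal_def graded_ideal_free_iff)
  next
    fix t d assume "t \<in> relation_ideal X v"
    then show "parity_part (rd_p v) d t \<in> relation_ideal X v"
      by (auto simp: relation_ideal_def graded_ideal_free_iff)
  qed
  show "relators X v \<subseteq> relation_ideal X v" unfolding relation_ideal_def by blast
qed

lemma super_epiD:
  assumes "super_epi L M f"
  shows "f ` carrier L = carrier M" "f \<zero>\<^bsub>L\<^esub> = \<zero>\<^bsub>M\<^esub>"
    "\<And>x y. x \<in> carrier L \<Longrightarrow> y \<in> carrier L \<Longrightarrow> f (x \<oplus>\<^bsub>L\<^esub> y) = f x \<oplus>\<^bsub>M\<^esub> f y"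
    "\<And>c x. x \<in> carrier L \<Longrightarrow> f (c \<odot>\<^bsub>L\<^esub> x) = c \<odot>\<^bsub>M\<^esub> f x"
    "\<And>x y. x \<in> carrier L \<Longrightarrow> y \<in> carrier L \<Longrightarrow> f (x \<otimes>\<^bsub>L\<^esub> y) = f x \<otimes>\<^bsub>M\<^esub> f y"
    "\<And>d. f ` part L d = part M d"
  using assms unfolding super_epi_def by simp_all

text \<open>\<open>J_inj\<close> is the condition I(v) \<inter> \<hh>(v) = 0 read in the free
  algebra; \<open>J_graded\<close> is what later allows parities to be compared.\<close>

locale graded_lie_ideal = lie_ideal_root +
  assumes J_graded: "t \<in> J \<Longrightarrow> parity_part (rd_p v) d t \<in> J"
    and J_inj: "\<lbrakk>h \<in> rd_space v; mono_word (Gen_h h) \<in> J\<rbrakk> \<Longrightarrow> h = 0"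

definition class_map ::
  "'x set \<Rightarrow> ('h::complex_vector, 'x) root_datum \<Rightarrow> (('h, 'x) word \<Rightarrow>\<^sub>0 complex) set set
    \<Rightarrow> (('h, 'x) word \<Rightarrow>\<^sub>0 complex) \<Rightarrow> (('h, 'x) word \<Rightarrow>\<^sub>0 complex) set set" where
  "class_map X v I t = I +>\<^bsub>half_baked X v\<^esub> (relation_ideal X v +>\<^bsub>free_superalgebra X v\<^esub> t)"

definition class_kernel ::
  "'x set \<Rightarrow> ('h::complex_vector, 'x) root_datum \<Rightarrow> (('h, 'x) word \<Rightarrow>\<^sub>0 complex) set set
    \<Rightarrow> (('h, 'x) word \<Rightarrow>\<^sub>0 complex) set" where
  "class_kernel X v I = {t \<in> free_space X v. relation_ideal X v +>\<^bsub>free_superalgebra X v\<^esub> t \<in> I}"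

text \<open>The map onto g(v) composes two coset maps; its kernel inherits from \<open>I\<close> and
  from the relation ideal all that \<open>graded_lie_ideal\<close> asks for.\<close>

lemma class_map:
  assumes v: "v \<in> root_data X" and I: "graded_ideal (half_baked X v) I"
  shows "super_epi (free_superalgebra X v) (quotient_superalgebra (half_baked X v) I) (class_map X v I)"
    and "\<And>t. t \<in> free_space X v \<Longrightarrow>
      class_map X v I t = \<zero>\<^bsub>quotient_superalgebra (half_baked X v) I\<^esub> \<longleftrightarrow> t \<in> class_kernel X v I"
    and "(\<And>h. h \<in> rd_space v \<Longrightarrow> half_baked_h X v h \<in> I \<Longrightarrow> h = 0) \<Longrightarrow>
      graded_lie_ideal X v (class_kernel X v I)"
proof -
  note F = bracket_algebra_free[of X v]
  note R = graded_ideal_relation_ideal[OF v]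
  note R' = R(1)[unfolded graded_ideal_free_iff]
  let ?f = "\<lambda>t. relation_ideal X v +>\<^bsub>free_superalgebra X v\<^esub> t"
  note sub = subspace_keys[of "words X v"]
  have f: "super_epi (free_superalgebra X v) (half_baked X v) ?f"
    unfolding half_baked_def by (rule graded_ideal_coset(1)[OF F R(1)])
  have zero: "\<zero>\<^bsub>half_baked X v\<^esub> = relation_ideal X v"
    by (simp add: half_baked_def quotient_superalgebra_def)
  have f0: "?f t = \<zero>\<^bsub>half_baked X v\<^esub> \<longleftrightarrow> t \<in> relation_ideal X v" if "t \<in> free_space X v" for t
    using graded_ideal_coset(2)[OF F R(1), of t] that unfolding zero free_superalgebra_simps by blast
  show "super_epi (free_superalgebra X v) (quotient_superalgebra (half_baked X v) I) (class_map X v I)"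
    unfolding class_map_def by (rule super_epi_kernel_pull(1)[OF F f I])
  show "class_map X v I t = \<zero>\<^bsub>quotient_superalgebra (half_baked X v) I\<^esub> \<longleftrightarrow> t \<in> class_kernel X v I"
    if "t \<in> free_space X v" for t
    using super_epi_kernel_pull(2)[OF F f I, of t] that
    by (simp add: class_map_def class_kernel_def quotient_superalgebra_def free_superalgebra_simps)
  assume inj: "\<And>h. h \<in> rd_space v \<Longrightarrow> half_baked_h X v h \<in> I \<Longrightarrow> h = 0"
  have M: "bracket_algebra (half_baked X v)" by (rule bracket_algebra_epi[OF F f])
  interpret M: bracket_algebra "half_baked X v" by fact
  have "additive_subgroup I (half_baked X v)" using I by (simp add: graded_ideal_def)
  then interpret I: abelian_subgroup I "half_baked X v"
    by (rule abelian_subgroupI3[OF _ M.abelian_group_axioms])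
  have fc: "?f t \<in> carrier (half_baked X v)" if "t \<in> free_space X v" for t
    using super_epiD(1)[OF f] that unfolding free_superalgebra_simps by blast
  have fops: "?f (s + t) = ?f s \<oplus>\<^bsub>half_baked X v\<^esub> ?f t" "?f (free_bracket s t) = ?f s \<otimes>\<^bsub>half_baked X v\<^esub> ?f t"
    "?f (scl c t) = c \<odot>\<^bsub>half_baked X v\<^esub> ?f t" if "s \<in> free_space X v" "t \<in> free_space X v" for s t c
    using that super_epiD(3,4,5)[OF f, unfolded free_superalgebra_simps] by simp_all
  have fpart: "?f ` part (free_superalgebra X v) d = part (half_baked X v) d" for d
    by (rule super_epiD(6)[OF f])
  let ?J = "class_kernel X v I"
  have J: "t \<in> ?J \<longleftrightarrow> t \<in> free_space X v \<and> ?f t \<in> I" for t by (simp add: class_kernel_def)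
  have rel_sub: "t \<in> ?J" if "t \<in> relation_ideal X v" for t
    using f0[of t] I.zero_closed R' that unfolding J by auto
  have add: "s + t \<in> ?J" if "s \<in> ?J" "t \<in> ?J" for s t
    using that free_vs.subspace_add[OF sub, of s t] fops(1)[of s t] I.a_closed unfolding J by simp
  have Jsub: "free_vs.subspace ?J"
  proof (rule free_vs.subspaceI)
    show "0 \<in> ?J" using rel_sub R' free_vs.subspace_0 by blast
    fix s c assume "s \<in> ?J"
    then show "scl c s \<in> ?J"
      using I fops(3)[of s s c] free_vs.subspace_scale[OF sub, of s c] unfolding J graded_ideal_def by simp
  qed (rule add)
  show "graded_lie_ideal X v ?J"
  proof
    fix s t assume *: "t \<in> ?J" "s \<in> free_space X v"
    then have **: "t \<in> free_space X v" "?f t \<in> I" by (simp_all add: J)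
    have "?f t \<otimes>\<^bsub>half_baked X v\<^esub> ?f s \<in> I" "?f s \<otimes>\<^bsub>half_baked X v\<^esub> ?f t \<in> I"
      using I ** fc[OF *(2)] unfolding graded_ideal_def by blast+
    then show "free_bracket t s \<in> ?J" "free_bracket s t \<in> ?J"
      using fops(2)[OF **(1) *(2)] fops(2)[OF *(2) **(1)]
        keys_free_bracket[of s "words X v" t "words X v"]
        keys_free_bracket[of t "words X v" s "words X v"] * **
      unfolding J by auto
  next
    fix t d assume t: "t \<in> ?J"
    then have tF: "t \<in> free_space X v" and tI: "?f t \<in> I" unfolding J by auto
    have "\<forall>x\<in>I. \<exists>x0\<in>I \<inter> part (half_baked X v) 0. \<exists>x1\<in>I \<inter> part (half_baked X v) 1.
        x = x0 \<oplus>\<^bsub>half_baked X v\<^esub> x1"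
      using I by (simp add: graded_ideal_def)
    from bspec[OF this tI] obtain y0 y1
      where y: "y0 \<in> I \<inter> part (half_baked X v) 0" "y1 \<in> I \<inter> part (half_baked X v) 1"
        "?f t = y0 \<oplus>\<^bsub>half_baked X v\<^esub> y1" by (elim bexE)
    obtain s0 where s0: "s0 \<in> part (free_superalgebra X v) 0" "y0 = ?f s0" using y(1) fpart[of 0] by blast
    obtain s1 where s1: "s1 \<in> part (free_superalgebra X v) 1" "y1 = ?f s1" using y(2) fpart[of 1] by blast
    have sF: "s0 \<in> free_space X v" "s1 \<in> free_space X v" using s0 s1 by (auto simp: free_superalgebra_simps)
    have s: "s0 \<in> ?J" "s1 \<in> ?J" using s0 s1 sF y unfolding J by auto
    have sF': "s0 + s1 \<in> free_space X v" using sF free_vs.subspace_add[OF sub] by blast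
    have eq: "?f t = ?f (s0 + s1)" using y s0 s1 fops(1)[OF sF] by metis
    \<comment> \<open>The homogeneous parts found in the half-baked algebra lift to
      \<open>s0\<close> and \<open>s1\<close>, but their sum is \<open>t\<close> only up to
      \<open>?r\<close>, which lies in the relation ideal; that ideal is itself graded.\<close>
    let ?r = "t - (s0 + s1)"
    have r: "?r \<in> free_space X v" using free_vs.subspace_diff[OF sub] tF sF' by blast
    have "?f t = ?f ?r \<oplus>\<^bsub>half_baked X v\<^esub> ?f (s0 + s1)"
      using fops(1)[OF r sF'] by simp
    then have "?f ?r = \<zero>\<^bsub>half_baked X v\<^esub>"
      using eq fc[OF r] fc[OF sF'] M.add.r_cancel_one'[of "?f (s0 + s1)" "?f ?r"] by metis
    then have "?r \<in> relation_ideal X v" using f0[OF r] by blast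
    then have "parity_part (rd_p v) d ?r \<in> ?J" using R' rel_sub by blast
    moreover have "parity_part (rd_p v) d (s0 + s1) \<in> ?J"
    proof -
      have "Poly_Mapping.keys s0 \<subseteq> {w. word_parity (rd_p v) w = 0}"
        "Poly_Mapping.keys s1 \<subseteq> {w. word_parity (rd_p v) w = 1}"
        using s0 s1 by (auto simp: free_superalgebra_simps)
      from parity_part_decomp[OF this] show ?thesis using s by (cases d rule: bit.exhaust) auto
    qed
    ultimately have "parity_part (rd_p v) d ?r + parity_part (rd_p v) d (s0 + s1) \<in> ?J"
      by (rule add)
    then show "parity_part (rd_p v) d t \<in> ?J" by (simp add: dgl_simps)
  next
    fix h assume "h \<in> rd_space v" "mono_word (Gen_h h) \<in> ?J"
    then show "h = 0" using inj by (simp add: J half_baked_h_def)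
  next
    show "?J \<subseteq> free_space X v" using J by blast
    show "relators X v \<subseteq> ?J" using R(2) rel_sub by blast
  qed (rule Jsub v)+
qed

text \<open>Instead of transporting elements along \<open>\<gg>(v) \<cong> \<gg>(w)\<close>, we relate those elements
  of the two free algebras whose classes correspond to each other.\<close>

locale lie_transport = V: graded_lie_ideal X v J + W: graded_lie_ideal X w K
  for X :: "'x set" and v w :: "('h::complex_vector, 'x) root_datum" and J K +
  fixes T :: "(('h, 'x) word \<Rightarrow>\<^sub>0 complex) \<Rightarrow> (('h, 'x) word \<Rightarrow>\<^sub>0 complex) \<Rightarrow> bool"
  assumes space_eq: "rd_space w = rd_space v"
    and T_free: "T t s \<Longrightarrow> t \<in> free_space X v \<and> s \<in> free_space X w"
    and T_ex: "t \<in> free_space X v \<Longrightarrow> \<exists>s. T t s"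
    and T_add: "\<lbrakk>T t s; T t' s'\<rbrakk> \<Longrightarrow> T (t + t') (s + s')"
    and T_scl: "T t s \<Longrightarrow> T (scl c t) (scl c s)"
    and T_bracket: "\<lbrakk>T t s; T t' s'\<rbrakk> \<Longrightarrow> T (free_bracket t t') (free_bracket s s')"
    and T_kernel: "T t s \<Longrightarrow> t \<in> J \<longleftrightarrow> s \<in> K"
    and T_h: "h \<in> rd_space v \<Longrightarrow> T (mono_word (Gen_h h)) (mono_word (Gen_h h))"
    and T_parity: "\<lbrakk>t \<in> free_space X v; parity_part (rd_p v) d t = t\<rbrakk> \<Longrightarrow>
      \<exists>s. T t s \<and> parity_part (rd_p w) d s = s"

text \<open>The relation is the graph of the isomorphism pulled back to representatives, so that no
  lift of it to the free algebras has to be chosen.\<close>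

lemma lie_transportI:
  assumes v: "v \<in> root_data X" and w: "w \<in> root_data X"
    and I: "graded_ideal (half_baked X v) I" "\<And>h. h \<in> rd_space v \<Longrightarrow> half_baked_h X v h \<in> I \<Longrightarrow> h = 0"
    and I': "graded_ideal (half_baked X w) I'" "\<And>h. h \<in> rd_space w \<Longrightarrow> half_baked_h X w h \<in> I' \<Longrightarrow> h = 0"
    and sp: "rd_space w = rd_space v"
    and \<Phi>: "superalgebra_iso (quotient_superalgebra (half_baked X v) I)
                 (quotient_superalgebra (half_baked X w) I') \<Phi>"
    and \<Phi>h: "\<And>h. h \<in> rd_space v \<Longrightarrow> \<Phi> (I +>\<^bsub>half_baked X v\<^esub> half_baked_h X v h)
                = I' +>\<^bsub>half_baked X w\<^esub> half_baked_h X w h"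
  shows "lie_transport X v w (class_kernel X v I) (class_kernel X w I')
    (\<lambda>t s. t \<in> free_space X v \<and> s \<in> free_space X w \<and> \<Phi> (class_map X v I t) = class_map X w I' s)"
proof -
  let ?F = "free_superalgebra X v" and ?F' = "free_superalgebra X w"
  let ?G = "quotient_superalgebra (half_baked X v) I"
  let ?G' = "quotient_superalgebra (half_baked X w) I'"
  let ?f = "class_map X v I" and ?f' = "class_map X w I'"
  note f = class_map(1)[OF v I(1)] and f' = class_map(1)[OF w I'(1)]
  note G = bracket_algebra_epi[OF bracket_algebra_free f]
    and G' = bracket_algebra_epi[OF bracket_algebra_free f']
  interpret G: bracket_algebra ?G by fact
  interpret G': bracket_algebra ?G' by fact
  note f = super_epiD[OF f, unfolded free_superalgebra_simps(1-5)]
    and f' = super_epiD[OF f', unfolded free_superalgebra_simps(1-5)]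
  have \<Phi>: "bij_betw \<Phi> (carrier ?G) (carrier ?G')"
    "\<And>x y. x \<in> carrier ?G \<Longrightarrow> y \<in> carrier ?G \<Longrightarrow> \<Phi> (x \<oplus>\<^bsub>?G\<^esub> y) = \<Phi> x \<oplus>\<^bsub>?G'\<^esub> \<Phi> y"
    "\<And>c x. x \<in> carrier ?G \<Longrightarrow> \<Phi> (c \<odot>\<^bsub>?G\<^esub> x) = c \<odot>\<^bsub>?G'\<^esub> \<Phi> x"
    "\<And>x y. x \<in> carrier ?G \<Longrightarrow> y \<in> carrier ?G \<Longrightarrow> \<Phi> (x \<otimes>\<^bsub>?G\<^esub> y) = \<Phi> x \<otimes>\<^bsub>?G'\<^esub> \<Phi> y"
    "\<And>d. \<Phi> ` part ?G d = part ?G' d"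
    using \<Phi> unfolding superalgebra_iso_def by simp_all
  have fc: "t \<in> free_space X v \<Longrightarrow> ?f t \<in> carrier ?G" for t
    using f(1) by blast
  have \<Phi>c: "y \<in> carrier ?G \<Longrightarrow> \<Phi> y \<in> carrier ?G'" for y
    using \<Phi>(1) unfolding bij_betw_def by blast
  have \<Phi>0: "\<Phi> \<zero>\<^bsub>?G\<^esub> = \<zero>\<^bsub>?G'\<^esub>"
  proof -
    have "\<Phi> \<zero>\<^bsub>?G\<^esub> \<oplus>\<^bsub>?G'\<^esub> \<Phi> \<zero>\<^bsub>?G\<^esub> = \<Phi> \<zero>\<^bsub>?G\<^esub>"
      using \<Phi>(2)[OF G.zero_closed G.zero_closed] G.l_zero[OF G.zero_closed] by simp
    then show ?thesis
      using G'.add.r_cancel_one[OF \<Phi>c[OF G.zero_closed] \<Phi>c[OF G.zero_closed]] by simp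
  qed
  have \<Phi>inj: "\<Phi> y = \<zero>\<^bsub>?G'\<^esub> \<longleftrightarrow> y = \<zero>\<^bsub>?G\<^esub>" if "y \<in> carrier ?G" for y
    using \<Phi>(1) \<Phi>0 that G.zero_closed unfolding bij_betw_def inj_on_def by metis
  interpret V: graded_lie_ideal X v "class_kernel X v I" by (rule class_map(3)[OF v I])
  interpret W: graded_lie_ideal X w "class_kernel X w I'" by (rule class_map(3)[OF w I'])
  show ?thesis
  proof
    fix t assume t: "t \<in> free_space X v"
    then have "\<Phi> (?f t) \<in> carrier ?G'" using fc \<Phi>c by blast
    then show "\<exists>s. t \<in> free_space X v \<and> s \<in> free_space X w \<and> \<Phi> (?f t) = ?f' s"
      using f'(1) t by blast
  next
    fix t d assume t: "t \<in> free_space X v" "parity_part (rd_p v) d t = t"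
    have "Poly_Mapping.keys t \<subseteq> {w. word_parity (rd_p v) w = d}"
      by (subst t(2)[symmetric]) (auto simp: keys_dgl)
    then have "t \<in> part ?F d" using t(1) by (auto simp: free_superalgebra_simps)
    then have "\<Phi> (?f t) \<in> part ?G' d"
      using f(6) \<Phi>(5) by blast
    then obtain s where s: "s \<in> part ?F' d" "\<Phi> (?f t) = ?f' s"
      using f'(6) by blast
    then have "parity_part (rd_p w) d s = s"
      by (auto intro!: poly_mapping_eqI simp: free_superalgebra_simps in_keys_iff subset_iff)
    then show "\<exists>s. (t \<in> free_space X v \<and> s \<in> free_space X w \<and> \<Phi> (?f t) = ?f' s)
        \<and> parity_part (rd_p w) d s = s"
      using s t(1) by (auto simp: free_superalgebra_simps)
  next
    fix t s assume ts: "t \<in> free_space X v \<and> s \<in> free_space X w \<and> \<Phi> (?f t) = ?f' s"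
    then show "t \<in> class_kernel X v I \<longleftrightarrow> s \<in> class_kernel X w I'"
      using class_map(2)[OF v I(1), of t] class_map(2)[OF w I'(1), of s] \<Phi>inj[OF fc, of t] by auto
    have "scl c t \<in> free_space X v \<and> scl c s \<in> free_space X w \<and> \<Phi> (?f (scl c t)) = ?f' (scl c s)" for c
      using ts f(4)[of t c] f'(4)[of s c] \<Phi>(3)[OF fc, of t c] V.free_space_ops(3)[of t c]
        W.free_space_ops(3)[of s c] by auto
    then show "scl c t \<in> free_space X v \<and> scl c s \<in> free_space X w \<and> \<Phi> (?f (scl c t)) = ?f' (scl c s)" for c .
    fix t' s' assume ts': "t' \<in> free_space X v \<and> s' \<in> free_space X w \<and> \<Phi> (?f t') = ?f' s'"
    show "t + t' \<in> free_space X v \<and> s + s' \<in> free_space X w \<and> \<Phi> (?f (t + t')) = ?f' (s + s')"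
      using ts ts' f(3)[of t t'] f'(3)[of s s'] \<Phi>(2)[OF fc fc, of t t']
        V.free_space_ops(1)[of t t'] W.free_space_ops(1)[of s s'] by auto
    show "free_bracket t t' \<in> free_space X v \<and> free_bracket s s' \<in> free_space X w
        \<and> \<Phi> (?f (free_bracket t t')) = ?f' (free_bracket s s')"
      using ts ts' f(5)[of t t'] f'(5)[of s s'] \<Phi>(4)[OF fc fc, of t t']
        V.free_space_bracket[of t t'] W.free_space_bracket[of s s'] by auto
  next
    fix h assume "h \<in> rd_space v"
    then show "mono_word (Gen_h h) \<in> free_space X v \<and> mono_word (Gen_h h) \<in> free_space X w
      \<and> \<Phi> (?f (mono_word (Gen_h h))) = ?f' (mono_word (Gen_h h))"
      using \<Phi>h[of h] sp by (simp add: class_map_def half_baked_h_def)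
  qed (use sp in auto)
qed

section \<open>Root data and reflexions\<close>

locale root_datum_on =
  fixes X :: "'x set" and v :: "('h::complex_vector, 'x) root_datum"
  assumes fin: "finite X" and root: "v \<in> root_data X"
begin

abbreviation "H \<equiv> rd_space v"
abbreviation "a \<equiv> rd_a v"
abbreviation "b \<equiv> rd_b v"
abbreviation "A \<equiv> cartan v"

lemma H_closed: "h \<in> H \<Longrightarrow> k \<in> H \<Longrightarrow> h + k \<in> H" "h \<in> H \<Longrightarrow> c *\<^sub>C h \<in> H" "0 \<in> H"
  "h \<in> H \<Longrightarrow> - h \<in> H"
  using root complex_vector.span_add complex_vector.span_scale complex_vector.span_zero
    complex_vector.span_neg
  by (auto simp: root_data_def fin_dim_subspace_def)

lemma a_in: "x \<in> X \<Longrightarrow> a x \<in> H" and a_ext: "x \<notin> X \<Longrightarrow> a x = undefined"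
  using root by (auto simp: root_data_def PiE_def Pi_def extensional_def)

lemma b_ext: "x \<notin> X \<Longrightarrow> b x = undefined" and p_ext: "x \<notin> X \<Longrightarrow> rd_p v x = undefined"
  using root by (auto simp: root_data_def PiE_def Pi_def extensional_def)

lemma b_dual: "x \<in> X \<Longrightarrow> clinear_on H (b x)"
  using root by (auto simp: root_data_def PiE_def Pi_def dual_space_def)

lemma b_linear:
  assumes "x \<in> X"
  shows "h \<in> H \<Longrightarrow> k \<in> H \<Longrightarrow> b x (h + k) = b x h + b x k" "h \<in> H \<Longrightarrow> b x (c *\<^sub>C h) = c * b x h"
    "h \<in> H \<Longrightarrow> b x (- h) = - b x h" "h \<notin> H \<Longrightarrow> b x h = undefined"
proof -
  show 1: "h \<in> H \<Longrightarrow> k \<in> H \<Longrightarrow> b x (h + k) = b x h + b x k"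
    and 2: "h \<in> H \<Longrightarrow> b x (c *\<^sub>C h) = c * b x h" and "h \<notin> H \<Longrightarrow> b x h = undefined" for h k c
    using b_dual[OF assms] by (auto simp: clinear_on_def scaleC_complex_def extensional_def)
  show "h \<in> H \<Longrightarrow> b x (- h) = - b x h"
    using 2[of h "-1"] by simp
qed

lemma a_indep: "(\<Sum>x\<in>X. c x *\<^sub>C a x) = 0 \<Longrightarrow> x \<in> X \<Longrightarrow> c x = 0"
  using root by (auto simp: root_data_def)

lemma b_indep: "(\<And>h. h \<in> H \<Longrightarrow> (\<Sum>x\<in>X. c x * b x h) = 0) \<Longrightarrow> x \<in> X \<Longrightarrow> c x = 0"
  using root by (auto simp: root_data_def)

lemma b_unique:
  assumes "\<And>h. h \<in> H \<Longrightarrow> (\<Sum>x\<in>X. c x * b x h) = (\<Sum>x\<in>X. d x * b x h)" "x \<in> X"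
  shows "c x = d x"
proof -
  have "c x - d x = 0"
    using assms by (intro b_indep[where c = "\<lambda>x. c x - d x"]) (auto simp: left_diff_distrib sum_subtractf)
  then show ?thesis by simp
qed

lemma a_unique:
  assumes "(\<Sum>x\<in>X. c x *\<^sub>C a x) = (\<Sum>x\<in>X. d x *\<^sub>C a x)" "x \<in> X"
  shows "c x = d x"
proof -
  have "c x - d x = 0"
    using assms
    by (intro a_indep[where c = "\<lambda>x. c x - d x"]) (auto simp: complex_vector.scale_left_diff_distrib sum_subtractf)
  then show ?thesis by simp
qed

lemma sum_delta_b: "x \<in> X \<Longrightarrow> (\<Sum>y\<in>X. (if y = x then c else 0) * b y h) = c * b x h"
  using fin by (simp add: if_distrib[of "\<lambda>u. u * _"] cong: if_cong)

lemma sum_delta_a: "x \<in> X \<Longrightarrow> (\<Sum>y\<in>X. (if y = x then c else 0) *\<^sub>C a y) = c *\<^sub>C a x"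
  using fin by (simp add: if_distrib[of "\<lambda>u. u *\<^sub>C _"] cong: if_cong)

lemma a_nonzero: "x \<in> X \<Longrightarrow> a x \<noteq> 0"
  using a_indep[of "\<lambda>y. if y = x then 1 else 0" x] sum_delta_a[of x 1] by auto

text \<open>A reflexion adds a multiple of \<open>a(x)\<close> to \<open>a(y)\<close> and of \<open>b(x)\<close> to \<open>b(y)\<close>; the multiples are:\<close>

definition ra :: "'x \<Rightarrow> 'x \<Rightarrow> complex" where
  "ra x y = (if A x x \<noteq> 0 then - (2 * A y x / A x x) else if A x y = 0 then 0 else A y x / A x y)"

definition rb :: "'x \<Rightarrow> 'x \<Rightarrow> complex" where
  "rb x y = (if A x x \<noteq> 0 then - (2 * A x y / A x x) else if A x y = 0 then 0 else 1)"

lemma reflexion_space [simp]: "rd_space (reflexion X v x) = H"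
  by (simp add: reflexion_def anisotropic_reflexion_def isotropic_reflexion_def)

lemma reflexion_a:
  assumes "x \<in> X" "y \<in> X"
  shows "rd_a (reflexion X v x) y = (if y = x then - a x else a y + ra x y *\<^sub>C a x)"
proof -
  have "a x - 2 *\<^sub>C a x = - a x"
    using scaleC_add_left[of 1 1 "a x"] by (simp add: scaleC_one)
  then show ?thesis
    using assms by (auto simp: reflexion_def anisotropic_reflexion_def isotropic_reflexion_def ra_def)
qed

lemma reflexion_b:
  assumes "x \<in> X" "y \<in> X" "h \<in> H"
  shows "rd_b (reflexion X v x) y h = (if y = x then - b x h else b y h + rb x y * b x h)"
  using assms by (auto simp: reflexion_def anisotropic_reflexion_def isotropic_reflexion_def rb_def)

lemma reflexion_p:
  assumes "x \<in> X" "y \<in> X"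
  shows "rd_p (reflexion X v x) y = (if A x x \<noteq> 0 \<or> y = x \<or> A x y = 0 then rd_p v y else 1 + rd_p v y)"
  using assms by (auto simp: reflexion_def anisotropic_reflexion_def isotropic_reflexion_def)

lemma reflexion_ext:
  "y \<notin> X \<Longrightarrow> rd_a (reflexion X v x) y = undefined"
  "y \<notin> X \<Longrightarrow> rd_b (reflexion X v x) y = undefined"
  "y \<notin> X \<Longrightarrow> rd_p (reflexion X v x) y = undefined"
  "y \<in> X \<Longrightarrow> h \<notin> H \<Longrightarrow> rd_b (reflexion X v x) y h = undefined"
  by (auto simp: reflexion_def anisotropic_reflexion_def isotropic_reflexion_def p_ext)

text \<open>A reflexion negates the vector marked \<open>x\<close> and shears the others along it.
  This is the resulting regrouping of a linear combination, shared by the families \<open>a\<close>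
  and \<open>b\<close>.\<close>

lemma sum_shear:
  fixes f :: "'x \<Rightarrow> 'z::ab_group_add"
  assumes "x \<in> X" "f x = - g x" "\<And>y. y \<in> X - {x} \<Longrightarrow> f y = g y + k y"
  shows "sum f X = sum g (X - {x}) + (sum k (X - {x}) - g x)"
  using assms fin by (simp add: sum.remove sum.distrib)

lemma reflexion_root:
  assumes x: "x \<in> X"
  shows "reflexion X v x \<in> root_data X"
proof -
  let ?v = "reflexion X v x"
  have 1: "c y = 0" if *: "(\<Sum>y\<in>X. c y *\<^sub>C rd_a ?v y) = 0" and y: "y \<in> X" for c y
  proof -
    \<comment> \<open>The coefficients of the same vector in the old family, whose independence is
      known.\<close>
    define d where "d y = (if y = x then (\<Sum>y\<in>X-{x}. c y * ra x y) - c x else c y)" for y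
    have "(\<Sum>y\<in>X. c y *\<^sub>C rd_a ?v y) = (\<Sum>y\<in>X-{x}. c y *\<^sub>C a y) + ((\<Sum>y\<in>X-{x}. (c y * ra x y) *\<^sub>C a x) - c x *\<^sub>C a x)"
      using x by (intro sum_shear) (auto simp: reflexion_a scaleC_add_right scaleC_scaleC)
    also have "\<dots> = (\<Sum>y\<in>X. d y *\<^sub>C a y)"
      using x fin by (simp add: sum.remove[of X x] d_def complex_vector.scale_left_diff_distrib
          complex_vector.scale_sum_left)
    finally have "\<And>y. y \<in> X \<Longrightarrow> d y = 0" using a_indep[of d] * by simp
    then have d0: "\<And>y. y \<in> X \<Longrightarrow> y \<noteq> x \<Longrightarrow> c y = 0" "d x = 0"
      using x unfolding d_def by metis+
    have "c x = 0" using d0 by (simp add: d_def)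
    then show ?thesis using d0(1) y by (cases "y = x") auto
  qed
  have 2: "c y = 0" if *: "\<And>h. h \<in> H \<Longrightarrow> (\<Sum>y\<in>X. c y * rd_b ?v y h) = 0" and y: "y \<in> X" for c y
  proof -
    define d where "d y = (if y = x then (\<Sum>y\<in>X-{x}. c y * rb x y) - c x else c y)" for y
    have "(\<Sum>y\<in>X. d y * b y h) = 0" if h: "h \<in> H" for h
    proof -
      have "(\<Sum>y\<in>X. c y * rd_b ?v y h) = (\<Sum>y\<in>X-{x}. c y * b y h) + ((\<Sum>y\<in>X-{x}. (c y * rb x y) * b x h) - c x * b x h)"
        using x h by (intro sum_shear) (auto simp: reflexion_b distrib_left mult.assoc)
      also have "\<dots> = (\<Sum>y\<in>X. d y * b y h)"
        using x fin by (simp add: sum.remove[of X x] d_def left_diff_distrib sum_distrib_right)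
      finally show ?thesis using *[OF h] by simp
    qed
    then have "\<And>y. y \<in> X \<Longrightarrow> d y = 0" using b_indep[of d] by simp
    then have d0: "\<And>y. y \<in> X \<Longrightarrow> y \<noteq> x \<Longrightarrow> c y = 0" "d x = 0"
      using x unfolding d_def by metis+
    have "c x = 0" using d0 by (simp add: d_def)
    then show ?thesis using d0(1) y by (cases "y = x") auto
  qed
  have 3: "rd_a ?v \<in> X \<rightarrow>\<^sub>E H"
    using x by (intro PiE_I) (auto simp: reflexion_a reflexion_ext intro!: H_closed a_in)
  have 4: "rd_b ?v \<in> X \<rightarrow>\<^sub>E dual_space H"
  proof (intro PiE_I)
    fix y assume y: "y \<in> X"
    show "rd_b ?v y \<in> dual_space H"
      using x y unfolding dual_space_def clinear_on_def mem_Collect_eq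
      by (auto simp: reflexion_b reflexion_ext extensional_def H_closed b_linear scaleC_complex_def algebra_simps)
  qed (simp add: reflexion_ext)
  have 5: "rd_p ?v \<in> X \<rightarrow>\<^sub>E UNIV" by (auto simp: reflexion_ext)
  show ?thesis
    using root 1 2 3 4 5 by (auto simp: root_data_def)
qed

lemma cartan_reflexion:
  assumes "x \<in> X" "y \<in> X" "z \<in> X"
  defines "A' \<equiv> cartan (reflexion X v x)"
  shows "A' x x = A x x"
    and "z \<noteq> x \<Longrightarrow> A' x z = - (A x z + rb x z * A x x)"
    and "y \<noteq> x \<Longrightarrow> A' y x = - (A y x + ra x y * A x x)"
    and "y \<noteq> x \<Longrightarrow> z \<noteq> x \<Longrightarrow> A' y z = A y z + rb x z * A y x + ra x y * A x z + ra x y * rb x z * A x x"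
  using assms
  by (auto simp: cartan_def reflexion_a reflexion_b a_in H_closed b_linear algebra_simps)

text \<open>An anisotropic reflexion acts on \<open>a\<close> and on \<open>b\<close> by mutually
  contragredient reflections, which preserve the pairing.\<close>

lemma cartan_reflexion_anisotropic:
  assumes "x \<in> X" "y \<in> X" "z \<in> X" "A x x \<noteq> 0"
  shows "cartan (reflexion X v x) y z = A y z"
  using assms cartan_reflexion[OF assms(1-3)]
  by (cases "y = x"; cases "z = x") (auto simp: ra_def rb_def field_simps)

lemma cartan_reflexion_isotropic:
  assumes "x \<in> X" "y \<in> X" "A x x = 0"
  shows "cartan (reflexion X v x) x y = - A x y" "cartan (reflexion X v x) y x = - A y x"
  using assms cartan_reflexion[OF assms(1,2,2)] by (cases "y = x"; auto)+

lemma reflectable_in: "reflectable X v x \<Longrightarrow> x \<in> X"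
  by (simp add: reflectable_def)

lemma reflectable_reflexion:
  assumes "reflectable X v x"
  shows "reflectable X (reflexion X v x) x"
  using assms cartan_reflexion(1)[of x x x] cartan_reflexion_anisotropic[of x x]
  by (auto simp: reflectable_def reflexion_p)

text \<open>Integrality and sign come from reflectability. For an odd anisotropic mark already a_xy
  / a_xx is a nonpositive integer, so there the multiple is even.\<close>

lemma rb_nat:
  assumes "reflectable X v x" "y \<in> X" "y \<noteq> x"
  shows "\<exists>n::nat. rb x y = of_nat n"
proof (cases "A x x = 0")
  case True
  then show ?thesis by (auto simp: rb_def intro: exI[of _ 0] exI[of _ 1])
next
  case False
  show ?thesis
  proof (cases "rd_p v x = 0")
    case True
    then have "2 * A x y / A x x \<in> \<int>\<^sub>\<le>\<^sub>0" using assms False by (auto simp: reflectable_def)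
    then show ?thesis using False by (auto simp: rb_def elim!: nonpos_Ints_cases')
  next
    case nz: False
    then have "rd_p v x = 1" by (cases "rd_p v x" rule: bit.exhaust) auto
    then have "A x y / A x x \<in> \<int>\<^sub>\<le>\<^sub>0" using assms False by (auto simp: reflectable_def)
    then obtain n :: nat where n: "A x y / A x x = - of_nat n" by (auto elim!: nonpos_Ints_cases')
    have "rb x y = - (2 * (A x y / A x x))" using False by (simp add: rb_def)
    also have "\<dots> = of_nat (2 * n)" unfolding n by simp
    finally show ?thesis by blast
  qed
qed

lemma reflexion_root_on: "x \<in> X \<Longrightarrow> root_datum_on X (reflexion X v x)"
  using fin reflexion_root by unfold_locales

text \<open>In the isotropic case a_xy and a_yx both change sign, which affects neither their ratio
  nor their vanishing; hence a second reflexion undoes the first.\<close>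

lemma ra_rb_reflexion:
  assumes x: "x \<in> X" and y: "y \<in> X"
  shows "root_datum_on.ra (reflexion X v x) x y = ra x y" "root_datum_on.rb (reflexion X v x) x y = rb x y"
proof -
  interpret W: root_datum_on X "reflexion X v x" by (rule reflexion_root_on[OF x])
  show "W.ra x y = ra x y" "W.rb x y = rb x y"
    using cartan_reflexion_anisotropic[OF x] cartan_reflexion_isotropic[OF x] x y
    unfolding W.ra_def W.rb_def ra_def rb_def by auto
qed

lemma reflexion_involution:
  assumes x: "x \<in> X"
  shows "reflexion X (reflexion X v x) x = v"
proof -
  interpret W: root_datum_on X "reflexion X v x" by (rule reflexion_root_on[OF x])
  let ?w = "reflexion X (reflexion X v x) x"
  have A0: "W.A x x = A x x" "\<And>y. y \<in> X \<Longrightarrow> W.A x x = 0 \<Longrightarrow> W.A x y = - A x y"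
    using cartan_reflexion(1)[OF x x x] cartan_reflexion_isotropic[OF x] by auto
  have "rd_a ?w y = a y" for y
    using x by (cases "y \<in> X") (auto simp: W.reflexion_a reflexion_a W.reflexion_ext a_ext ra_rb_reflexion)
  moreover have "rd_b ?w y h = b y h" for y h
    using x by (cases "y \<in> X"; cases "h \<in> H")
      (auto simp: W.reflexion_b reflexion_b W.reflexion_ext b_ext b_linear ra_rb_reflexion)
  moreover have "rd_p ?w y = rd_p v y" for y
    using x A0 by (cases "y \<in> X") (auto simp: W.reflexion_p reflexion_p W.reflexion_ext p_ext add.assoc[symmetric])
  moreover have "rd_space ?w = rd_space v" by simp
  ultimately show ?thesis by (intro root_datum.equality) (auto simp: fun_eq_iff)
qed

end

lemma clinear_on_sum:
  assumes "clinear_on H f" "fin_dim_subspace H" "finite I" "\<And>i. i \<in> I \<Longrightarrow> g i \<in> H"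
  shows "f (\<Sum>i\<in>I. c i *\<^sub>C g i) = (\<Sum>i\<in>I. c i *\<^sub>C f (g i)) \<and> (\<Sum>i\<in>I. c i *\<^sub>C g i) \<in> H"
  using assms(3,4)
proof (induction I rule: finite_induct)
  case empty
  have "0 \<in> H" using assms(2) complex_vector.span_zero by (auto simp: fin_dim_subspace_def)
  moreover have "f (0 *\<^sub>C 0) = 0 *\<^sub>C f 0" using assms(1) calculation unfolding clinear_on_def by blast
  ultimately show ?case by simp
next
  case (insert i I)
  then have "c i *\<^sub>C g i \<in> H" "(\<Sum>i\<in>I. c i *\<^sub>C g i) \<in> H"
    using assms(2) complex_vector.span_scale by (auto simp: fin_dim_subspace_def)
  then show ?case using insert assms(1,2) complex_vector.span_add
    by (auto simp: clinear_on_def fin_dim_subspace_def)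
qed

lemma taut_image_root:
  assumes X: "finite X" and v: "v \<in> root_data X" and H': "fin_dim_subspace H'"
    and th: "clinear_iso (rd_space v) H' \<theta>"
  shows "taut_image X v \<theta> H' \<in> root_data X"
proof -
  interpret root_datum_on X v using X v by unfold_locales
  let ?i = "inv_into H \<theta>"
  have lin: "clinear_on H \<theta>" and bij: "bij_betw \<theta> H H'" using th by (auto simp: clinear_iso_def)
  have fdH: "fin_dim_subspace H" using v by (simp add: root_data_def)
  have sub: "\<And>h k. h \<in> H' \<Longrightarrow> k \<in> H' \<Longrightarrow> h + k \<in> H'" "\<And>c h. h \<in> H' \<Longrightarrow> c *\<^sub>C h \<in> H'"
    using H' complex_vector.span_add complex_vector.span_scale by (auto simp: fin_dim_subspace_def)
  have tH: "\<theta> h \<in> H'" if "h \<in> H" for h using bij that by (auto simp: bij_betw_def)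
  have iH: "?i h \<in> H" "\<theta> (?i h) = h" if "h \<in> H'" for h
    using bij that by (auto simp: bij_betw_def inv_into_into f_inv_into_f)
  have i\<theta>: "?i (\<theta> h) = h" if "h \<in> H" for h using bij that by (simp add: bij_betw_def)
  have iadd: "?i (h + k) = ?i h + ?i k" if "h \<in> H'" "k \<in> H'" for h k
  proof -
    have "\<theta> (?i h + ?i k) = h + k" using lin iH that by (auto simp: clinear_on_def)
    then show ?thesis using i\<theta>[of "?i h + ?i k"] iH H_closed that by metis
  qed
  have iscale: "?i (c *\<^sub>C h) = c *\<^sub>C ?i h" if "h \<in> H'" for c h
  proof -
    have "\<theta> (c *\<^sub>C ?i h) = c *\<^sub>C h" using lin iH that by (auto simp: clinear_on_def)
    then show ?thesis using i\<theta>[of "c *\<^sub>C ?i h"] iH H_closed that by metis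
  qed
  have 1: "\<forall>x\<in>X. c x = 0" if *: "(\<Sum>x\<in>X. c x *\<^sub>C rd_a (taut_image X v \<theta> H') x) = 0" for c
  proof -
    note s = clinear_on_sum[OF lin fdH X, of a c, OF a_in]
    have "\<theta> (\<Sum>x\<in>X. c x *\<^sub>C a x) = 0" using s * by (simp add: taut_image_def)
    moreover have "\<theta> 0 = 0" using clinear_on_sum[OF lin fdH, of "{}"] by simp
    ultimately have "(\<Sum>x\<in>X. c x *\<^sub>C a x) = 0"
      using s H_closed(3) i\<theta> by metis
    then show ?thesis using a_indep by blast
  qed
  have 2: "\<forall>x\<in>X. c x = 0" if *: "\<forall>h\<in>H'. (\<Sum>x\<in>X. c x * rd_b (taut_image X v \<theta> H') x h) = 0" for c
  proof -
    have "(\<Sum>x\<in>X. c x * b x h) = 0" if "h \<in> H" for h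
      using *[rule_format, OF tH[OF that]] that tH by (simp add: taut_image_def i\<theta>)
    then show ?thesis using b_indep by blast
  qed
  have 3: "rd_b (taut_image X v \<theta> H') \<in> X \<rightarrow>\<^sub>E dual_space H'"
    using b_linear iH sub
    by (intro PiE_I) (auto simp: taut_image_def dual_space_def clinear_on_def iadd iscale scaleC_complex_def)
  show ?thesis
    using v H' 1 2 3 tH a_in unfolding root_data_def by (auto simp: taut_image_def)
qed

lemma homothety_image_root:
  assumes X: "finite X" and v: "v \<in> root_data X" and l: "\<forall>x\<in>X. l x \<noteq> 0"
  shows "homothety_image X v l \<in> root_data X"
proof -
  interpret root_datum_on X v using X v by unfold_locales
  have "\<forall>x\<in>X. c x = 0" if *: "(\<Sum>x\<in>X. c x *\<^sub>C rd_a (homothety_image X v l) x) = 0" for c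
    using a_indep[of "\<lambda>x. c x * l x"] * l by (simp add: homothety_image_def scaleC_scaleC)
  then show ?thesis
    using v H_closed a_in unfolding root_data_def by (auto simp: homothety_image_def)
qed

text \<open>All three kinds of generators occur, since a component is reached from its base point by
  arbitrary arrows, not by reflexions alone.\<close>

lemma rg_arrow_root:
  assumes "finite X" "rg_arrow X u \<phi> w"
  shows "w \<in> root_data X"
  using assms(2)
proof induction
  case (step u \<phi> v \<psi> w)
  from step(2) show ?case
  proof cases
    case (reflexion x)
    then show ?thesis
      using root_datum_on.reflexion_root[of X v x] assms(1)
      by (auto simp: root_datum_on_def reflectable_def)
  qed (use taut_image_root homothety_image_root assms(1) in auto)
qed

section \<open>Consequences of the Lie superalgebra structure\<close>

text \<open>\<open>n\<close> counts the occurrences of each generator, so its total is the number of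
  letters, and a word with one letter is a generator.\<close>

lemma e_word_weight:
  assumes "finite X" "q \<in> words X v" "e_word q"
  shows "\<exists>n. (\<forall>h. word_weight b q h = (\<Sum>x\<in>X. of_nat (n x) * b x h))
    \<and> (\<Sum>x\<in>X. n x) \<ge> 1 \<and> ((\<Sum>x\<in>X. n x) = 1 \<longrightarrow> (\<exists>x\<in>X. q = Gen_e x))"
  using assms(2,3)
proof (induction q)
  case (Gen_e x)
  have "(\<Sum>y\<in>X. of_nat (if y = x then 1 else 0) * b y h) = b x h" for h
    using Gen_e assms(1) by (simp add: if_distrib[of "\<lambda>u. u * _"] if_distrib[of of_nat] cong: if_cong)
  then show ?case
    using Gen_e assms(1) by (intro exI[of _ "\<lambda>y. if y = x then 1 else 0"]) auto
next
  case (Br p q)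
  then obtain n m where
    "\<forall>h. word_weight b p h = (\<Sum>x\<in>X. of_nat (n x) * b x h)" "(\<Sum>x\<in>X. n x) \<ge> 1"
    "\<forall>h. word_weight b q h = (\<Sum>x\<in>X. of_nat (m x) * b x h)" "(\<Sum>x\<in>X. m x) \<ge> 1"
    by auto
  then show ?case
    by (intro exI[of _ "\<lambda>x. n x + m x"]) (simp add: sum.distrib distrib_right)
qed auto

lemma f_word_weight:
  assumes "finite X" "q \<in> words X v" "f_word q"
  shows "\<exists>n. (\<forall>h. word_weight b q h = - (\<Sum>x\<in>X. of_nat (n x) * b x h))
    \<and> (\<Sum>x\<in>X. n x) \<ge> 1 \<and> ((\<Sum>x\<in>X. n x) = 1 \<longrightarrow> (\<exists>x\<in>X. q = Gen_f x))"
  using assms(2,3)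
proof (induction q)
  case (Gen_f x)
  have "(\<Sum>y\<in>X. of_nat (if y = x then 1 else 0) * b y h) = b x h" for h
    using Gen_f assms(1) by (simp add: if_distrib[of "\<lambda>u. u * _"] if_distrib[of of_nat] cong: if_cong)
  then show ?case
    using Gen_f assms(1) by (intro exI[of _ "\<lambda>y. if y = x then 1 else 0"]) auto
next
  case (Br p q)
  then obtain n m where
    "\<forall>h. word_weight b p h = - (\<Sum>x\<in>X. of_nat (n x) * b x h)" "(\<Sum>x\<in>X. n x) \<ge> 1"
    "\<forall>h. word_weight b q h = - (\<Sum>x\<in>X. of_nat (m x) * b x h)" "(\<Sum>x\<in>X. m x) \<ge> 1"
    by auto
  then show ?case
    by (intro exI[of _ "\<lambda>x. n x + m x"]) (simp add: sum.distrib distrib_right)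
qed auto

text \<open>Represents (ad e_x)^n e_z, the root string through e_z in the direction of e_x.\<close>

primrec ad_word :: "'x \<Rightarrow> 'x \<Rightarrow> nat \<Rightarrow> ('h, 'x) word" where
  "ad_word x z 0 = Gen_e z"
| "ad_word x z (Suc n) = Br (Gen_e x) (ad_word x z n)"

locale contragredient = graded_lie_ideal + finite_marks: root_datum_on X v
begin

abbreviation "ge x \<equiv> mono_word (Gen_e x)"
abbreviation "gf x \<equiv> mono_word (Gen_f x)"
abbreviation "gh h \<equiv> mono_word (Gen_h h)"

lemma h_scale: "h \<in> rd_space v \<Longrightarrow> gh (c *\<^sub>C h) - scl c (gh h) \<in> J"
  using relators.h_scale[of h v c X] J_rel by auto

lemma h_add: "h \<in> rd_space v \<Longrightarrow> k \<in> rd_space v \<Longrightarrow> gh (h + k) - gh h - gh k \<in> J"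
  using relators.h_add[of h v k X] J_rel by auto

lemma h_inj:
  assumes "h \<in> rd_space v" "k \<in> rd_space v" "gh h - gh k \<in> J"
  shows "h = k"
proof -
  have k: "(-1) *\<^sub>C k = - k" "- k \<in> rd_space v"
    using complex_vector.scale_minus_left[of 1 k] scaleC_one[of k] finite_marks.H_closed assms(2) by auto
  have "(gh (h + - k) - gh h - gh (- k)) + (gh (- k) - scl (-1) (gh k)) + (gh h - gh k) \<in> J"
    using h_add[OF assms(1) k(2)] h_scale[OF assms(2), of "-1"] k(1) assms(3) by (intro J_add) auto
  moreover have "(gh (h + - k) - gh h - gh (- k)) + (gh (- k) - scl (-1) (gh k)) + (gh h - gh k) = gh (h - k)"
    by (simp add: free_vs.scale_minus_left del: scl_single)
  ultimately have "gh (h - k) \<in> J" by metis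
  then have "h - k = 0"
    using finite_marks.H_closed(1)[OF assms(1) k(2)] by (intro J_inj) simp_all
  then show ?thesis by simp
qed

lemma ef_same: "x \<in> X \<Longrightarrow> mono_word (Br (Gen_e x) (Gen_f x)) - gh (rd_a v x) \<in> J"
  using subsetD[OF J_rel relators.ef_same] .

lemma ef_other: "x \<in> X \<Longrightarrow> y \<in> X \<Longrightarrow> x \<noteq> y \<Longrightarrow> mono_word (Br (Gen_e x) (Gen_f y)) \<in> J"
  using subsetD[OF J_rel relators.ef] .

lemma a_not_in_J: "x \<in> X \<Longrightarrow> gh (rd_a v x) \<notin> J"
  using J_inj finite_marks.a_nonzero finite_marks.a_in by blast

text \<open>If e_x or f_x vanished in the quotient, so would their bracket a(x), which is a nonzero
  element of \<hh>.\<close>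

lemma e_not_in_J: "x \<in> X \<Longrightarrow> ge x \<notin> J" and f_not_in_J: "x \<in> X \<Longrightarrow> gf x \<notin> J"
proof -
  assume x: "x \<in> X"
  then have n: "mono_word (Br (Gen_e x) (Gen_f x)) \<notin> J"
    using J_diff_cancel[OF ef_same] a_not_in_J by blast
  show "ge x \<notin> J" using J_left[of "ge x" "gf x"] n x by auto
  show "gf x \<notin> J" using J_right[of "gf x" "ge x"] n x by auto
qed

lemma tri_weight:
  assumes "q \<in> tri_words X v"
  obtains n where "\<And>h. word_weight (rd_b v) q h = (\<Sum>x\<in>X. of_nat (n x) * rd_b v x h)"
  | n where "\<And>h. word_weight (rd_b v) q h = - (\<Sum>x\<in>X. of_nat (n x) * rd_b v x h)"
proof -
  have q: "q \<in> words X v" using assms tri_sub by blast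
  consider "e_word q" | "f_word q" | h where "q = Gen_h h" using assms by (auto simp: tri_words_def)
  then show thesis
  proof cases
    case 1
    then show ?thesis using e_word_weight[OF finite_marks.fin q] that(1) by metis
  next
    case 2
    then show ?thesis using f_word_weight[OF finite_marks.fin q] that(2) by metis
  next
    case 3
    then show ?thesis by (intro that(1)[of "\<lambda>_. 0"]) simp
  qed
qed

lemma sum_delta: "x \<in> X \<Longrightarrow> (\<Sum>y\<in>X. (if y = x then 1 else 0) * rd_b v y h) = rd_b v x h"
  using finite_marks.sum_delta_b[of x 1 h] by simp

lemma b_inj:
  assumes "x \<in> X" "y \<in> X" "\<And>h. h \<in> rd_space v \<Longrightarrow> rd_b v x h = rd_b v y h"
  shows "x = y"
proof (rule ccontr)
  assume ne: "x \<noteq> y"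
  have "(if x = x then 1 else 0 :: complex) = (if x = y then 1 else 0)"
    using assms
    by (intro finite_marks.b_unique[where c = "\<lambda>z. if z = x then 1 else 0"
          and d = "\<lambda>z. if z = y then 1 else 0"]) (simp_all add: sum_delta)
  then show False using ne by simp
qed

text \<open>By independence of the b's, an e-word of weight b(x) has multiplicity 1 at
  \<open>x\<close> and 0 elsewhere, hence a single letter; weights of f-words and of \<hh> cannot
  equal b(x). The negative case is symmetric.\<close>

lemma tri_simple:
  assumes "q \<in> tri_words X v" "x \<in> X"
  shows "q \<in> of_weight (rd_b v x) \<Longrightarrow> q = Gen_e x"
    and "q \<in> of_weight (\<lambda>h. - rd_b v x h) \<Longrightarrow> q = Gen_f x"
proof -
  let ?\<delta> = "\<lambda>y. if y = x then 1 else 0 :: complex"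
  have q: "q \<in> words X v" using assms tri_sub by blast
  have delta: "n y = (if y = x then 1 else 0)"
    if "\<And>h. h \<in> rd_space v \<Longrightarrow> (\<Sum>y\<in>X. of_nat (n y) * rd_b v y h) = rd_b v x h" "y \<in> X" for n :: "'a \<Rightarrow> nat" and y
  proof -
    have "of_nat (n y) = ?\<delta> y"
      using that assms(2) by (intro finite_marks.b_unique[where d = ?\<delta>]) (simp_all add: sum_delta)
    then show ?thesis by (auto split: if_splits)
  qed
  have neg: False
    if "\<And>h. h \<in> rd_space v \<Longrightarrow> - (\<Sum>y\<in>X. of_nat (n y) * rd_b v y h) = rd_b v x h" for n :: "'a \<Rightarrow> nat"
  proof -
    have "- of_nat (n x) = ?\<delta> x"
      using that assms(2)
      by (intro finite_marks.b_unique[where d = ?\<delta> and c = "\<lambda>y. - of_nat (n y)"])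
        (simp_all add: sum_delta sum_negf)
    then have "Re (- of_nat (n x)) = 1" by simp
    then show False by simp
  qed
  have single: "(\<Sum>y\<in>X. n y) = 1" if "\<And>y. y \<in> X \<Longrightarrow> n y = (if y = x then 1 else 0)" for n :: "'a \<Rightarrow> nat"
    using that assms(2) finite_marks.fin by simp
  consider "e_word q" | "f_word q" | h where "q = Gen_h h" using assms by (auto simp: tri_words_def)
  note cases = this
  show "q = Gen_e x" if w: "q \<in> of_weight (rd_b v x)"
    using cases
  proof cases
    case 1
    then obtain n where n: "\<And>h. word_weight (rd_b v) q h = (\<Sum>x\<in>X. of_nat (n x) * rd_b v x h)"
      "(\<Sum>x\<in>X. n x) = 1 \<longrightarrow> (\<exists>x\<in>X. q = Gen_e x)"
      using e_word_weight[OF finite_marks.fin q] by metis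
    have "\<And>y. y \<in> X \<Longrightarrow> n y = (if y = x then 1 else 0)" using w n(1) by (intro delta) (auto simp: of_weight_def)
    then obtain y where y: "y \<in> X" "q = Gen_e y" using n(2) single by blast
    then have "x = y" using w assms(2) by (intro b_inj) (auto simp: of_weight_def)
    then show ?thesis using y by simp
  next
    case 2
    then obtain n where "\<And>h. word_weight (rd_b v) q h = - (\<Sum>x\<in>X. of_nat (n x) * rd_b v x h)"
      using f_word_weight[OF finite_marks.fin q] by metis
    then show ?thesis using w neg[of n] by (auto simp: of_weight_def)
  next
    case 3
    then show ?thesis using w neg[of "\<lambda>_. 0"] by (auto simp: of_weight_def)
  qed
  show "q = Gen_f x" if w: "q \<in> of_weight (\<lambda>h. - rd_b v x h)"
    using cases
  proof cases
    case 1
    then obtain n where "\<And>h. word_weight (rd_b v) q h = (\<Sum>x\<in>X. of_nat (n x) * rd_b v x h)"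
      using e_word_weight[OF finite_marks.fin q] by metis
    then show ?thesis using w neg[of n] by (auto simp: of_weight_def)
  next
    case 2
    then obtain n where n: "\<And>h. word_weight (rd_b v) q h = - (\<Sum>x\<in>X. of_nat (n x) * rd_b v x h)"
      "(\<Sum>x\<in>X. n x) = 1 \<longrightarrow> (\<exists>x\<in>X. q = Gen_f x)"
      using f_word_weight[OF finite_marks.fin q] by metis
    have "\<And>y. y \<in> X \<Longrightarrow> n y = (if y = x then 1 else 0)" using w n(1) by (intro delta) (auto simp: of_weight_def)
    then obtain y where y: "y \<in> X" "q = Gen_f y" using n(2) single by blast
    then have "x = y" using w assms(2) by (intro b_inj) (auto simp: of_weight_def)
    then show ?thesis using y by simp
  next
    case 3
    then show ?thesis using w neg[of "\<lambda>_. 0"] by (auto simp: of_weight_def)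
  qed
qed

text \<open>The root spaces of simple roots and of their negatives are lines. Every identification
  of generators across vertices rests on this.\<close>

lemma eigen_simple:
  assumes "x \<in> X"
  shows "eigen (rd_b v x) t \<Longrightarrow> \<exists>c. t - scl c (ge x) \<in> J"
    and "eigen (\<lambda>h. - rd_b v x h) t \<Longrightarrow> \<exists>c. t - scl c (gf x) \<in> J"
proof -
  have single: "s = scl (Poly_Mapping.lookup s p) (mono_word p)"
    if "Poly_Mapping.keys s \<subseteq> {p}" for s :: "('b, 'a) word \<Rightarrow>\<^sub>0 complex" and p
    using poly_mapping_expand[of "{p}" s] that by simp
  show "\<exists>c. t - scl c (ge x) \<in> J" if "eigen (rd_b v x) t"
    using eigen_tri[OF that] tri_simple(1)[OF _ assms] single[of _ "Gen_e x"]
    by (metis (no_types, lifting) IntD1 IntD2 insertI1 subset_iff)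
  show "\<exists>c. t - scl c (gf x) \<in> J" if "eigen (\<lambda>h. - rd_b v x h) t"
    using eigen_tri[OF that] tri_simple(2)[OF _ assms] single[of _ "Gen_f x"]
    by (metis (no_types, lifting) IntD1 IntD2 insertI1 subset_iff)
qed

section \<open>Root strings for even and odd simple roots\<close>

abbreviation "sgn2 x y \<equiv> koszul_sign (rd_p v x) (rd_p v y)"

lemma koszul_sign_nonzero: "koszul_sign d e \<noteq> 0" "koszul_sign d e * koszul_sign d e = 1"
  by (auto simp: koszul_sign_def)

lemma fe_same: "x \<in> X \<Longrightarrow> mono_word (Br (Gen_f x) (Gen_e x)) + scl (sgn2 x x) (gh (rd_a v x)) \<in> J"
proof -
  assume x: "x \<in> X"
  have "mono_word (Br (Gen_f x) (Gen_e x)) + scl (sgn2 x x) (mono_word (Br (Gen_e x) (Gen_f x)))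
      - scl (sgn2 x x) (mono_word (Br (Gen_e x) (Gen_f x)) - gh (rd_a v x)) \<in> J"
    using skew[of "Gen_f x" "Gen_e x"] x by (intro J_diff[OF _ J_scl[OF ef_same]]) simp_all
  then show ?thesis by (simp add: free_vs.scale_right_diff_distrib del: scl_single)
qed

lemma fe_other: "x \<in> X \<Longrightarrow> y \<in> X \<Longrightarrow> x \<noteq> y \<Longrightarrow> mono_word (Br (Gen_f x) (Gen_e y)) \<in> J"
proof -
  assume x: "x \<in> X" "y \<in> X" "x \<noteq> y"
  have "mono_word (Br (Gen_f x) (Gen_e y)) + scl (sgn2 x y) (mono_word (Br (Gen_e y) (Gen_f x)))
      - scl (sgn2 x y) (mono_word (Br (Gen_e y) (Gen_f x))) \<in> J"
    using skew[of "Gen_f x" "Gen_e y"] x by (intro J_diff[OF _ J_scl[OF ef_other]]) auto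
  then show ?thesis by (simp del: scl_single)
qed

text \<open>Regroupings that present a congruence as a combination of known members of
  \<open>J\<close>.\<close>

lemma scl_identities:
  fixes A B C D E :: "'w \<Rightarrow>\<^sub>0 complex"
  shows "A - scl s (C - E) = (A - B - scl s C) + (B + scl s D) - scl s (D - E)"
    and "A - scl (s * (d - w)) E = A - scl s (C - scl w E) + scl s (C - scl d E)"
  by (simp_all add: free_vs.scale_right_diff_distrib right_diff_distrib free_vs.scale_left_diff_distrib)

text \<open>Jacobi for f_x, e_x and \<open>p\<close>, where [f_x, e_x] = -s a(x) and a(x) acts on
  \<open>p\<close> through its weight; s is -1 exactly when \<open>x\<close> is odd.\<close>

lemma f_ad_e:
  assumes "x \<in> X" "p \<in> words X v"
  shows "free_bracket (gf x) (mono_word (Br (Gen_e x) p))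
    - scl (sgn2 x x) (free_bracket (ge x) (free_bracket (gf x) (mono_word p))
        - scl (word_weight (rd_b v) p (rd_a v x)) (mono_word p)) \<in> J"
proof -
  let ?s = "sgn2 x x" and ?p = "mono_word p" and ?w = "word_weight (rd_b v) p (rd_a v x)"
  have 1: "free_bracket (gf x) (free_bracket (ge x) ?p) - free_bracket (mono_word (Br (Gen_f x) (Gen_e x))) ?p
    - scl ?s (free_bracket (ge x) (free_bracket (gf x) ?p)) \<in> J"
    using jacobi_right[of "Gen_f x" "Gen_e x" ?p] assms by simp
  have "free_bracket (mono_word (Br (Gen_f x) (Gen_e x)) + scl ?s (gh (rd_a v x))) ?p \<in> J"
    using assms by (intro J_left fe_same) auto
  then have 2: "free_bracket (mono_word (Br (Gen_f x) (Gen_e x))) ?p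
      + scl ?s (free_bracket (gh (rd_a v x)) ?p) \<in> J"
    by (simp only: free_bracket_add_left free_bracket_scl_left)
  have 3: "scl ?s (free_bracket (gh (rd_a v x)) ?p - scl ?w ?p) \<in> J"
    using ad_h_word[of "rd_a v x" p] assms finite_marks.a_in by (intro J_scl) auto
  have "free_bracket (gf x) (free_bracket (ge x) ?p)
      - scl ?s (free_bracket (ge x) (free_bracket (gf x) ?p) - scl ?w ?p) \<in> J"
    unfolding scl_identities(1)[of "free_bracket (gf x) (free_bracket (ge x) ?p)" ?s _ _
        "free_bracket (mono_word (Br (Gen_f x) (Gen_e x))) ?p" "free_bracket (gh (rd_a v x)) ?p"]
    by (rule J_diff[OF J_add[OF 1 2] 3])
  then show ?thesis by simp
qed

text \<open>The scalar by which f_x lowers the n-th vector of the root string, as produced by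
  iterating \<open>f_ad_e\<close>.\<close>

primrec string_coeff :: "'a \<Rightarrow> 'a \<Rightarrow> nat \<Rightarrow> complex" where
  "string_coeff x z 0 = 0"
| "string_coeff x z (Suc n) = sgn2 x x * (string_coeff x z n - (cartan v x z + of_nat n * cartan v x x))"

lemma ad_word_in: "x \<in> X \<Longrightarrow> z \<in> X \<Longrightarrow> ad_word x z n \<in> words X v"
  by (induction n) auto

lemma ad_word_weight: "word_weight (rd_b v) (ad_word x z n) h = rd_b v z h + of_nat n * rd_b v x h"
  by (induction n) (auto simp: algebra_simps)

lemma f_ad_word:
  assumes "x \<in> X" "z \<in> X" "z \<noteq> x"
  shows "free_bracket (gf x) (mono_word (ad_word x z n))
    - scl (string_coeff x z n) (mono_word (ad_word x z (n - 1))) \<in> J"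
proof (induction n)
  case 0
  then show ?case using fe_other[of x z] assms by simp
next
  case (Suc n)
  let ?s = "sgn2 x x" and ?E = "\<lambda>n. mono_word (ad_word x z n)"
  let ?w = "cartan v x z + of_nat n * cartan v x x" and ?d = "string_coeff x z n"
  have w: "word_weight (rd_b v) (ad_word x z n) (rd_a v x) = ?w"
    by (simp add: ad_word_weight cartan_def)
  have 1: "free_bracket (gf x) (?E (Suc n)) - scl ?s (free_bracket (ge x) (free_bracket (gf x) (?E n))
      - scl ?w (?E n)) \<in> J"
    using f_ad_e[OF assms(1) ad_word_in[OF assms(1,2)], of n] unfolding w by simp
  have "free_bracket (ge x) (free_bracket (gf x) (?E n) - scl ?d (?E (n - 1))) \<in> J"
    using Suc assms by (intro J_right) auto
  \<comment> \<open>For \<open>n = 0\<close> the truncated \<open>n - 1\<close> does not name a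
    lower vector, but its coefficient \<open>string_coeff x z 0\<close> is 0.\<close>
  moreover have "free_bracket (ge x) (free_bracket (gf x) (?E n) - scl ?d (?E (n - 1)))
      = free_bracket (ge x) (free_bracket (gf x) (?E n)) - scl ?d (?E n)"
    by (cases n) (simp_all add: free_bracket_linear)
  ultimately have "free_bracket (ge x) (free_bracket (gf x) (?E n)) - scl ?d (?E n) \<in> J" by metis
  then have 2: "scl ?s (free_bracket (ge x) (free_bracket (gf x) (?E n)) - scl ?d (?E n)) \<in> J"
    by (rule J_scl)
  have "free_bracket (gf x) (?E (Suc n)) - scl (?s * (?d - ?w)) (?E n) \<in> J"
    unfolding scl_identities(2)[of _ _ _ _ _ "free_bracket (ge x) (free_bracket (gf x) (?E n))"]
    by (rule J_add[OF 1 2])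
  then show ?case by (simp only: string_coeff.simps diff_Suc_1)
qed

text \<open>The sl2 formula for lowering along a string; the factor 2 clears the denominator of n (n
  - 1) / 2.\<close>

lemma string_coeff_even:
  "rd_p v x = 0 \<Longrightarrow> 2 * string_coeff x z n = - of_nat n * (2 * cartan v x z + (of_nat n - 1) * cartan v x x)"
  by (induction n) (auto simp: koszul_sign_def algebra_simps)

text \<open>For odd \<open>x\<close> the recursion alternates in sign, as in osp(1|2), so even and
  odd places of the string obey different formulas.\<close>

lemma string_coeff_odd:
  "rd_p v x = 1 \<Longrightarrow> string_coeff x z (2 * k) = of_nat k * cartan v x x
    \<and> string_coeff x z (Suc (2 * k)) = cartan v x z + of_nat k * cartan v x x"
proof (induction k)
  case 0
  then show ?case by (simp add: koszul_sign_def)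
next
  case (Suc k)
  have step: "string_coeff x z (Suc n) = (cartan v x z + of_nat n * cartan v x x) - string_coeff x z n" for n
    using Suc.prems by (simp add: koszul_sign_def)
  have k: "2 * Suc k = Suc (Suc (2 * k))" by simp
  note IH = Suc.IH[OF Suc.prems]
  have 1: "string_coeff x z (Suc (Suc (2 * k))) = of_nat (Suc k) * cartan v x x"
    unfolding step[of "Suc (2 * k)"] by (simp add: IH distrib_right del: string_coeff.simps)
  have "string_coeff x z (Suc (Suc (Suc (2 * k)))) = cartan v x z + of_nat (Suc k) * cartan v x x"
    unfolding step[of "Suc (Suc (2 * k))"] 1 by (simp add: distrib_right)
  then show ?case unfolding k using 1 by blast
qed

text \<open>Lowering the first vanishing vector of the string gives 0 although the vector before it
  is nonzero, so the coefficient at that place is 0; its closed form is then solved for a_xz /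
  a_xx.\<close>

lemma finite_string:
  assumes x: "x \<in> X" "z \<in> X" "z \<noteq> x" "cartan v x x \<noteq> 0" and N: "mono_word (ad_word x z N) \<in> J"
  shows "rd_p v x = 0 \<Longrightarrow> 2 * cartan v x z / cartan v x x \<in> \<int>\<^sub>\<le>\<^sub>0"
    and "rd_p v x = 1 \<Longrightarrow> cartan v x z / cartan v x x \<in> \<int>\<^sub>\<le>\<^sub>0"
proof -
  define M where "M = (LEAST n. mono_word (ad_word x z n) \<in> J)"
  have M: "mono_word (ad_word x z M) \<in> J" unfolding M_def using N by (rule LeastI)
  have "M \<noteq> 0" using M e_not_in_J x by (auto intro: ccontr)
  then obtain m where m: "M = Suc m" by (cases M) auto
  have m': "mono_word (ad_word x z m) \<notin> J"
    using not_less_Least[of m "\<lambda>n. mono_word (ad_word x z n) \<in> J"] m unfolding M_def by auto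
  have "free_bracket (gf x) (mono_word (ad_word x z M)) \<in> J" using M x by (intro J_right) auto
  then have s: "scl (string_coeff x z M) (mono_word (ad_word x z m)) \<in> J"
    using J_diff_cancel[OF f_ad_word[OF x(1-3), of M]] m by simp
  have 0: "string_coeff x z M = 0"
  proof (rule ccontr)
    assume "string_coeff x z M \<noteq> 0"
    then have "mono_word (ad_word x z m) = scl (inverse (string_coeff x z M)) (scl (string_coeff x z M) (mono_word (ad_word x z m)))"
      by simp
    then show False using J_scl[OF s] m' by metis
  qed
  show "2 * cartan v x z / cartan v x x \<in> \<int>\<^sub>\<le>\<^sub>0" if "rd_p v x = 0"
  proof -
    have "of_nat M * (2 * cartan v x z + (of_nat M - 1) * cartan v x x) = 0"
      using string_coeff_even[OF that, of z M] 0 by simp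
    then have "complex_of_nat (Suc m) = 0 \<or> 2 * cartan v x z + (of_nat (Suc m) - 1) * cartan v x x = 0"
      unfolding m by (simp only: mult_eq_0_iff)
    then have "2 * cartan v x z + of_nat m * cartan v x x = 0"
      using of_nat_eq_0_iff[of "Suc m", where ?'a = complex] by (simp del: of_nat_eq_0_iff)
    then have "2 * cartan v x z / cartan v x x = - of_nat m"
      using x(4) by (simp add: field_simps add_eq_0_iff)
    then show ?thesis by simp
  qed
  show "cartan v x z / cartan v x x \<in> \<int>\<^sub>\<le>\<^sub>0" if p: "rd_p v x = 1"
  proof (cases "even M")
    \<comment> \<open>At an even place the coefficient is \<open>k\<close> times a_xx with
      \<open>k > 0\<close>, so the string cannot first vanish there.\<close>
    case True
    then obtain k where k: "M = 2 * k" by blast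
    then show ?thesis using string_coeff_odd[OF p, of z k] 0 x(4) m by auto
  next
    case False
    then obtain k where "M = Suc (2 * k)" by (auto elim: oddE)
    then have "cartan v x z + of_nat k * cartan v x x = 0" using string_coeff_odd[OF p, of z k] 0 by metis
    then have "cartan v x z / cartan v x x = - of_nat k"
      using x(4) by (simp add: field_simps add_eq_0_iff)
    then show ?thesis by simp
  qed
qed

end

section \<open>Comparing simple roots of two vertices\<close>

locale root_transport = lie_transport + V: contragredient X v J + W: contragredient X w K
begin

lemma T_diff: "T t s \<Longrightarrow> T t' s' \<Longrightarrow> T (t - t') (s - s')"
  using T_add[OF _ T_scl[of t' s' "-1"], of t s] by simp

lemma T_cong: "T t s \<Longrightarrow> T t' s' \<Longrightarrow> t - t' \<in> J \<longleftrightarrow> s - s' \<in> K"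
  using T_diff T_kernel by blast

lemma T_eigen:
  assumes "T t s" "V.eigen \<mu> t"
  shows "W.eigen \<mu> s"
  unfolding W.eigen_def
proof (intro conjI ballI)
  show "s \<in> free_space X w" using T_free assms(1) by blast
  fix h assume "h \<in> rd_space w"
  then have h: "h \<in> rd_space v" using space_eq by simp
  show "W.ad_h h s - scl (\<mu> h) s \<in> K"
    using T_cong[OF T_bracket[OF T_h[OF h] assms(1)] T_scl[OF assms(1), of "\<mu> h"]] assms(2) h
    by (simp add: V.eigen_def)
qed

lemma eigen_coherent:
  assumes "t \<notin> J" "V.eigen \<mu> t"
  shows "\<exists>q\<in>tri_words X w. q \<in> W.of_weight \<mu>"
proof (rule ccontr)
  assume no: "\<not> ?thesis"
  obtain s where s: "T t s" using T_ex assms(2) V.eigen_def by blast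
  obtain r where "Poly_Mapping.keys r \<subseteq> tri_words X w \<inter> W.of_weight \<mu>" "s - r \<in> K"
    using W.eigen_tri[OF T_eigen[OF s assms(2)]] by blast
  then have "r = 0" "s - r \<in> K" using no by (auto simp flip: keys_eq_empty)
  then show False using T_kernel[OF s] assms(1) by simp
qed

text \<open>Weights are functions on the common space \<hh>, so a weight of g(v) is a weight of
  g(w), where \<open>tri_weight\<close> gives it one sign.\<close>

lemma eigen_sign:
  assumes "t \<notin> J" "V.eigen \<mu> t"
  obtains n where "\<And>h. h \<in> rd_space v \<Longrightarrow> \<mu> h = (\<Sum>x\<in>X. of_nat (n x) * rd_b w x h)"
  | n where "\<And>h. h \<in> rd_space v \<Longrightarrow> \<mu> h = - (\<Sum>x\<in>X. of_nat (n x) * rd_b w x h)"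
proof -
  obtain q where q: "q \<in> tri_words X w" "q \<in> W.of_weight \<mu>" using eigen_coherent[OF assms] by blast
  then have \<mu>: "\<mu> h = word_weight (rd_b w) q h" if "h \<in> rd_space v" for h
    using that space_eq by (simp add: W.of_weight_def)
  show thesis
    using q(1)
  proof (cases rule: W.tri_weight)
    case (1 n)
    then show ?thesis using \<mu> by (intro that(1)[of n]) simp
  next
    case (2 n)
    then show ?thesis using \<mu> by (intro that(2)[of n]) simp
  qed
qed

text \<open>The root space of b(x) at \<open>w\<close> is a line spanned by e_x; a transported
  vector in it is nonzero because \<open>t\<close> is.\<close>

lemma T_simple:
  assumes "V.eigen (rd_b w x) t" "x \<in> X" "t \<notin> J"
  obtains s c where "T t s" "s - scl c (W.ge x) \<in> K" "c \<noteq> 0"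
proof -
  obtain s where s: "T t s" using T_ex assms(1) V.eigen_def by blast
  obtain c where c: "s - scl c (W.ge x) \<in> K" using W.eigen_simple(1)[OF assms(2) T_eigen[OF s assms(1)]] by blast
  have "c \<noteq> 0" using c T_kernel[OF s] assms(3) by (auto simp: single_zero)
  then show thesis using that s c by blast
qed

lemma T_simple_neg:
  assumes "V.eigen (\<lambda>h. - rd_b w x h) t" "x \<in> X" "t \<notin> J"
  obtains s c where "T t s" "s - scl c (W.gf x) \<in> K" "c \<noteq> 0"
proof -
  obtain s where s: "T t s" using T_ex assms(1) V.eigen_def by blast
  obtain c where c: "s - scl c (W.gf x) \<in> K" using W.eigen_simple(2)[OF assms(2) T_eigen[OF s assms(1)]] by blast
  have "c \<noteq> 0" using c T_kernel[OF s] assms(3) by (auto simp: single_zero)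
  then show thesis using that s c by blast
qed

lemma eigen_gen:
  assumes "x \<in> X" "\<And>h. h \<in> rd_space v \<Longrightarrow> \<mu> h = rd_b v x h"
  shows "V.eigen \<mu> (V.ge x)"
  using V.eigen_word[of "Gen_e x"] assms by (simp add: V.eigen_def)

lemma eigen_gen_neg:
  assumes "x \<in> X" "\<And>h. h \<in> rd_space v \<Longrightarrow> \<mu> h = - rd_b v x h"
  shows "V.eigen \<mu> (V.gf x)"
  using V.eigen_word[of "Gen_f x"] assms by (simp add: V.eigen_def)

text \<open>e_x and f_x correspond to multiples c e_x' and d f_x', so their bracket a(x) corresponds
  to c d a(x'). The factors c and d are not known, which is why \<open>a\<close> is recovered only
  up to a scalar.\<close>

lemma same_root:
  assumes x: "x \<in> X" "x' \<in> X" and b: "\<And>h. h \<in> rd_space v \<Longrightarrow> rd_b v x h = rd_b w x' h"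
  shows "\<exists>k. k \<noteq> 0 \<and> rd_a v x = k *\<^sub>C rd_a w x'" and "rd_p v x = rd_p w x'"
proof -
  have E: "V.eigen (rd_b w x') (V.ge x)" using eigen_gen x b by simp
  have F: "V.eigen (\<lambda>h. - rd_b w x' h) (V.gf x)" using eigen_gen_neg x b by simp
  obtain s c where s: "T (V.ge x) s" "s - scl c (W.ge x') \<in> K" "c \<noteq> 0"
    using T_simple[OF E x(2) V.e_not_in_J[OF x(1)]] by blast
  obtain t d where t: "T (V.gf x) t" "t - scl d (W.gf x') \<in> K" "d \<noteq> 0"
    using T_simple_neg[OF F x(2) V.f_not_in_J[OF x(1)]] by blast
  let ?ef = "mono_word (Br (Gen_e x') (Gen_f x'))"
  have ax: "rd_a v x \<in> rd_space v" "rd_a w x' \<in> rd_space w"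
    using x V.finite_marks.a_in W.finite_marks.a_in by auto
  have 1: "free_bracket s t - W.gh (rd_a v x) \<in> K"
    using T_cong[OF T_bracket[OF s(1) t(1)] T_h[OF ax(1)]] V.ef_same[OF x(1)] by simp
  have "free_bracket s t - free_bracket (scl c (W.ge x')) (scl d (W.gf x')) \<in> K"
    using s t x T_free[OF t(1)] by (intro W.bracket_cong) auto
  moreover have "free_bracket (scl c (W.ge x')) (scl d (W.gf x')) = scl (c * d) ?ef"
    by simp
  ultimately have 2: "free_bracket s t - scl (c * d) ?ef \<in> K" by metis
  have 3: "scl (c * d) ?ef - scl (c * d) (W.gh (rd_a w x')) \<in> K"
    using W.J_scl[OF W.ef_same[OF x(2)], of "c * d"] by (simp only: free_vs.scale_right_diff_distrib)
  have 4: "W.gh ((c * d) *\<^sub>C rd_a w x') - scl (c * d) (W.gh (rd_a w x')) \<in> K"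
    by (rule W.h_scale[OF ax(2)])
  have "W.gh (rd_a v x) - W.gh ((c * d) *\<^sub>C rd_a w x') \<in> K"
    by (rule W.J_trans[OF W.J_trans[OF W.J_trans[OF W.J_sym[OF 1] 2] 3] W.J_sym[OF 4]])
  then have "rd_a v x = (c * d) *\<^sub>C rd_a w x'"
    using ax W.finite_marks.H_closed(2) space_eq by (intro W.h_inj) auto
  then show "\<exists>k. k \<noteq> 0 \<and> rd_a v x = k *\<^sub>C rd_a w x'" using s t by (metis mult_eq_0_iff)
  show "rd_p v x = rd_p w x'"
  proof (rule ccontr)
    assume ne: "rd_p v x \<noteq> rd_p w x'"
    have "parity_part (rd_p v) (rd_p v x) (V.ge x) = V.ge x"
      by (simp add: dgl_mono_word)
    then obtain s where s: "T (V.ge x) s" "parity_part (rd_p w) (rd_p v x) s = s"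
      using T_parity[of "V.ge x"] x by auto
    obtain c where c: "s - scl c (W.ge x') \<in> K"
      using W.eigen_simple(1)[OF x(2) T_eigen[OF s(1) E]] by blast
    \<comment> \<open>A homogeneous \<open>s\<close> differs from a multiple of e_x' by an element
      of the graded ideal \<open>K\<close>. If the parities differ, the projection removes e_x' and
      leaves \<open>s\<close> in \<open>K\<close>.\<close>
    have "parity_part (rd_p w) (rd_p v x) (s - scl c (W.ge x')) = s"
      using ne s(2) by (simp add: dgl_simps dgl_mono_word del: scl_single) 
    then have "s \<in> K" using W.J_graded[OF c, of "rd_p v x"] by simp
    then show False using T_kernel[OF s(1)] V.e_not_in_J[OF x(1)] by simp
  qed
qed

text \<open>To be applied with \<open>v\<close> the reflexion of \<open>w\<close> at
  \<open>x\<close> when a_xy = 0. The relation [e_y, f_x] = 0 at \<open>v\<close> reads [e_y, e_x] =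
  0 at \<open>w\<close>, and applying f_y there leaves, up to sign, a_yx e_x.\<close>

lemma weak_symmetry:
  assumes x: "x \<in> X" "y \<in> X" "x \<noteq> y" and yb: "\<And>h. h \<in> rd_space v \<Longrightarrow> rd_b v y h = rd_b w y h"
    and xb: "\<And>h. h \<in> rd_space v \<Longrightarrow> rd_b v x h = - rd_b w x h"
  shows "cartan w y x = 0"
proof -
  have E: "V.eigen (rd_b w y) (V.ge y)" using x yb by (intro eigen_gen) simp_all
  have F: "V.eigen (rd_b w x) (V.gf x)" using x xb by (intro eigen_gen_neg) simp_all
  obtain s c where s: "T (V.ge y) s" "s - scl c (W.ge y) \<in> K" "c \<noteq> 0"
    using T_simple[OF E x(2) V.e_not_in_J[OF x(2)]] by blast
  obtain t d where t: "T (V.gf x) t" "t - scl d (W.ge x) \<in> K" "d \<noteq> 0"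
    using T_simple[OF F x(1) V.f_not_in_J[OF x(1)]] by blast
  let ?ee = "mono_word (Br (Gen_e y) (Gen_e x))"
  have "free_bracket s t \<in> K"
    using T_kernel[OF T_bracket[OF s(1) t(1)]] V.ef_other[of y x] x by simp
  moreover have "free_bracket s t - free_bracket (scl c (W.ge y)) (scl d (W.ge x)) \<in> K"
    using s t x T_free[OF t(1)] by (intro W.bracket_cong) auto
  ultimately have "free_bracket (scl c (W.ge y)) (scl d (W.ge x)) \<in> K" using W.J_diff_cancel by blast
  then have "scl (inverse (c * d)) (free_bracket (scl c (W.ge y)) (scl d (W.ge x))) \<in> K"
    by (rule W.J_scl)
  moreover have "inverse c * inverse d * (c * d) = 1" using s(3) t(3) by (simp add: field_simps)
  ultimately have ee: "?ee \<in> K" by simp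
  have 1: "free_bracket (W.gf y) ?ee \<in> K" using ee x by (intro W.J_right) auto
  have 2: "free_bracket (W.ge y) (free_bracket (W.gf y) (W.ge x)) \<in> K"
    using W.J_right[OF W.fe_other[of y x], of "W.ge y"] x by simp
  let ?s = "W.sgn2 y y" and ?k = "cartan w y x"
  have "free_bracket (W.gf y) ?ee - scl ?s (free_bracket (W.ge y) (free_bracket (W.gf y) (W.ge x))
        - scl ?k (W.ge x)) \<in> K"
    using W.f_ad_e[of y "Gen_e x"] x by (simp add: cartan_def)
  then have "scl ?s (free_bracket (W.ge y) (free_bracket (W.gf y) (W.ge x)) - scl ?k (W.ge x)) \<in> K"
    using 1 W.J_diff_cancel by blast
  then have "scl ?s (scl ?s (free_bracket (W.ge y) (free_bracket (W.gf y) (W.ge x)) - scl ?k (W.ge x))) \<in> K"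
    by (rule W.J_scl)
  then have "free_bracket (W.ge y) (free_bracket (W.gf y) (W.ge x)) - scl ?k (W.ge x) \<in> K"
    by (simp only: free_vs.scale_scale W.koszul_sign_nonzero free_vs.scale_one)
  then have k: "scl ?k (W.ge x) \<in> K" using 2 W.J_diff_cancel by blast
  show ?thesis
  proof (rule ccontr)
    assume "?k \<noteq> 0"
    then have "W.ge x \<in> K" using W.J_scl[OF k, of "inverse ?k"] by simp
    then show False using W.e_not_in_J x by blast
  qed
qed

end

section \<open>Coxeter graphs from sign-coherent coordinates\<close>

text \<open>
  \<open>C u w x\<close> is the row of coordinates of the root \<open>b\<^sub>w(x)\<close> in the basis \<open>b\<^sub>u\<close>, and \<open>c w x y\<close> is the
  multiple of \<open>b\<^sub>w(x)\<close> that the reflexion \<open>r w x\<close> adds to \<open>b\<^sub>w(y)\<close>.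
\<close>

locale reflexion_graph =
  fixes V :: "'v set" and X :: "'x set" and rf :: "'v \<Rightarrow> 'x \<Rightarrow> bool" and r :: "'v \<Rightarrow> 'x \<Rightarrow> 'v"
    and c :: "'v \<Rightarrow> 'x \<Rightarrow> 'x \<Rightarrow> nat" and C :: "'v \<Rightarrow> 'v \<Rightarrow> 'x \<Rightarrow> 'x \<Rightarrow> int"
  assumes fin: "finite X"
    and rf_in: "rf w x \<Longrightarrow> x \<in> X"
    and r_closed: "\<lbrakk>w \<in> V; rf w x\<rbrakk> \<Longrightarrow> r w x \<in> V"
    and r_rf: "\<lbrakk>w \<in> V; rf w x\<rbrakk> \<Longrightarrow> rf (r w x) x"
    and r_inv: "\<lbrakk>w \<in> V; rf w x\<rbrakk> \<Longrightarrow> r (r w x) x = w"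
    and reach: "\<lbrakk>u \<in> V; w \<in> V\<rbrakk> \<Longrightarrow> (\<lambda>s t. \<exists>x. rf s x \<and> t = r s x)\<^sup>*\<^sup>* u w"
    and C_id: "\<lbrakk>u \<in> V; x \<in> X\<rbrakk> \<Longrightarrow> C u u x = (\<lambda>y. if y = x then 1 else 0)"
    and C_trans: "\<lbrakk>u \<in> V; t \<in> V; w \<in> V; x \<in> X\<rbrakk> \<Longrightarrow> C u w x = (\<lambda>y. \<Sum>z\<in>X. C t w x z * C u t z y)"
    and C_r: "\<lbrakk>w \<in> V; rf w x; y \<in> X\<rbrakk> \<Longrightarrow> C w (r w x) y =
      (\<lambda>z. if y = x then (if z = x then -1 else 0)
           else (if z = y then 1 else 0) + (if z = x then int (c w x y) else 0))"
    and C_sign: "\<lbrakk>u \<in> V; w \<in> V; x \<in> X\<rbrakk> \<Longrightarrow> (\<forall>y. C u w x y \<ge> 0) \<or> (\<forall>y. C u w x y \<le> 0)"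
    and rf_root: "\<lbrakk>t \<in> V; w \<in> V; z \<in> X; rf w x; C w t z = C w w x\<rbrakk> \<Longrightarrow> rf t z"
    and c_inv: "\<lbrakk>w \<in> V; rf w x; y \<in> X; y \<noteq> x\<rbrakk> \<Longrightarrow> c (r w x) x y = c w x y"
    and c_const: "\<lbrakk>w \<in> V; x \<noteq> y; rf w x; rf w y; rf (r w x) y\<rbrakk> \<Longrightarrow> c (r w x) y x = c w y x"
    and c_zero: "\<lbrakk>w \<in> V; x \<noteq> y; rf w x; rf w y\<rbrakk> \<Longrightarrow> c w x y = 0 \<Longrightarrow> c w y x = 0"
    and close: "\<lbrakk>w \<in> V; x \<noteq> y; rf w x; rf w y;
      (\<lambda>s t. \<exists>z\<in>{x, y}. rf s z \<and> t = r s z)\<^sup>*\<^sup>* w s; (\<lambda>s t. \<exists>z\<in>{x, y}. rf s z \<and> t = r s z)\<^sup>*\<^sup>* w s';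
      \<And>z. z \<in> X \<Longrightarrow> C s s' z = C s s z\<rbrakk> \<Longrightarrow> s = s'"
begin

definition P :: "'v \<Rightarrow> 'v \<Rightarrow> 'x \<Rightarrow> bool" where "P u w x \<longleftrightarrow> (\<forall>y. C u w x y \<ge> 0)"
definition N :: "'v \<Rightarrow> 'v \<Rightarrow> 'x \<Rightarrow> bool" where "N u w x \<longleftrightarrow> (\<forall>y. C u w x y \<le> 0)"

lemma P_or_N: "\<lbrakk>u \<in> V; w \<in> V; x \<in> X\<rbrakk> \<Longrightarrow> P u w x \<or> N u w x"
  using C_sign by (auto simp: P_def N_def)

lemma sum_single: "z \<in> X \<Longrightarrow> (\<Sum>q\<in>X. (if q = z then k else 0) * f q) = k * (f z :: int)"
  using fin by (simp add: if_distrib[of "\<lambda>u. u * _"] cong: if_cong)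

lemma C_row_cong:
  assumes "u \<in> V" "t \<in> V" "w \<in> V" "w' \<in> V" "x \<in> X" "x' \<in> X" "C t w x = C t w' x'"
  shows "C u w x = C u w' x'"
  using C_trans[of u t w x] C_trans[of u t w' x'] assms by simp

lemma C_row_nonzero:
  assumes "u \<in> V" "w \<in> V" "x \<in> X"
  shows "\<exists>y. C u w x y \<noteq> 0"
proof (rule ccontr)
  assume "\<not> ?thesis"
  then have "C w w x x = 0" using C_trans[of w u w x] assms by simp
  then show False using C_id[of w x] assms by simp
qed

lemma not_P_N: "\<lbrakk>u \<in> V; w \<in> V; x \<in> X\<rbrakk> \<Longrightarrow> P u w x \<Longrightarrow> \<not> N u w x"
  using C_row_nonzero unfolding P_def N_def by (metis order_antisym)

lemma C_next:
  assumes "u \<in> V" "w \<in> V" "rf w x" "y \<in> X"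
  shows "C u (r w x) y = (\<lambda>z. if y = x then - C u w x z else C u w y z + int (c w x y) * C u w x z)"
proof
  fix z
  have x: "x \<in> X" using assms rf_in by auto
  have "C u (r w x) y z = (\<Sum>q\<in>X. C w (r w x) y q * C u w q z)"
    using C_trans[of u w "r w x" y] assms r_closed by simp
  also have "\<dots> = (\<Sum>q\<in>X. (if q = x then (if y = x then -1 else int (c w x y)) else 0) * C u w q z)
      + (\<Sum>q\<in>X. (if q = y then (if y = x then 0 else 1) else 0) * C u w q z)"
    unfolding C_r[OF assms(2-4)] sum.distrib[symmetric] by (intro sum.cong) (auto simp: distrib_right)
  also have "\<dots> = (if y = x then - C u w x z else C u w y z + int (c w x y) * C u w x z)"
    unfolding sum_single[OF x] sum_single[OF assms(4)] by simp
  finally show "C u (r w x) y z = (if y = x then - C u w x z else C u w y z + int (c w x y) * C u w x z)" .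
qed

text \<open>Passing between the bases at \<open>w\<close> and at \<open>r w x\<close> negates the
  root marked \<open>x\<close> and shears the others along it, so only the coordinate at
  \<open>x\<close> can differ.\<close>

lemma C_from_r:
  assumes "w \<in> V" "t \<in> V" "rf w x" "z \<in> X" "y \<noteq> x"
  shows "C (r w x) t z y = C w t z y"
proof (cases "y \<in> X")
  case True
  have x: "x \<in> X" using assms rf_in by auto
  have w': "r w x \<in> V" "rf (r w x) x" using assms r_closed r_rf by auto
  have row: "C (r w x) w q y = (if q = y then 1 else 0)" if "q \<in> X" for q
    using C_r[OF w' that] r_inv[OF assms(1,3)] assms(5) by auto
  have "C (r w x) t z y = (\<Sum>q\<in>X. C w t z q * C (r w x) w q y)"
    using C_trans[of "r w x" w t z] assms w' by simp
  also have "\<dots> = (\<Sum>q\<in>X. (if q = y then 1 else 0) * C w t z q)"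
    by (intro sum.cong) (auto simp: row)
  also have "\<dots> = C w t z y" using sum_single[OF True, of 1 "C w t z"] by simp
  finally show ?thesis .
next
  case False
  have w': "r w x \<in> V" "rf (r w x) x" using assms r_closed r_rf by auto
  have zero: "C s t z y = 0" if "s \<in> V" for s
  proof -
    have "C s t z y = (\<Sum>q\<in>X. C s t z q * C s s q y)"
      using fun_cong[OF C_trans[OF that that assms(2,4)], of y] .
    also have "\<dots> = 0" using C_id[OF that] False by (intro sum.neutral) auto
    finally show ?thesis .
  qed
  show ?thesis using zero assms w' by simp
qed

text \<open>The coordinate matrices are invertible over the integers, so a row supported at
  \<open>x\<close> has a unit there.\<close>

lemma C_multiple:
  assumes "w \<in> V" "t \<in> V" "z \<in> X" "x \<in> X" "\<And>y. y \<noteq> x \<Longrightarrow> C w t z y = 0"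
  shows "C w t z = C w w x \<or> C w t z = (\<lambda>y. - C w w x y)"
proof -
  let ?k = "C w t z x"
  have row: "C w t z = (\<lambda>y. if y = x then ?k else 0)" using assms(5) by auto
  have "1 = C t t z z" using C_id[of t z] assms by simp
  also have "\<dots> = (\<Sum>q\<in>X. C w t z q * C t w q z)" using C_trans[of t w t z] assms by simp
  also have "\<dots> = (\<Sum>q\<in>X. (if q = x then ?k else 0) * C t w q z)" using assms(5) by (intro sum.cong) auto
  also have "\<dots> = ?k * C t w x z" by (rule sum_single[OF assms(4)])
  finally have "\<bar>?k\<bar> = 1" by (metis zmult_eq_1_iff abs_1 abs_minus_cancel)
  then have "?k = 1 \<or> ?k = -1" by arith
  then show ?thesis unfolding C_id[OF assms(1,4)] by (subst (1 2) row) auto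
qed

text \<open>Off \<open>x\<close> the coordinates at both ends agree but have opposite signs, so they
  vanish and the root is a positive multiple of b_w(x).\<close>

lemma sign_change:
  assumes "w \<in> V" "t \<in> V" "rf w x" "z \<in> X" "P w t z" "N (r w x) t z"
  shows "C w t z = C w w x"
proof -
  have x: "x \<in> X" using assms rf_in by auto
  have z: "C w t z y = 0" if "y \<noteq> x" for y
    using C_from_r[OF assms(1-4) that] assms(5,6) unfolding P_def N_def by (metis order_antisym)
  have "C w t z x \<ge> 0" using assms(5) by (auto simp: P_def)
  then show ?thesis using C_multiple[OF assms(1,2,4) x z] C_id[OF assms(1) x] by auto
qed

text \<open>b_t(z) is positive at \<open>t\<close> itself. On a path from \<open>t\<close> to
  \<open>u\<close> its sign changes at some edge, where it is the simple root reflected in;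
  \<open>rf_root\<close> carries reflectability back to \<open>t\<close>.\<close>

lemma rf_crossing:
  assumes "t \<in> V" "u \<in> V" "z \<in> X" "N u t z"
  shows "rf t z"
proof -
  have "w \<in> V \<and> (N w t z \<longrightarrow> rf t z)" if "(\<lambda>s t. \<exists>x. rf s x \<and> t = r s x)\<^sup>*\<^sup>* t w" for w
    using that
  proof (induction rule: rtranclp_induct)
    case base
    then show ?case using assms C_id[of t z] by (auto simp: N_def)
  next
    case (step w w')
    then obtain x where x: "rf w x" "w' = r w x" by blast
    have w: "w \<in> V" using step by blast
    show ?case
    proof (intro conjI impI)
      show "w' \<in> V" using r_closed w x by simp
      assume N': "N w' t z"
      show "rf t z"
      proof (cases "N w t z")
        case False
        then have "C w t z = C w w x"
          using P_or_N w assms x N' by (intro sign_change) auto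
        then show ?thesis using rf_root w assms x by blast
      qed (use step in blast)
    qed
  qed
  then show ?thesis using reach[of t u] assms by blast
qed

text \<open>Inversions are stored as rows of coordinates at \<open>u\<close>, so that a root
  occurring at many vertices is counted once.\<close>

definition Inv :: "'v \<Rightarrow> 'v \<Rightarrow> ('x \<Rightarrow> int) set" where
  "Inv u w = {C u t z | t z. t \<in> V \<and> z \<in> X \<and> P u t z \<and> N w t z}"

definition height :: "'v \<Rightarrow> 'v \<Rightarrow> nat" where "height u w = card (Inv u w)"

lemma Inv_self: "u \<in> V \<Longrightarrow> Inv u u = {}"
  using not_P_N by (auto simp: Inv_def)

text \<open>By \<open>sign_change\<close> an edge flips only the root that it reflects in, together
  with its negative.\<close>

lemma Inv_step:
  assumes "u \<in> V" "w \<in> V" "rf w x" "N u w x"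
  shows "Inv u w = insert (C u (r w x) x) (Inv u (r w x))" "C u (r w x) x \<notin> Inv u (r w x)"
proof -
  let ?w = "r w x"
  have x: "x \<in> X" using assms rf_in by auto
  have w': "?w \<in> V" "rf ?w x" "r ?w x = w" using assms r_closed r_rf r_inv by auto
  have neg: "C s ?w x = (\<lambda>z. - C s w x z)" if "s \<in> V" for s
    using C_next[OF that assms(2,3) x] by simp
  have in1: "C u ?w x \<in> Inv u w"
  proof -
    have "P u ?w x" using assms(4) by (auto simp: P_def N_def neg[OF assms(1)])
    moreover have "N w ?w x" using C_id[OF assms(2) x] by (auto simp: N_def neg[OF assms(2)])
    ultimately show ?thesis using w' x unfolding Inv_def by blast
  qed
  have sub: "Inv u ?w \<subseteq> Inv u w"
  proof
    fix \<beta> assume "\<beta> \<in> Inv u ?w"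
    then obtain t z where tz: "\<beta> = C u t z" "t \<in> V" "z \<in> X" "P u t z" "N ?w t z"
      by (auto simp: Inv_def)
    have "N w t z"
    proof (rule ccontr)
      assume "\<not> N w t z"
      then have "C w t z = C w w x" using P_or_N tz assms by (intro sign_change) auto
      then have "C u t z = C u w x" using C_row_cong[of u w t w z x] tz assms x by auto
      then have "N u t z" using assms(4) by (auto simp: N_def)
      then show False using not_P_N tz assms by blast
    qed
    then show "\<beta> \<in> Inv u w" using tz by (auto simp: Inv_def)
  qed
  have sup: "\<beta> \<in> insert (C u ?w x) (Inv u ?w)" if "\<beta> \<in> Inv u w" for \<beta>
  proof -
    obtain t z where tz: "\<beta> = C u t z" "t \<in> V" "z \<in> X" "P u t z" "N w t z"
      using \<open>\<beta> \<in> Inv u w\<close> by (auto simp: Inv_def)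
    show ?thesis
    proof (cases "N ?w t z")
      case True
      then show ?thesis using tz by (auto simp: Inv_def)
    next
      case False
      then have "C ?w t z = C ?w ?w x"
        using P_or_N tz w' by (intro sign_change) auto
      then have "C u t z = C u ?w x" using C_row_cong[of u ?w t ?w z x] tz w' x assms by auto
      then show ?thesis using tz by simp
    qed
  qed
  show "Inv u w = insert (C u ?w x) (Inv u ?w)" using in1 sub sup by blast
  show "C u ?w x \<notin> Inv u ?w"
  proof
    assume "C u ?w x \<in> Inv u ?w"
    then obtain t z where tz: "C u ?w x = C u t z" "t \<in> V" "z \<in> X" "N ?w t z"
      by (auto simp: Inv_def)
    then have "C ?w ?w x = C ?w t z" using C_row_cong[of ?w u ?w t x z] w' x assms by auto
    then show False using tz(4) C_id[OF w'(1) x] unfolding N_def by (metis not_one_le_zero)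
  qed
qed

lemma N_r_iff:
  assumes "u \<in> V" "w \<in> V" "rf w x"
  shows "N u (r w x) x \<longleftrightarrow> P u w x"
  using C_next[OF assms rf_in[OF assms(3)]] by (auto simp: P_def N_def)

text \<open>There may be infinitely many real roots, but each edge of a path from \<open>u\<close>
  changes the set by one element. Without finiteness the cardinality in \<open>height\<close> would
  be a default 0.\<close>

lemma finite_Inv:
  assumes "u \<in> V" "w \<in> V"
  shows "finite (Inv u w)"
proof -
  have "w \<in> V \<and> finite (Inv u w)"
    using reach[OF assms]
  proof (induction rule: rtranclp_induct)
    case base
    then show ?case using assms Inv_self by simp
  next
    case (step w w')
    then obtain x where x: "rf w x" "w' = r w x" by blast
    have w: "w \<in> V" "r w x \<in> V" "rf (r w x) x" "r (r w x) x = w" using step x r_closed r_rf r_inv by auto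
    show ?case
    proof (cases "N u w x")
      case True
      then show ?thesis using Inv_step(1)[OF assms(1) w(1) x(1)] step w x by simp
    next
      case False
      then have "N u (r w x) x" using N_r_iff P_or_N assms(1) w x rf_in by blast
      then show ?thesis using Inv_step(1)[OF assms(1) w(2,3)] step w x by simp
    qed
  qed
  then show ?thesis by simp
qed

lemma height_self: "u \<in> V \<Longrightarrow> height u u = 0"
  by (simp add: height_def Inv_self)

lemma height_down:
  assumes "u \<in> V" "w \<in> V" "rf w x" "N u w x"
  shows "height u w = Suc (height u (r w x))"
  using Inv_step[OF assms] finite_Inv[of u "r w x"] r_closed assms by (simp add: height_def)

lemma height_up:
  assumes "u \<in> V" "w \<in> V" "rf w x" "\<not> N u w x"
  shows "height u (r w x) = Suc (height u w)"
  using height_down[of u "r w x" x] N_r_iff[OF assms(1-3)] P_or_N[OF assms(1,2) rf_in[OF assms(3)]]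
    r_closed r_rf r_inv assms by auto

section \<open>Paths as words of marks\<close>

fun run :: "'v \<Rightarrow> 'x list \<Rightarrow> 'v" where
  "run w [] = w" | "run w (x # xs) = run (r w x) xs"

fun valid :: "'v \<Rightarrow> 'x list \<Rightarrow> bool" where
  "valid w [] \<longleftrightarrow> True" | "valid w (x # xs) \<longleftrightarrow> rf w x \<and> valid (r w x) xs"

text \<open>The final vertex is left out, so that these lists concatenate along with the
  words.\<close>

fun sources :: "'v \<Rightarrow> 'x list \<Rightarrow> 'v list" where
  "sources w [] = []" | "sources w (x # xs) = w # sources (r w x) xs"

lemma run_append [simp]: "run w (xs @ ys) = run (run w xs) ys"
  by (induction xs arbitrary: w) auto

lemma valid_append [simp]: "valid w (xs @ ys) \<longleftrightarrow> valid w xs \<and> valid (run w xs) ys"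
  by (induction xs arbitrary: w) auto

lemma sources_append [simp]: "sources w (xs @ ys) = sources w xs @ sources (run w xs) ys"
  by (induction xs arbitrary: w) auto

lemma run_closed: "w \<in> V \<Longrightarrow> valid w xs \<Longrightarrow> run w xs \<in> V"
  by (induction xs arbitrary: w) (auto simp: r_closed)

lemma run_rev: "w \<in> V \<Longrightarrow> valid w xs \<Longrightarrow> run (run w xs) (rev xs) = w \<and> valid (run w xs) (rev xs)"
  by (induction xs arbitrary: w) (auto simp: r_closed r_inv r_rf)

lemma sources_rev:
  "w \<in> V \<Longrightarrow> valid w xs \<Longrightarrow> set (sources (run w xs) (rev xs)) \<subseteq> insert (run w xs) (set (sources w xs))"
proof (induction xs arbitrary: w)
  case (Cons x xs)
  let ?w = "r w x"
  have w: "?w \<in> V" "valid ?w xs" using Cons r_closed by auto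
  have "?w \<in> insert (run ?w xs) (set (sources ?w xs))" by (cases xs) auto
  then show ?case using Cons.IH[OF w] run_rev[OF w] by auto
qed simp

fun alt :: "'x \<Rightarrow> 'x \<Rightarrow> nat \<Rightarrow> 'x list" where
  "alt x y 0 = []" | "alt x y (Suc n) = x # alt y x n"

lemma alt_snoc: "alt x y (Suc n) = alt x y n @ [if even n then x else y]"
  by (induction n arbitrary: x y) auto

lemma alt_add: "alt x y (2 * m + n) = alt x y (2 * m) @ alt x y n"
  by (induction m) auto

lemma alt_concat: "concat (replicate m [x, y]) = alt x y (2 * m)"
  by (induction m) auto

section \<open>Vertices joined through two marks\<close>

definition linked :: "'x \<Rightarrow> 'x \<Rightarrow> 'v \<Rightarrow> 'v \<Rightarrow> bool" where
  "linked x y = (\<lambda>s t. \<exists>z\<in>{x, y}. rf s z \<and> t = r s z)\<^sup>*\<^sup>*"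

lemma linked_closed: "linked x y s t \<Longrightarrow> s \<in> V \<Longrightarrow> t \<in> V"
  unfolding linked_def by (induction rule: rtranclp_induct) (auto simp: r_closed)

lemma linked_sym: "linked x y s t \<Longrightarrow> s \<in> V \<Longrightarrow> linked x y t s"
  unfolding linked_def
proof (induction rule: rtranclp_induct)
  case (step t t')
  then have t: "t \<in> V" using linked_closed[of x y s t] by (simp add: linked_def)
  obtain z where "z \<in> {x, y}" "rf t z" "t' = r t z" using step by blast
  then have "\<exists>z\<in>{x, y}. rf t' z \<and> t = r t' z" using t r_rf r_inv by metis
  then show ?case
    using step.IH[OF step.prems] by (rule converse_rtranclp_into_rtranclp)
qed simp

lemma linked_trans: "linked x y s t \<Longrightarrow> linked x y t w \<Longrightarrow> linked x y s w"
  unfolding linked_def by (rule rtranclp_trans)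

lemma linked_run: "w \<in> V \<Longrightarrow> valid w xs \<Longrightarrow> set xs \<subseteq> {x, y} \<Longrightarrow> linked x y w (run w xs)"
proof (induction xs arbitrary: w)
  case (Cons z xs)
  then have "linked x y (r w z) (run (r w z) xs)" using r_closed by auto
  moreover have "\<exists>z\<in>{x, y}. rf w z \<and> r w z = r w z" using Cons by auto
  ultimately show ?case
    using Cons unfolding linked_def by (auto intro: converse_rtranclp_into_rtranclp)
qed (simp add: linked_def)

lemma set_alt: "set (alt x y n) \<subseteq> {x, y}"
  by (induction n arbitrary: x y) auto

lemma linked_outside:
  assumes "linked x y s t" "s \<in> V" "a \<in> X" "z \<notin> {x, y}"
  shows "C s t a z = (if z = a then 1 else 0)"
  using assms(1,3) unfolding linked_def
proof (induction arbitrary: a rule: rtranclp_induct)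
  case base
  then show ?case using C_id assms by simp
next
  case (step t t')
  then have t: "t \<in> V" using linked_closed[of x y s t] assms by (simp add: linked_def)
  obtain p where p: "p \<in> {x, y}" "rf t p" "t' = r t p" using step by blast
  then have "p \<in> X" "z \<noteq> p" using rf_in assms(4) by auto
  then show ?case
    using C_next[OF assms(2) t p(2) step.prems] step.IH[OF step.prems] step.IH[OF \<open>p \<in> X\<close>] p(3)
    by (auto split: if_splits)
qed

text \<open>For a third mark \<open>z\<close> the transition in each direction adds nonnegative
  multiples of the roots marked \<open>x\<close> and \<open>y\<close>. The two transitions are
  inverse to each other, so these multiples cancel and must be 0.\<close>

lemma closure_id:
  assumes s: "s \<in> V" "s' \<in> V" "linked x y s s'" and x: "x \<in> X" and y: "y \<in> X" "x \<noteq> y"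
    and C: "C s s' x = C s s x" "C s s' y = C s s y" and z: "z \<in> X"
  shows "C s s' z = C s s z"
proof (cases "z \<in> {x, y}")
  case True
  then show ?thesis using C by auto
next
  case False
  have s': "linked x y s' s" using linked_sym s by blast
  have outside: "C s s' z q = (if q = z then 1 else 0)" "C s' s z q = (if q = z then 1 else 0)"
    if "q \<notin> {x, y}" for q
    using linked_outside[OF s(3,1) z that] linked_outside[OF s' s(2) z that] by auto
  \<comment> \<open>The coordinate at \<open>z\<close> is 1, so sign coherence makes the whole row
    nonnegative.\<close>
  have pos: "C s s' z q \<ge> 0" "C s' s z q \<ge> 0" for q
    using C_sign[OF s(1,2) z] C_sign[OF s(2,1) z] outside[OF False] by (auto, (metis not_one_le_zero)+)
  have "(if q = z then 1 else 0) = C s s' z q + C s' s z x * (if q = x then 1 else 0)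
      + C s' s z y * (if q = y then 1 else 0)" for q
  proof -
    have "(if q = z then 1 else 0) = C s s z q" using C_id[OF s(1) z] by simp
    also have "\<dots> = (\<Sum>p\<in>X. C s' s z p * C s s' p q)"
      using fun_cong[OF C_trans[OF s(1,2,1) z], of q] .
    also have "\<dots> = (\<Sum>p\<in>X. (if p = z then 1 else 0) * C s s' p q)
      + (\<Sum>p\<in>X. (if p = x then C s' s z x else 0) * C s s' p q)
      + (\<Sum>p\<in>X. (if p = y then C s' s z y else 0) * C s s' p q)"
      unfolding sum.distrib[symmetric] using False y(2)
      by (intro sum.cong) (auto simp: outside)
    also have "\<dots> = C s s' z q + C s' s z x * (if q = x then 1 else 0)
      + C s' s z y * (if q = y then 1 else 0)"
      unfolding sum_single[OF z] sum_single[OF x] sum_single[OF y(1)] C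
      using C_id[OF s(1)] x y by simp
    finally show ?thesis .
  qed
  from this[of x] this[of y] have "C s s' z x = 0" "C s s' z y = 0"
    using pos[of x] pos[of y] False y(2) by auto
  then have "C s s' z q = (if q = z then 1 else 0)" for q
    using outside(1)[of q] False by (cases "q \<in> {x, y}") auto
  then show ?thesis using C_id[OF s(1) z] by auto
qed

text \<open>Agreement of two rows at \<open>w\<close> passes to the basis at \<open>s\<close>,
  extends to all marks by \<open>closure_id\<close>, and becomes equality of vertices by
  \<open>close\<close>.\<close>

lemma closure:
  assumes w: "w \<in> V" and x: "rf w x" and y: "rf w y" and ne: "x \<noteq> y"
    and l: "linked x y w s" "linked x y w s'"
    and C: "C w s x = C w s' x" "C w s y = C w s' y"
  shows "s = s'"
proof -
  have s: "s \<in> V" "s' \<in> V" using linked_closed l w by auto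
  have xy: "x \<in> X" "y \<in> X" using rf_in x y by auto
  have ss: "linked x y s s'" using linked_trans linked_sym l w by blast
  have "C s s' x = C s s x" "C s s' y = C s s y"
    using C_row_cong[of s w s' s x x] C_row_cong[of s w s' s y y] C s w xy by auto
  then have "C s s' z = C s s z" if "z \<in> X" for z
    using closure_id[OF s ss xy(1,2) ne _ _ that] by blast
  then show ?thesis using close[OF w ne x y l[unfolded linked_def]] by blast
qed

end

section \<open>Rank two\<close>

text \<open>Coordinates of the roots marked by \<open>x\<close> and \<open>y\<close> after \<open>n\<close> alternating reflexions,
  when \<open>k\<close> and \<open>l\<close> are the (negated) off-diagonal entries of the rank two Cartan matrix.\<close>

fun alt_coords :: "nat \<Rightarrow> nat \<Rightarrow> nat \<Rightarrow> (int \<times> int) \<times> (int \<times> int)" where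
  "alt_coords k l 0 = ((1, 0), (0, 1))"
| "alt_coords k l (Suc n) = (case alt_coords k l n of ((a, b), (c, d)) \<Rightarrow>
     if even n then ((- a, - b), (c + int k * a, d + int k * b))
     else ((a + int l * c, b + int l * d), (- c, - d)))"

text \<open>The root in which the step after the first \<open>n\<close> reflects. The companion
  \<open>prev_root\<close> is, for \<open>n > 0\<close>, the negative of the root reflected in just
  before.\<close>

definition next_root :: "nat \<Rightarrow> nat \<Rightarrow> nat \<Rightarrow> int \<times> int" where
  "next_root k l n = (if even n then fst (alt_coords k l n) else snd (alt_coords k l n))"

definition prev_root :: "nat \<Rightarrow> nat \<Rightarrow> nat \<Rightarrow> int \<times> int" where
  "prev_root k l n = (if even n then snd (alt_coords k l n) else fst (alt_coords k l n))"

definition nonneg2 :: "int \<times> int \<Rightarrow> bool" where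
  "nonneg2 g \<longleftrightarrow> fst g \<ge> 0 \<and> snd g \<ge> 0"

lemma root_recursion:
  "fst (next_root k l (Suc n)) = fst (prev_root k l n) + int (if even n then k else l) * fst (next_root k l n)"
  "snd (next_root k l (Suc n)) = snd (prev_root k l n) + int (if even n then k else l) * snd (next_root k l n)"
  "fst (prev_root k l (Suc n)) = - fst (next_root k l n)"
  "snd (prev_root k l (Suc n)) = - snd (next_root k l n)"
  by (auto simp: next_root_def prev_root_def split: prod.splits)

text \<open>The invariant \<open>- 2 * p \<le> c * g\<close> bounds the previous coordinate, which
  is \<open>- p\<close>, by the current one, with \<open>c\<close> and \<open>c'\<close> alternating
  between \<open>k\<close> and \<open>l\<close>. Plain monotonicity can fail when these differ; a
  product of at least 4 is what keeps the invariant going.\<close>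

lemma growth_step:
  fixes g p c c' :: int
  assumes "g \<ge> 0" "- 2 * p \<le> c * g" "c * c' \<ge> 4" "c' \<ge> 0" "c \<ge> 0"
  shows "p + c * g \<ge> 0" "2 * g \<le> c' * (p + c * g)"
proof -
  show "p + c * g \<ge> 0" using assms mult_nonneg_nonneg[of c g] by linarith
  have "4 * g \<le> (c * c') * g" using assms by (intro mult_right_mono) auto
  also have "\<dots> = c' * (c * g)" by simp
  also have "\<dots> \<le> c' * (2 * (p + c * g))" using assms by (intro mult_left_mono) auto
  also have "\<dots> = 2 * (c' * (p + c * g))" by (rule mult.left_commute)
  finally show "2 * g \<le> c' * (p + c * g)" by simp
qed

lemma infinite_type:
  assumes "k * l \<ge> 4"
  shows "nonneg2 (next_root k l n)"
proof -
  let ?c = "\<lambda>n. int (if even n then k else l)"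
  have kl: "?c n * ?c (Suc n) \<ge> 4" for n
    using assms by (auto simp: mult.commute simp flip: of_nat_mult)
  have "fst (next_root k l n) \<ge> 0 \<and> snd (next_root k l n) \<ge> 0
    \<and> - 2 * fst (prev_root k l n) \<le> ?c n * fst (next_root k l n)
    \<and> - 2 * snd (prev_root k l n) \<le> ?c n * snd (next_root k l n)"
  proof (induction n)
    case 0
    then show ?case by (simp add: next_root_def prev_root_def)
  next
    case (Suc n)
    then show ?case
      using growth_step[of "fst (next_root k l n)" "fst (prev_root k l n)" "?c n" "?c (Suc n)"]
        growth_step[of "snd (next_root k l n)" "snd (prev_root k l n)" "?c n" "?c (Suc n)"] kl[of n]
      unfolding root_recursion by simp
  qed
  then show ?thesis by (simp add: nonneg2_def)
qed

text \<open>After a positive number of steps one of the two roots is the negative of a nonnegative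
  one, whereas at the start neither is.\<close>

lemma infinite_type_no_return:
  assumes "k * l \<ge> 4" "n \<ge> 1"
  shows "alt_coords k l n \<noteq> ((1, 0), (0, 1))"
proof
  assume *: "alt_coords k l n = ((1, 0), (0, 1))"
  obtain m where "n = Suc m" using assms(2) by (cases n) auto
  then have "nonneg2 (- fst (prev_root k l n), - snd (prev_root k l n))"
    using infinite_type[OF assms(1), of m] by (simp add: root_recursion nonneg2_def)
  then show False using * by (auto simp: nonneg2_def prev_root_def split: if_splits)
qed

text \<open>A condition that can be evaluated for given numbers. \<open>M\<close> is the number of
  positive roots: 2, 3, 4, 6 for A1 x A1, A2, B2, G2. Both alternating descents last
  \<open>M\<close> steps and end at the same pair of roots, and the first return after an even
  number of steps is at \<open>2 * M\<close>.\<close>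

definition finite_type_check :: "nat \<Rightarrow> nat \<Rightarrow> nat \<Rightarrow> bool" where
  "finite_type_check k l M \<longleftrightarrow> M \<in> {2, 3, 4, 6}
    \<and> (\<forall>i\<in>set [0..<M]. nonneg2 (next_root k l i) \<and> nonneg2 (next_root l k i))
    \<and> fst (alt_coords k l M) = prod.swap (snd (alt_coords l k M))
    \<and> snd (alt_coords k l M) = prod.swap (fst (alt_coords l k M))
    \<and> alt_coords k l (2 * M) = ((1, 0), (0, 1))
    \<and> (\<forall>j\<in>set [1..<M]. alt_coords k l (2 * j) \<noteq> ((1, 0), (0, 1)))"

text \<open>The second hypothesis excludes pairs with exactly one zero; the six remaining pairs are
  checked by evaluation.\<close>

lemma finite_type:
  assumes "k * l < 4" "k = 0 \<longleftrightarrow> l = 0"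
  obtains M where "finite_type_check k l M"
proof -
  have checks: "finite_type_check 0 0 2" "finite_type_check 1 1 3" "finite_type_check 1 2 4"
    "finite_type_check 2 1 4" "finite_type_check 1 3 6" "finite_type_check 3 1 6"
    by code_simp+
  have "k \<le> 3 \<and> l \<le> 3"
  proof (cases "k = 0")
    case False
    then have "k \<ge> 1" "l \<ge> 1" using assms(2) by auto
    then have "k \<le> k * l" "l \<le> k * l" by simp_all
    then show ?thesis using assms(1) by linarith
  qed (use assms in simp)
  then have "k \<in> {0, 1, 2, 3}" "l \<in> {0, 1, 2, 3}" by auto
  then consider "k = 0" "l = 0" | "k = 1" "l = 1" | "k = 1" "l = 2" | "k = 2" "l = 1"
    | "k = 1" "l = 3" | "k = 3" "l = 1"
    using assms by auto
  then show ?thesis using that checks by cases auto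
qed

context reflexion_graph
begin

section \<open>Alternating descents in the graph\<close>

definition at2 :: "'x \<Rightarrow> 'x \<Rightarrow> int \<times> int \<Rightarrow> 'x \<Rightarrow> int" where
  "at2 x y g z = (if z = x then fst g else 0) + (if z = y then snd g else 0)"

text \<open>The integers are known to persist only while both marks are reflectable
  (\<open>c_const\<close>), hence the implication. One mark is reflectable because the path arrived
  by it, or by hypothesis for \<open>n = 0\<close>; the other is once the path continues.\<close>

lemma alt_coords:
  assumes "w \<in> V" "x \<noteq> y" "rf w x" "rf w y" "valid w (alt x y n)"
  defines "t \<equiv> run w (alt x y n)" and "K \<equiv> alt_coords (c w x y) (c w y x)"
  shows "t \<in> V \<and> rf t (if even n then y else x)
    \<and> (rf t (if even n then x else y) \<longrightarrow> c t x y = c w x y \<and> c t y x = c w y x)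
    \<and> C w t x = at2 x y (fst (K n)) \<and> C w t y = at2 x y (snd (K n))"
  using assms(5) unfolding t_def
proof (induction n)
  case 0
  then show ?case using assms rf_in C_id by (auto simp: K_def at2_def)
next
  case (Suc n)
  let ?t = "run w (alt x y n)"
  have v: "valid w (alt x y n)" and rft: "rf ?t (if even n then x else y)"
    using Suc.prems by (simp_all only: alt_snoc valid_append valid.simps)
  note IH = Suc.IH[OF v]
  have run: "run w (alt x y (Suc n)) = r ?t (if even n then x else y)"
    by (simp only: alt_snoc run_append run.simps)
  obtain a b a' b' where K: "K n = ((a, b), (a', b'))" by (metis surj_pair)
  have xy: "x \<in> X" "y \<in> X" using assms rf_in by auto
  have t: "?t \<in> V" using IH by blast
  show ?case
  proof (cases "even n")
    case True
    then have rx: "rf ?t x" "rf ?t y" and cc: "c ?t x y = c w x y" "c ?t y x = c w y x"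
      using IH rft by auto
    have "c (r ?t x) x y = c w x y" using c_inv[OF t rx(1) xy(2)] cc assms(2) by auto
    moreover have "c (r ?t x) y x = c w y x" if "rf (r ?t x) y"
      using c_const[OF t assms(2) rx that] cc by simp
    moreover have "C w (r ?t x) x = at2 x y (fst (K (Suc n)))" "C w (r ?t x) y = at2 x y (snd (K (Suc n)))"
      using C_next[OF assms(1) t rx(1)] xy IH cc assms(2) K True by (auto simp: at2_def K_def algebra_simps)
    ultimately show ?thesis unfolding run using True r_closed[OF t rx(1)] r_rf[OF t rx(1)] by auto
  next
    case False
    then have rx: "rf ?t x" "rf ?t y" and cc: "c ?t x y = c w x y" "c ?t y x = c w y x"
      using IH rft by auto
    have "c (r ?t y) y x = c w y x" using c_inv[OF t rx(2) xy(1)] cc assms(2) by auto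
    moreover have "c (r ?t y) x y = c w x y" if "rf (r ?t y) x"
      using c_const[OF t assms(2)[symmetric] rx(2,1) that] cc by simp
    moreover have "C w (r ?t y) x = at2 x y (fst (K (Suc n)))" "C w (r ?t y) y = at2 x y (snd (K (Suc n)))"
      using C_next[OF assms(1) t rx(2)] xy IH cc assms(2) K False by (auto simp: at2_def K_def algebra_simps)
    ultimately show ?thesis unfolding run using False r_closed[OF t rx(2)] r_rf[OF t rx(2)] by auto
  qed
qed

text \<open>While \<open>next_root\<close> is nonnegative, the root to be reflected in is a
  nonnegative combination of two roots that are negative at \<open>u\<close>, hence negative;
  \<open>rf_crossing\<close> makes it reflectable, and the step lowers the height. \<open>tl\<close>
  drops \<open>w\<close> itself.\<close>

lemma descend:
  assumes u: "u \<in> V" "N u w x" "N u w y" and w: "w \<in> V" "x \<noteq> y" "rf w x" "rf w y"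
    and nn: "\<And>i. i < n \<Longrightarrow> nonneg2 (next_root (c w x y) (c w y x) i)"
  shows "valid w (alt x y n) \<and> height u w = height u (run w (alt x y n)) + n
    \<and> (\<forall>s\<in>set (tl (sources w (alt x y n))). height u s < height u w)"
  using nn
proof (induction n)
  case (Suc n)
  let ?t = "run w (alt x y n)" and ?q = "if even n then x else y"
  have IH: "valid w (alt x y n)" "height u w = height u ?t + n"
    "\<forall>s\<in>set (tl (sources w (alt x y n))). height u s < height u w" using Suc by auto
  note co = alt_coords[OF w IH(1)]
  have t: "?t \<in> V" using co by blast
  have xy: "x \<in> X" "y \<in> X" using w rf_in by auto
  then have q: "?q \<in> X" by simp
  let ?g = "next_root (c w x y) (c w y x) n"
  have g: "C w ?t ?q = at2 x y ?g" using co by (simp add: next_root_def)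
  have "C u ?t ?q z \<le> 0" for z
  proof -
    have "C u ?t ?q z = (\<Sum>p\<in>X. at2 x y ?g p * C u w p z)"
      using fun_cong[OF C_trans[OF u(1) w(1) t q], of z] g by simp
    also have "\<dots> = fst ?g * C u w x z + snd ?g * C u w y z"
      unfolding at2_def distrib_right sum.distrib sum_single[OF xy(1)] sum_single[OF xy(2)] by simp
    also have "\<dots> \<le> 0"
      using Suc.prems[of n] u(2,3) unfolding nonneg2_def N_def
      by (intro add_nonpos_nonpos mult_nonneg_nonpos) auto
    finally show ?thesis .
  qed
  then have N: "N u ?t ?q" by (simp add: N_def)
  then have rq: "rf ?t ?q" using rf_crossing[OF t u(1) q] by blast
  have "height u ?t = Suc (height u (r ?t ?q))" by (rule height_down[OF u(1) t rq N])
  moreover have "sources w (alt x y (Suc n)) = sources w (alt x y n) @ [?t]"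
    by (simp only: alt_snoc sources_append sources.simps)
  then have "tl (sources w (alt x y (Suc n))) = (if n = 0 then [] else tl (sources w (alt x y n)) @ [?t])"
    by (cases n) auto
  ultimately show ?case using IH rq unfolding alt_snoc valid_append run_append by auto
qed simp

lemma peak:
  assumes u: "u \<in> V" "N u w x" "N u w y" and w: "w \<in> V" "x \<noteq> y" "rf w x" "rf w y"
  obtains M where "M \<in> {2, 3, 4, 6}" "valid w (alt x y M)" "valid w (alt y x M)"
    "run w (alt x y M) = run w (alt y x M)"
    "\<And>s. s \<in> set (tl (sources w (alt x y M))) \<union> set (tl (sources w (alt y x M)))
      \<union> {run w (alt x y M)} \<Longrightarrow> height u s < height u w"
proof -
  let ?k = "c w x y" and ?l = "c w y x"
  have "\<not> ?k * ?l \<ge> 4"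
  proof
    assume "?k * ?l \<ge> 4"
    \<comment> \<open>A descent that never stops would outlast the height of
      \<open>w\<close>.\<close>
    from infinite_type[OF this] descend[OF u w, of "Suc (height u w)"] show False by simp
  qed
  then have "?k * ?l < 4" by simp
  moreover have "?k = 0 \<longleftrightarrow> ?l = 0" using c_zero w by metis
  ultimately obtain M where M: "finite_type_check ?k ?l M" by (rule finite_type)
  have d1: "valid w (alt x y M) \<and> height u w = height u (run w (alt x y M)) + M
    \<and> (\<forall>s\<in>set (tl (sources w (alt x y M))). height u s < height u w)"
    using M by (intro descend u w) (auto simp: finite_type_check_def)
  have d2: "valid w (alt y x M) \<and> height u w = height u (run w (alt y x M)) + M
    \<and> (\<forall>s\<in>set (tl (sources w (alt y x M))). height u s < height u w)"
    using M by (intro descend u w w(2)[symmetric]) (auto simp: finite_type_check_def)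
  have at2_swap: "at2 x y g = at2 y x (prod.swap g)" for g by (auto simp: at2_def)
  have "run w (alt x y M) = run w (alt y x M)"
  proof (rule closure[OF w(1,3,4,2)])
    show "linked x y w (run w (alt x y M))" "linked x y w (run w (alt y x M))"
      using linked_run[OF w(1), of "alt x y M" x y] linked_run[OF w(1), of "alt y x M" x y]
        d1 d2 set_alt[of x y M] set_alt[of y x M] by auto
    show "C w (run w (alt x y M)) x = C w (run w (alt y x M)) x"
      "C w (run w (alt x y M)) y = C w (run w (alt y x M)) y"
      using alt_coords[OF w, of M] alt_coords[OF w(1) w(2)[symmetric] w(4,3), of M] d1 d2 M
      by (auto simp: finite_type_check_def at2_swap)
  qed
  moreover have "M \<in> {2, 3, 4, 6}" using M by (simp add: finite_type_check_def)
  ultimately show ?thesis using d1 d2 by (intro that[of M]) auto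
qed

end

section \<open>Peak reduction\<close>

context reflexion_graph
begin

definition graph :: "('v, 'x) mgraph" where
  "graph = \<lparr>verts = V, arrows = {(u, x, w). u \<in> V \<and> rf u x \<and> w = r u x}\<rparr>"

fun path_edges :: "'v \<Rightarrow> 'x list \<Rightarrow> ('v \<times> 'x \<times> 'v) list" where
  "path_edges w [] = []"
| "path_edges w (x # xs) = (w, x, r w x) # path_edges (r w x) xs"

lemma path_edges_append: "path_edges w (xs @ ys) = path_edges w xs @ path_edges (run w xs) ys"
  by (induction xs arbitrary: w) auto

lemma path_marks_edges [simp]: "path_marks (path_edges w xs) = xs"
  by (induction xs arbitrary: w) (auto simp: path_marks_def)

lemma path_inverse_edges:
  "w \<in> V \<Longrightarrow> valid w xs \<Longrightarrow> path_inverse (path_edges w xs) = path_edges (run w xs) (rev xs)"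
proof (induction xs arbitrary: w)
  case (Cons x xs)
  then have "path_inverse (path_edges (r w x) xs) = path_edges (run (r w x) xs) (rev xs)"
    using r_closed by simp
  then show ?case
    using Cons run_rev[of "r w x" xs] r_closed r_inv by (simp add: path_inverse_def path_edges_append)
qed (simp add: path_inverse_def)

lemma is_path_edges: "w \<in> V \<Longrightarrow> valid w xs \<Longrightarrow> is_path graph w (path_edges w xs) (run w xs)"
  by (induction xs arbitrary: w) (auto simp: graph_def r_closed)

lemma is_pathE:
  assumes "is_path graph u es w"
  obtains "u \<in> V" "valid u (path_marks es)" "es = path_edges u (path_marks es)" "w = run u (path_marks es)"
proof -
  have "u \<in> V \<and> valid u (path_marks es) \<and> es = path_edges u (path_marks es) \<and> w = run u (path_marks es)"
    using assms
    by (induction es arbitrary: u) (auto simp: graph_def path_marks_def)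
  then show ?thesis using that by blast
qed

definition coxeter_word :: "'x list \<Rightarrow> bool" where
  "coxeter_word zs \<longleftrightarrow> (\<exists>x. zs = [x, x]) \<or> (\<exists>m x y. m \<ge> 1 \<and> x \<noteq> y \<and> zs = concat (replicate m [x, y]))"

lemma coxeter_word_rev:
  assumes "coxeter_word zs"
  shows "coxeter_word (rev zs)"
proof -
  have "rev (concat (replicate m [x, y])) = concat (replicate m [y, x])" for m and x y :: 'x
    by (simp add: rev_concat)
  then show ?thesis using assms unfolding coxeter_word_def by (metis rev.simps append.simps)
qed

text \<open>\<open>coxeter_modification\<close> on words of marks, since a start vertex and a word
  determine a path.\<close>

definition modif :: "'v \<Rightarrow> 'x list \<Rightarrow> 'x list \<Rightarrow> bool" where
  "modif u xs ys \<longleftrightarrow> u \<in> V \<and> valid u xs \<and> valid u ys \<and> (\<exists>\<alpha> \<phi> \<psi> \<beta>. xs = \<alpha> @ \<phi> @ \<beta> \<and> ys = \<alpha> @ \<psi> @ \<beta>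
     \<and> run (run u \<alpha>) \<phi> = run (run u \<alpha>) \<psi> \<and> coxeter_word (\<phi> @ rev \<psi>))"

lemma modif_sym: "modif u xs ys \<Longrightarrow> modif u ys xs"
  unfolding modif_def using coxeter_word_rev by (metis rev_append rev_rev_ident)

lemma modif_coxeter:
  assumes "modif u xs ys"
  shows "coxeter_modification graph u (run u xs) (path_edges u xs) (path_edges u ys)"
    and "run u ys = run u xs"
proof -
  obtain \<alpha> \<phi> \<psi> \<beta> where *: "xs = \<alpha> @ \<phi> @ \<beta>" "ys = \<alpha> @ \<psi> @ \<beta>"
    "run (run u \<alpha>) \<phi> = run (run u \<alpha>) \<psi>" "coxeter_word (\<phi> @ rev \<psi>)"
    and u: "u \<in> V" "valid u xs" "valid u ys"
    using assms unfolding modif_def by blast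
  let ?s = "run u \<alpha>" let ?t = "run ?s \<phi>"
  have s: "?s \<in> V" "valid u \<alpha>" "valid ?s \<phi>" "valid ?s \<psi>" "valid ?t \<beta>" "?t \<in> V"
    using u * run_closed[of u \<alpha>] run_closed[of ?s \<phi>] by auto
  have inv: "path_inverse (path_edges ?s \<psi>) = path_edges ?t (rev \<psi>)"
    using path_inverse_edges[OF s(1,4)] *(3) by simp
  have loop: "path_edges ?s \<phi> @ path_inverse (path_edges ?s \<psi>) = path_edges ?s (\<phi> @ rev \<psi>)"
    unfolding inv by (simp add: path_edges_append)
  have "is_path graph ?s (path_edges ?s (\<phi> @ rev \<psi>)) ?s"
    using is_path_edges[OF s(1), of "\<phi> @ rev \<psi>"] s run_rev[OF s(1,4)] *(3) by simp
  then have "coxeter_loop graph ?s (path_edges ?s (\<phi> @ rev \<psi>))"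
    using *(4) unfolding coxeter_loop_def trivial_coxeter_loop_def nontrivial_coxeter_loop_def
      coxeter_word_def path_marks_edges by blast
  then have "elementary_coxeter_modification graph ?s ?t (path_edges ?s \<phi>) (path_edges ?s \<psi>)"
    unfolding elementary_coxeter_modification_def loop
    using is_path_edges[OF s(1,3)] is_path_edges[OF s(1,4)] *(3) by simp
  then show "coxeter_modification graph u (run u xs) (path_edges u xs) (path_edges u ys)"
    unfolding coxeter_modification_def
    using is_path_edges[OF u(1) s(2)] is_path_edges[OF s(6,5)] *
    by (intro exI[of _ "path_edges u \<alpha>"] exI[of _ "path_edges ?s \<phi>"] exI[of _ "path_edges ?s \<psi>"]
        exI[of _ "path_edges ?t \<beta>"] exI[of _ ?s] exI[of _ ?t]) (auto simp: path_edges_append)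
  show "run u ys = run u xs" using * by simp
qed

lemma modif_context:
  assumes "(modif (run u \<alpha>))\<^sup>*\<^sup>* xs ys" "u \<in> V" "valid u \<alpha>" "valid (run (run u \<alpha>) xs) \<beta>"
  shows "(modif u)\<^sup>*\<^sup>* (\<alpha> @ xs @ \<beta>) (\<alpha> @ ys @ \<beta>)"
proof -
  have "run (run u \<alpha>) ys = run (run u \<alpha>) xs \<and> (modif u)\<^sup>*\<^sup>* (\<alpha> @ xs @ \<beta>) (\<alpha> @ ys @ \<beta>)"
    using assms(1)
  proof (induction rule: rtranclp_induct)
    case (step ys zs)
    then have run: "run (run u \<alpha>) zs = run (run u \<alpha>) ys" using modif_coxeter(2) by blast
    obtain \<alpha>' \<phi> \<psi> \<beta>' where *: "ys = \<alpha>' @ \<phi> @ \<beta>'" "zs = \<alpha>' @ \<psi> @ \<beta>'"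
      "run (run (run u \<alpha>) \<alpha>') \<phi> = run (run (run u \<alpha>) \<alpha>') \<psi>" "coxeter_word (\<phi> @ rev \<psi>)"
      "valid (run u \<alpha>) ys" "valid (run u \<alpha>) zs"
      using step(2) unfolding modif_def by blast
    have "modif u (\<alpha> @ ys @ \<beta>) (\<alpha> @ zs @ \<beta>)"
      unfolding modif_def
      using * assms(2-4) step run
      by (intro conjI exI[of _ "\<alpha> @ \<alpha>'"] exI[of _ \<phi>] exI[of _ \<psi>] exI[of _ "\<beta>' @ \<beta>"]) auto
    then show ?case using step run by (metis rtranclp.rtrancl_into_rtrancl)
  qed simp
  then show ?thesis by simp
qed

text \<open>Heights change by exactly one, so there are no plateaus: a path that starts upwards and
  does not end higher must turn down right after some upward step.\<close>

lemma exists_peak: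
  assumes "u \<in> V" "s \<in> V" "valid s xs" "xs \<noteq> []" "height u (r s (hd xs)) > height u s"
    "height u (run s xs) \<le> height u s"
  shows "\<exists>\<alpha> a b \<beta>. xs = \<alpha> @ [a, b] @ \<beta> \<and> height u (r (run s \<alpha>) a) > height u (run s \<alpha>)
    \<and> height u (r (r (run s \<alpha>) a) b) < height u (r (run s \<alpha>) a)"
  using assms(2-)
proof (induction xs arbitrary: s)
  case (Cons a xs)
  let ?s = "r s a"
  have s: "?s \<in> V" "valid ?s xs" using Cons r_closed by auto
  obtain b ys where xs: "xs = b # ys" using Cons by (cases xs) auto
  show ?case
  proof (cases "height u (r ?s b) < height u ?s")
    case True
    then show ?thesis using Cons xs by (intro exI[of _ "[]"]) auto
  next
    case False
    have b: "rf ?s b" using s xs by simp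
    have "\<not> N u ?s b" using False height_down[OF assms(1) s(1) b] by auto
    then have "height u (r ?s b) > height u ?s" using height_up[OF assms(1) s(1) b] by simp
    moreover have "height u (run ?s xs) \<le> height u ?s" using Cons by auto
    ultimately obtain \<alpha> a' b' \<beta> where "xs = \<alpha> @ [a', b'] @ \<beta>"
      "height u (r (run ?s \<alpha>) a') > height u (run ?s \<alpha>)"
      "height u (r (r (run ?s \<alpha>) a') b') < height u (r (run ?s \<alpha>) a')"
      using Cons.IH[OF s] xs by auto
    then show ?thesis by (intro exI[of _ "a # \<alpha>"]) auto
  qed
qed simp

text \<open>The bypass below a peak may be longer than the piece it replaces, so length is no
  measure; the multiset of heights loses a copy of \<open>h\<close> and gains only smaller
  numbers.\<close>

lemma multiset_less_replace:
  fixes K :: "nat multiset"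
  assumes "\<And>k. k \<in># K \<Longrightarrow> k < h" "h \<in># L"
  shows "A + K + B < A + L + B"
proof -
  have "count K h = 0" using assms(1)[of h] by (auto simp: not_in_iff[symmetric])
  then have "K < {#h#}"
    using assms(1) by (force simp: less_multiset\<^sub>H\<^sub>O)
  also have "{#h#} \<le> L" using assms(2) by (intro subset_eq_imp_le_multiset) simp
  finally show ?thesis by simp
qed

text \<open>Peak reduction: a vertex of a closed path at maximal height is bypassed below, through
  the Coxeter loop of the two marks meeting there.\<close>
lemma closed_path_contracts:
  assumes "u \<in> V" "valid u xs" "run u xs = u"
  shows "(modif u)\<^sup>*\<^sup>* xs []"
  using assms(2,3)
proof (induction "image_mset (height u) (mset (sources u xs))" arbitrary: xs rule: less_induct)
  case less
  show ?case
  proof (cases "xs = []")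
    case False
    then obtain x ys where xs: "xs = x # ys" by (cases xs) auto
    \<comment> \<open>The base vertex has height 0, so the first edge goes up.\<close>
    have "\<not> N u u x" using height_down[of u u x] height_self assms(1) less xs by force
    then have "height u (r u (hd xs)) > height u u" using height_up[of u u x] assms(1) less xs by simp
    then obtain \<alpha> a b \<beta> where *: "xs = \<alpha> @ [a, b] @ \<beta>"
      "height u (r (run u \<alpha>) a) > height u (run u \<alpha>)"
      "height u (r (r (run u \<alpha>) a) b) < height u (r (run u \<alpha>) a)"
      using exists_peak[OF assms(1,1) less(2) False] less(3) by auto
    let ?s = "run u \<alpha>" let ?w = "r ?s a" let ?t = "r ?w b"
    have s: "valid u \<alpha>" "?s \<in> V" "rf ?s a" "?w \<in> V" "rf ?w b" "?t \<in> V" "valid ?t \<beta>"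
      using less(2) * run_closed[OF assms(1), of \<alpha>] r_closed by auto
    have w: "rf ?w a" "r ?w a = ?s" using r_rf r_inv s by auto
    have Na: "N u ?w a" using height_up[OF assms(1) s(4) w(1)] w(2) *(2) by fastforce
    have Nb: "N u ?w b" using height_up[OF assms(1) s(4,5)] *(3) by fastforce
    have ex: "\<exists>\<psi>. valid ?s \<psi> \<and> run ?s \<psi> = ?t \<and> coxeter_word ([a, b] @ rev \<psi>)
      \<and> (\<forall>p\<in>set (sources ?s \<psi>). height u p < height u ?w)"
    proof (cases "a = b")
      case True
      then show ?thesis using w by (intro exI[of _ "[]"]) (auto simp: coxeter_word_def)
    next
      case False
      obtain M where M: "M \<in> {2, 3, 4, 6}" "valid ?w (alt a b M)" "valid ?w (alt b a M)"
        "run ?w (alt a b M) = run ?w (alt b a M)"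
        "\<And>q. q \<in> set (tl (sources ?w (alt a b M))) \<union> set (tl (sources ?w (alt b a M)))
          \<union> {run ?w (alt a b M)} \<Longrightarrow> height u q < height u ?w"
        using peak[OF assms(1) Na Nb s(4) False w(1) s(5)] by blast
      obtain m where m: "M = Suc m" using M(1) by (cases M) auto
      have va: "valid ?s (alt b a m)" and vb: "valid ?t (alt a b m)"
        and bot: "run ?s (alt b a m) = run ?t (alt a b m)"
        and low: "\<And>q. q \<in> set (sources ?s (alt b a m)) \<union> set (sources ?t (alt a b m))
          \<union> {run ?t (alt a b m)} \<Longrightarrow> height u q < height u ?w"
        using M(2-5) w unfolding m by auto
      \<comment> \<open>With \<open>M = Suc m\<close>: down from one neighbour of the peak along the
        remaining \<open>m\<close> edges, then up to the other neighbour along the reverse of the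
        second descent. Together with the two edges at the peak this closes to a loop of length
        \<open>2 * M\<close>.\<close>
      let ?\<psi> = "alt b a m @ rev (alt a b m)"
      have "coxeter_word ([a, b] @ rev ?\<psi>)"
      proof -
        have "[a, b] @ rev ?\<psi> = concat (replicate M [a, b])"
          using M(1) unfolding m by (auto simp: eval_nat_numeral)
        then show ?thesis unfolding coxeter_word_def using False m by (metis One_nat_def Suc_le_mono le0)
      qed
      moreover have "valid ?s ?\<psi>" "run ?s ?\<psi> = ?t" using va bot run_rev[OF s(6) vb] by auto
      moreover have "\<forall>p\<in>set (sources ?s ?\<psi>). height u p < height u ?w"
        using low sources_rev[OF s(6) vb] bot by auto
      ultimately show ?thesis by blast
    qed
    then obtain \<psi> where \<psi>: "valid ?s \<psi>" "run ?s \<psi> = ?t" "coxeter_word ([a, b] @ rev \<psi>)"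
      "\<forall>p\<in>set (sources ?s \<psi>). height u p < height u ?w" by blast
    let ?xs = "\<alpha> @ \<psi> @ \<beta>"
    have "modif u xs ?xs"
      unfolding modif_def using assms(1) less(2) * s \<psi>
      by (intro conjI exI[of _ \<alpha>] exI[of _ "[a, b]"] exI[of _ \<psi>] exI[of _ \<beta>]) auto
    moreover have "(modif u)\<^sup>*\<^sup>* ?xs []"
    proof (rule less(1))
      show "valid u ?xs" using s \<psi> by auto
      show "run u ?xs = u" using less(3) * \<psi> by simp
      \<comment> \<open>The piece \<open>[a, b]\<close> has the peak as a source; all sources of
        \<open>\<psi>\<close> lie below it.\<close>
      have "image_mset (height u) (mset (sources u \<alpha>)) + image_mset (height u) (mset (sources ?s \<psi>))
          + image_mset (height u) (mset (sources ?t \<beta>))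
        < image_mset (height u) (mset (sources u \<alpha>)) + image_mset (height u) (mset (sources ?s [a, b]))
          + image_mset (height u) (mset (sources ?t \<beta>))"
        using \<psi>(4) by (intro multiset_less_replace[of _ "height u ?w"]) auto
      then show "image_mset (height u) (mset (sources u ?xs)) < image_mset (height u) (mset (sources u xs))"
        using * \<psi>(2) by (simp add: add.assoc)
    qed
    ultimately show ?thesis by (rule converse_rtranclp_into_rtranclp)
  qed simp
qed

text \<open>The contractible loop \<open>rev ys @ ys\<close> is inserted after \<open>xs\<close>,
  and then the loop \<open>xs @ rev ys\<close> is contracted.\<close>

lemma modif_equivalent:
  assumes "u \<in> V" "valid u xs" "valid u ys" "run u xs = run u ys"
  shows "(modif u)\<^sup>*\<^sup>* xs ys"
proof -
  have y: "run (run u ys) (rev ys) = u" "valid (run u ys) (rev ys)" using run_rev[OF assms(1,3)] by auto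
  have w: "run u xs \<in> V" using run_closed[OF assms(1,2)] .
  have loop: "valid u (xs @ rev ys)" "run u (xs @ rev ys) = u" using y assms by auto
  have loop': "valid (run u xs) (rev ys @ ys)" "run (run u xs) (rev ys @ ys) = run u xs"
    using y assms by auto
  have "(modif (run u xs))\<^sup>*\<^sup>* (rev ys @ ys) []" by (rule closed_path_contracts[OF w loop'])
  then have "(modif u)\<^sup>*\<^sup>* (xs @ (rev ys @ ys) @ []) (xs @ [] @ [])"
    using assms by (intro modif_context) auto
  moreover have "symp ((modif u)\<^sup>*\<^sup>*)" using modif_sym by (intro symp_rtranclp sympI) blast
  ultimately have 1: "(modif u)\<^sup>*\<^sup>* xs (xs @ rev ys @ ys)" by (auto dest: sympD)
  have "(modif u)\<^sup>*\<^sup>* (xs @ rev ys) []" by (rule closed_path_contracts[OF assms(1) loop])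
  then have "(modif u)\<^sup>*\<^sup>* ([] @ (xs @ rev ys) @ ys) ([] @ [] @ ys)"
    using assms loop by (intro modif_context) auto
  then show ?thesis using 1 by simp
qed

lemma coxeter_graph: "V \<noteq> {} \<Longrightarrow> coxeter_graph X graph"
  unfolding coxeter_graph_def
proof (intro conjI allI impI)
  assume ne: "V \<noteq> {}"
  have path: "\<exists>es. is_path graph u es w" if uw: "u \<in> V" "w \<in> V" for u w
  proof -
    have "\<exists>xs. valid u xs \<and> run u xs = w"
      using reach[OF uw]
    proof (induction rule: rtranclp_induct)
      case base
      show ?case by (intro exI[of _ "[]"]) simp
    next
      case (step s t)
      then obtain xs x where "valid u xs" "run u xs = s" "rf s x" "t = r s x" by blast
      then show ?case by (intro exI[of _ "xs @ [x]"]) simp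
    qed
    then show ?thesis using is_path_edges[OF uw(1)] by blast
  qed
  have neq: "u \<noteq> r u x" if "u \<in> V" "rf u x" for u x
  proof
    assume "u = r u x"
    then have "C u u x x = - C u u x x" using C_next[OF that(1,1,2), of x] rf_in[OF that(2)] by metis
    then show False using C_id[OF that(1)] rf_in[OF that(2)] by simp
  qed
  show "connected_marked_graph X graph"
    unfolding connected_marked_graph_def
  proof (intro conjI allI impI ballI)
    show "arrows graph \<subseteq> verts graph \<times> X \<times> verts graph"
      using r_closed rf_in by (auto simp: graph_def)
    show "verts graph \<noteq> {}" using ne by (simp add: graph_def)
    fix u w assume "u \<in> verts graph" "w \<in> verts graph"
    then show "\<exists>es. is_path graph u es w" using path by (simp add: graph_def)
  qed (use neq r_closed r_rf r_inv in \<open>auto simp: graph_def\<close>)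
  fix u w \<phi> \<psi> assume p: "is_path graph u \<phi> w" "is_path graph u \<psi> w"
  from p(1) show "(coxeter_modification graph u w)\<^sup>*\<^sup>* \<phi> \<psi>"
  proof (rule is_pathE)
    assume u: "u \<in> V" and x: "valid u (path_marks \<phi>)" "\<phi> = path_edges u (path_marks \<phi>)" "w = run u (path_marks \<phi>)"
    from p(2) show ?thesis
    proof (rule is_pathE)
      assume y: "valid u (path_marks \<psi>)" "\<psi> = path_edges u (path_marks \<psi>)" "w = run u (path_marks \<psi>)"
      have "(modif u)\<^sup>*\<^sup>* (path_marks \<phi>) (path_marks \<psi>)"
        using modif_equivalent[OF u x(1) y(1)] x y by simp
      then have "run u (path_marks \<psi>) = w \<and>
          (coxeter_modification graph u w)\<^sup>*\<^sup>* (path_edges u (path_marks \<phi>)) (path_edges u (path_marks \<psi>))"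
      proof (induction rule: rtranclp_induct)
        case (step ys zs)
        then show ?case using modif_coxeter[OF step(2)] by (auto intro: rtranclp.rtrancl_into_rtrancl)
      qed (use x in simp)
      then show ?thesis using x(2) y(2) by simp
    qed
  qed
qed

text \<open>A loop returns the coordinates, which excludes infinite type and forces \<open>m\<close>
  to be at least \<open>M\<close>. The vertex already returns after \<open>2 * M\<close> edges, so
  the loop is a power of that shorter one, and traversing it once leaves
  \<open>m = M\<close>.\<close>

lemma coxeter_loop_length:
  assumes "nontrivial_coxeter_loop graph m u \<phi>" "traversed_once \<phi>"
  shows "m \<in> {2, 3, 4, 6}"
proof -
  obtain x y where p: "is_path graph u \<phi> u" and m: "m \<ge> 1" and xy: "x \<noteq> y"
    and marks: "path_marks \<phi> = alt x y (2 * m)"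
    using assms(1) unfolding nontrivial_coxeter_loop_def alt_concat by blast
  from p have u: "u \<in> V" and v: "valid u (alt x y (2 * m))" and e: "\<phi> = path_edges u (alt x y (2 * m))"
    and run: "run u (alt x y (2 * m)) = u"
    unfolding marks[symmetric] by (auto elim: is_pathE)
  obtain m' where m': "2 * m = Suc (Suc (2 * m'))" using m by (cases m) auto
  have x: "rf u x" using v unfolding m' by simp
  have "valid u (alt x y (Suc (2 * m')))" "rf (run u (alt x y (Suc (2 * m')))) y"
    "u = r (run u (alt x y (Suc (2 * m')))) y"
    using v run unfolding m' alt_snoc[of x y "Suc (2 * m')"] by auto
  \<comment> \<open>The last edge of the loop is marked \<open>y\<close> and arrives at
    \<open>u\<close>, so its reverse starts there.\<close>
  then have y: "rf u y" using r_rf[OF run_closed[OF u]] by metis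
  let ?k = "c u x y" and ?l = "c u y x"
  have X: "x \<in> X" "y \<in> X" using x y rf_in by auto
  have ret: "alt_coords ?k ?l n = ((1, 0), (0, 1))"
    if "valid u (alt x y n)" "run u (alt x y n) = u" for n
  proof -
    obtain a b a' b' where K: "alt_coords ?k ?l n = ((a, b), (a', b'))" by (metis surj_pair)
    have "at2 x y (a, b) = C u u x" "at2 x y (a', b') = C u u y"
      using alt_coords[OF u xy x y that(1)] that(2) K by simp_all
    then have "at2 x y (a, b) z = (if z = x then 1 else 0)" "at2 x y (a', b') z = (if z = y then 1 else 0)" for z
      using C_id[OF u] X by simp_all
    from this(1)[of x] this(1)[of y] this(2)[of x] this(2)[of y] show ?thesis
      using xy K by (simp add: at2_def)
  qed
  have "\<not> ?k * ?l \<ge> 4" using infinite_type_no_return[of ?k ?l "2 * m"] ret[OF v run] m by auto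
  then have "?k * ?l < 4" by simp
  moreover have "?k = 0 \<longleftrightarrow> ?l = 0" using c_zero u xy x y by metis
  ultimately obtain M where M: "finite_type_check ?k ?l M" by (rule finite_type)
  then have Mval: "M \<in> {2, 3, 4, 6}" and M0: "alt_coords ?k ?l (2 * M) = ((1, 0), (0, 1))"
    and Mmin: "\<And>j. 0 < j \<Longrightarrow> j < M \<Longrightarrow> alt_coords ?k ?l (2 * j) \<noteq> ((1, 0), (0, 1))"
    by (auto simp: finite_type_check_def)
  have "M \<le> m" using Mmin[of m] ret[OF v run] m by force
  then have split: "alt x y (2 * m) = alt x y (2 * M) @ alt x y (2 * (m - M))"
    using alt_add[of x y M "2 * (m - M)"] by (simp add: right_diff_distrib')
  then have vM: "valid u (alt x y (2 * M))" using v by simp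
  have runM: "run u (alt x y (2 * M)) = u"
  proof (rule closure[OF u x y xy, symmetric])
    show "linked x y u (run u (alt x y (2 * M)))" using linked_run[OF u vM set_alt] .
    show "linked x y u u" by (simp add: linked_def)
    show "C u u x = C u (run u (alt x y (2 * M))) x" "C u u y = C u (run u (alt x y (2 * M))) y"
      using alt_coords[OF u xy x y vM] M0 C_id[OF u] X by (auto simp: at2_def)
  qed
  have period: "valid u (alt x y (2 * (q * M + s))) \<Longrightarrow>
      run u (alt x y (2 * (q * M + s))) = run u (alt x y (2 * s)) \<and> valid u (alt x y (2 * s))
      \<and> path_edges u (alt x y (2 * (q * M + s)))
        = concat (replicate q (path_edges u (alt x y (2 * M)))) @ path_edges u (alt x y (2 * s))" for q s
  proof (induction q)
    case (Suc q)
    have "alt x y (2 * (Suc q * M + s)) = alt x y (2 * M) @ alt x y (2 * (q * M + s))"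
      using alt_add[of x y M "2 * (q * M + s)"] by (simp add: algebra_simps)
    then show ?case using Suc runM by (simp add: path_edges_append)
  qed simp
  define q s where "q = m div M" and "s = m mod M"
  have qs: "m = q * M + s" "s < M" using Mval by (auto simp: q_def s_def)
  note per = period[of q s, folded qs(1), OF v]
  \<comment> \<open>A nonzero remainder would return the coordinates before \<open>2 * M\<close>
    steps.\<close>
  have "s = 0"
    using Mmin[of s] ret[of "2 * s"] per run qs(2) by (cases "s = 0") auto
  then have "\<phi> = concat (replicate q (path_edges u (alt x y (2 * M))))" using per e by simp
  then have "\<not> q \<ge> 2" using assms(2) unfolding traversed_once_def by blast
  then have "m = M" using qs \<open>s = 0\<close> m by (cases q) auto
  then show ?thesis using Mval by simp
qed

end

section \<open>The skeleton of an admissible component\<close>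

abbreviation reflexion_step ::
  "'x set \<Rightarrow> ('h::complex_vector, 'x) root_datum \<Rightarrow> ('h, 'x) root_datum \<Rightarrow> bool" where
  "reflexion_step X \<equiv> \<lambda>u w. \<exists>x. reflectable X u x \<and> w = reflexion X u x"

text \<open>Reflexions induce identity maps, so an isomorphism of algebras over such an arrow fixes
  \<hh> pointwise.\<close>

lemma skeleton_arrow:
  assumes X: "finite X" and u: "u \<in> root_data X"
    and r: "(reflexion_step X)\<^sup>*\<^sup>* u w"
  shows "rg_arrow X u (\<lambda>h\<in>rd_space u. h) w \<and> rd_space w = rd_space u"
  using r
proof (induction rule: rtranclp_induct)
  case base
  show ?case using rg_arrow.identity[OF u] by blast
next
  case (step s t)
  then obtain x where x: "reflectable X s x" "t = reflexion X s x" by blast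
  have s: "s \<in> root_data X" using rg_arrow_root[OF X] step by blast
  have "rd_space t = rd_space u"
    using root_datum_on.reflexion_space[of X s x] X s x step by (simp add: root_datum_on_def)
  moreover have "rg_arrow X u (compose (rd_space u) (\<lambda>h\<in>rd_space s. h) (\<lambda>h\<in>rd_space u. h)) t"
    unfolding x(2) by (rule rg_arrow.step[OF conjunct1[OF step.IH] rg_generator.reflexion[OF s x(1)]])
  moreover have "compose (rd_space u) (\<lambda>h\<in>rd_space s. h) (\<lambda>h\<in>rd_space u. h) = (\<lambda>h\<in>rd_space u. h)"
    using step by (auto simp: compose_def)
  ultimately show ?case by metis
qed

lemma arrow_component:
  assumes "rg_arrow X u \<phi> v" "(reflexion_step X)\<^sup>*\<^sup>* v w" "finite X"
  shows "\<exists>\<psi>. rg_arrow X u \<psi> w"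
  using assms(2)
proof (induction rule: rtranclp_induct)
  case base
  then show ?case using assms(1) by blast
next
  case (step s t)
  then obtain \<psi> x where x: "rg_arrow X u \<psi> s" "reflectable X s x" "t = reflexion X s x" by blast
  then show ?case using rg_arrow.step[OF x(1) rg_generator.reflexion[OF rg_arrow_root[OF assms(3) x(1)] x(2)]] by blast
qed

lemma skeleton_reach_sym:
  assumes X: "finite X" and v: "v \<in> root_data X"
    and r: "(reflexion_step X)\<^sup>*\<^sup>* v u"
  shows "(reflexion_step X)\<^sup>*\<^sup>* u v"
  using r
proof (induction rule: rtranclp_induct)
  case (step s t)
  then obtain x where x: "reflectable X s x" "t = reflexion X s x" by blast
  have "s \<in> root_data X" using skeleton_arrow[OF X v step(1)] rg_arrow_root[OF X] by blast
  then interpret root_datum_on X s using X by unfold_locales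
  have "\<exists>x. reflectable X t x \<and> s = reflexion X t x"
    using reflectable_reflexion[OF x(1)] reflexion_involution[of x] x reflectable_in by metis
  then show ?case using step.IH by (rule converse_rtranclp_into_rtranclp)
qed simp

text \<open>All that is used of admissibility: a kernel \<open>J u\<close> for each vertex, and
  between any two vertices a transport over the identity of \<hh>.\<close>

locale admissible_skeleton =
  fixes X :: "'x set" and v0 :: "('h::complex_vector, 'x) root_datum"
    and J :: "('h, 'x) root_datum \<Rightarrow> (('h, 'x) word \<Rightarrow>\<^sub>0 complex) set"
  assumes fin: "finite X" and v0: "v0 \<in> root_data X"
    and transport: "\<lbrakk>(reflexion_step X)\<^sup>*\<^sup>* v0 u;
      (reflexion_step X)\<^sup>*\<^sup>* v0 w\<rbrakk>
      \<Longrightarrow> \<exists>T. root_transport X u w (J u) (J w) T"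
begin

section \<open>Integral coordinates over the skeleton\<close>

definition V :: "('h, 'x) root_datum set" where
  "V = {w. (reflexion_step X)\<^sup>*\<^sup>* v0 w}"

abbreviation "H0 \<equiv> rd_space v0"

lemma reflectable_in: "reflectable X w x \<Longrightarrow> x \<in> X"
  by (simp add: reflectable_def)

lemma V_facts:
  assumes "w \<in> V"
  shows "root_datum_on X w" "rd_space w = H0"
  using skeleton_arrow[OF fin v0, of w] rg_arrow_root[OF fin] assms fin
  by (auto simp: V_def root_datum_on_def)

lemma V_closed: "w \<in> V \<Longrightarrow> reflectable X w x \<Longrightarrow> reflexion X w x \<in> V"
  unfolding V_def by (auto intro: rtranclp.rtrancl_into_rtrancl)

lemma V_inv:
  assumes "w \<in> V" "reflectable X w x"
  shows "reflectable X (reflexion X w x) x" "reflexion X (reflexion X w x) x = w"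
proof -
  interpret root_datum_on X w using V_facts assms by blast
  show "reflectable X (reflexion X w x) x" "reflexion X (reflexion X w x) x = w"
    using reflectable_reflexion reflexion_involution reflectable_in assms by auto
qed

lemma V_reach: "u \<in> V \<Longrightarrow> w \<in> V \<Longrightarrow> (reflexion_step X)\<^sup>*\<^sup>* u w"
  using rtranclp_trans[OF skeleton_reach_sym[OF fin v0]] by (simp add: V_def)

text \<open>The value 0 outside \<open>X\<close> makes coordinates unique as functions, not merely
  on \<open>X\<close>.\<close>

definition coords :: "('h, 'x) root_datum \<Rightarrow> ('h, 'x) root_datum \<Rightarrow> 'x \<Rightarrow> 'x \<Rightarrow> int" where
  "coords u w x = (SOME n. (\<forall>y. y \<notin> X \<longrightarrow> n y = 0)
     \<and> (\<forall>h\<in>H0. rd_b w x h = (\<Sum>y\<in>X. of_int (n y) * rd_b u y h)))"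

lemma sum_delta_int:
  assumes "x \<in> X"
  shows "(\<Sum>y\<in>X. of_int (if y = x then c else 0) * f y) = of_int c * (f x :: complex)"
  using fin assms by (simp add: if_distrib[of "\<lambda>u. u * _"] if_distrib[of of_int] cong: if_cong)

lemma coords_ex:
  assumes "u \<in> V" "w \<in> V" "x \<in> X"
  shows "\<exists>n. (\<forall>y. y \<notin> X \<longrightarrow> n y = 0) \<and> (\<forall>h\<in>H0. rd_b w x h = (\<Sum>y\<in>X. of_int (n y) * rd_b u y h))"
  using V_reach[OF assms(1,2)] assms(3)
proof (induction arbitrary: x rule: rtranclp_induct)
  case base
  then show ?case using sum_delta_int[OF base, of 1]
    by (intro exI[of _ "\<lambda>y. if y = x then 1 else 0"]) auto
next
  case (step s t)
  obtain p where p: "reflectable X s p" "t = reflexion X s p" "p \<in> X" using step reflectable_in by blast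
  have "s \<in> V" using step(1)
  proof (induction rule: rtranclp_induct)
    case (step a b)
    then show ?case using V_closed by blast
  qed (rule assms)
  interpret root_datum_on X s using V_facts \<open>s \<in> V\<close> by blast
  have sH: "rd_space s = H0" using V_facts \<open>s \<in> V\<close> by blast
  obtain n where n: "\<forall>y. y \<notin> X \<longrightarrow> n y = 0" "\<forall>h\<in>H0. rd_b s p h = (\<Sum>y\<in>X. of_int (n y) * rd_b u y h)"
    using step.IH[OF p(3)] by blast
  obtain m where m: "\<forall>y. y \<notin> X \<longrightarrow> m y = 0" "\<forall>h\<in>H0. rd_b s x h = (\<Sum>y\<in>X. of_int (m y) * rd_b u y h)"
    using step.IH[OF step.prems] by blast
  show ?case
  proof (cases "x = p")
    case True
    then show ?thesis using n p sH reflexion_b[OF p(3,3)]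
      by (intro exI[of _ "\<lambda>y. - n y"]) (simp add: sum_negf)
  next
    case False
    obtain k :: nat where k: "rb p x = of_nat k" using rb_nat[OF p(1) step.prems False] by blast
    then show ?thesis using n m p sH reflexion_b[OF p(3) step.prems] False
      by (intro exI[of _ "\<lambda>y. m y + int k * n y"])
        (simp add: sum.distrib distrib_right sum_distrib_left mult.assoc)
  qed
qed

lemma coords:
  assumes "u \<in> V" "w \<in> V" "x \<in> X"
  shows "y \<notin> X \<Longrightarrow> coords u w x y = 0"
    and "h \<in> H0 \<Longrightarrow> rd_b w x h = (\<Sum>y\<in>X. of_int (coords u w x y) * rd_b u y h)"
  using someI_ex[OF coords_ex[OF assms]] unfolding coords_def[symmetric] by blast+

lemma coords_unique_complex:
  assumes "u \<in> V" "w \<in> V" "x \<in> X" "y \<in> X"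
    and "\<And>h. h \<in> H0 \<Longrightarrow> rd_b w x h = (\<Sum>y\<in>X. n y * rd_b u y h)"
  shows "n y = of_int (coords u w x y)"
proof -
  interpret root_datum_on X u using V_facts assms by blast
  show ?thesis
  proof (rule b_unique[where c = n and d = "\<lambda>y. of_int (coords u w x y)", OF _ assms(4)])
    fix h assume "h \<in> rd_space u"
    then have "h \<in> H0" using V_facts(2)[OF assms(1)] by simp
    then show "(\<Sum>y\<in>X. n y * rd_b u y h) = (\<Sum>y\<in>X. of_int (coords u w x y) * rd_b u y h)"
      using coords(2)[OF assms(1-3)] assms(5) by metis
  qed
qed

lemma coords_unique:
  assumes "u \<in> V" "w \<in> V" "x \<in> X" "\<And>y. y \<notin> X \<Longrightarrow> n y = 0"
    and "\<And>h. h \<in> H0 \<Longrightarrow> rd_b w x h = (\<Sum>y\<in>X. of_int (n y) * rd_b u y h)"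
  shows "coords u w x = n"
proof
  fix y
  show "coords u w x y = n y"
  proof (cases "y \<in> X")
    case True
    then show ?thesis using coords_unique_complex[OF assms(1-3) True, of "\<lambda>y. of_int (n y)"] assms(5) by simp
  next
    case False
    then show ?thesis using coords(1)[OF assms(1-3)] assms(4) by simp
  qed
qed

lemma coords_id: "u \<in> V \<Longrightarrow> x \<in> X \<Longrightarrow> coords u u x = (\<lambda>y. if y = x then 1 else 0)"
  using sum_delta_int[of x 1] by (intro coords_unique) auto

lemma coords_trans:
  assumes "u \<in> V" "t \<in> V" "w \<in> V" "x \<in> X"
  shows "coords u w x = (\<lambda>y. \<Sum>z\<in>X. coords t w x z * coords u t z y)"
proof (rule coords_unique)
  fix y assume "y \<notin> X"
  then show "(\<Sum>z\<in>X. coords t w x z * coords u t z y) = 0"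
    using coords(1)[OF assms(1,2)] by (intro sum.neutral) auto
next
  fix h assume h: "h \<in> H0"
  have "rd_b w x h = (\<Sum>z\<in>X. of_int (coords t w x z) * (\<Sum>y\<in>X. of_int (coords u t z y) * rd_b u y h))"
    using coords(2)[OF assms(2-4) h] coords(2)[OF assms(1,2) _ h] by (simp cong: sum.cong)
  also have "\<dots> = (\<Sum>y\<in>X. \<Sum>z\<in>X. of_int (coords t w x z) * (of_int (coords u t z y) * rd_b u y h))"
    unfolding sum_distrib_left by (rule sum.swap)
  also have "\<dots> = (\<Sum>y\<in>X. of_int (\<Sum>z\<in>X. coords t w x z * coords u t z y) * rd_b u y h)"
    by (simp add: sum_distrib_right mult.assoc)
  finally show "rd_b w x h = (\<Sum>y\<in>X. of_int (\<Sum>z\<in>X. coords t w x z * coords u t z y) * rd_b u y h)" .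
qed (use assms in auto)

definition cn :: "('h, 'x) root_datum \<Rightarrow> 'x \<Rightarrow> 'x \<Rightarrow> nat" where
  "cn w x y = (SOME n. root_datum_on.rb w x y = of_nat n)"

lemma cn:
  assumes "w \<in> V" "reflectable X w x" "y \<in> X" "y \<noteq> x"
  shows "root_datum_on.rb w x y = of_nat (cn w x y)"
proof -
  interpret root_datum_on X w using V_facts assms by blast
  show ?thesis unfolding cn_def using rb_nat[OF assms(2-4)] by (rule someI_ex)
qed

lemma coords_r:
  assumes "w \<in> V" "reflectable X w x" "y \<in> X"
  shows "coords w (reflexion X w x) y = (\<lambda>z. if y = x then (if z = x then -1 else 0)
           else (if z = y then 1 else 0) + (if z = x then int (cn w x y) else 0))"
proof -
  interpret root_datum_on X w using V_facts assms by blast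
  have x: "x \<in> X" using assms reflectable_in by blast
  have H: "rd_space w = H0" using V_facts assms by blast
  show ?thesis
  proof (cases "y = x")
    case True
    have "coords w (reflexion X w x) y = (\<lambda>z. if z = x then -1 else 0)"
      using assms V_closed x sum_delta_int[OF x, of "-1"] reflexion_b[OF x x] H True
      by (intro coords_unique) auto
    then show ?thesis using True by simp
  next
    case False
    have "coords w (reflexion X w x) y = (\<lambda>z. (if z = y then 1 else 0) + (if z = x then int (cn w x y) else 0))"
    proof (rule coords_unique)
      fix h assume h: "h \<in> H0"
      show "rd_b (reflexion X w x) y h = (\<Sum>z\<in>X. of_int ((if z = y then 1 else 0)
          + (if z = x then int (cn w x y) else 0)) * rd_b w z h)"
        unfolding of_int_add distrib_right sum.distrib sum_delta_int[OF x] sum_delta_int[OF assms(3)]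
        using reflexion_b[OF x assms(3)] False H h cn[OF assms False] by simp
    qed (use assms V_closed x in auto)
    then show ?thesis using False by simp
  qed
qed

lemma transport_V: "u \<in> V \<Longrightarrow> w \<in> V \<Longrightarrow> \<exists>T. root_transport X u w (J u) (J w) T"
  using transport by (simp add: V_def)

text \<open>e_x is a nonzero weight vector of weight b_w(x), so \<open>eigen_sign\<close>
  applies.\<close>

lemma coords_sign:
  assumes "u \<in> V" "w \<in> V" "x \<in> X"
  shows "(\<forall>y. coords u w x y \<ge> 0) \<or> (\<forall>y. coords u w x y \<le> 0)"
proof -
  obtain T where "root_transport X w u (J w) (J u) T" using transport_V assms by blast
  then interpret root_transport X w u "J w" "J u" T .
  have "V.eigen (rd_b w x) (V.ge x)" using assms by (intro eigen_gen) simp_all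
  from V.e_not_in_J[OF assms(3)] this show ?thesis
  proof (cases rule: eigen_sign)
    case (1 n)
    have "coords u w x = (\<lambda>y. if y \<in> X then int (n y) else 0)"
      using assms 1 V_facts(2)[OF assms(2)] by (intro coords_unique) auto
    then show ?thesis by auto
  next
    case (2 n)
    have "coords u w x = (\<lambda>y. if y \<in> X then - int (n y) else 0)"
      using assms 2 V_facts(2)[OF assms(2)] by (intro coords_unique) (auto simp: sum_negf)
    then show ?thesis by auto
  qed
qed

lemma same_root_data:
  assumes "t \<in> V" "w \<in> V" "z \<in> X" "x \<in> X" "\<And>h. h \<in> H0 \<Longrightarrow> rd_b t z h = rd_b w x h"
  shows "\<exists>k. k \<noteq> 0 \<and> rd_a t z = k *\<^sub>C rd_a w x" "rd_p t z = rd_p w x"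
proof -
  obtain T where "root_transport X t w (J t) (J w) T" using transport_V assms by blast
  then interpret root_transport X t w "J t" "J w" T .
  show "\<exists>k. k \<noteq> 0 \<and> rd_a t z = k *\<^sub>C rd_a w x" "rd_p t z = rd_p w x"
    using same_root[OF assms(3,4)] assms(5) V_facts(2)[OF assms(1)] by simp_all
qed

text \<open>The two sides of the reflexion in \<open>x\<close> would see long strings with opposite signs.\<close>
lemma string_terminates:
  assumes t: "t \<in> V" and w: "w \<in> V" "reflectable X w x" and z: "z \<in> X" "y \<in> X" "y \<noteq> z"
    and b: "\<And>h. h \<in> H0 \<Longrightarrow> rd_b t z h = rd_b w x h"
  shows "\<exists>N. mono_word (ad_word z y N) \<in> J t"
proof (rule ccontr)
  assume no: "\<not> ?thesis"
  have x: "x \<in> X" using w reflectable_in by blast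
  let ?w = "reflexion X w x"
  have w': "?w \<in> V" using V_closed w by blast
  interpret W: root_datum_on X w using V_facts w by blast
  have H: "rd_space w = H0" "rd_space t = H0" using V_facts w t by auto
  have b': "rd_b t z h = - rd_b ?w x h" if "h \<in> H0" for h
    using b[OF that] W.reflexion_b[OF x x, of h] that H by simp
  have coherent: "(\<forall>q\<in>X. k q \<ge> 0) \<or> (\<forall>q\<in>X. k q \<le> 0)"
    if u: "u \<in> V" and k: "\<And>h. h \<in> H0 \<Longrightarrow> rd_b t y h + of_nat N * rd_b t z h = (\<Sum>q\<in>X. of_int (k q) * rd_b u q h)"
    for u N k
  proof -
    interpret U: root_datum_on X u using V_facts u by blast
    have Hu: "rd_space u = H0" using V_facts u by auto
    obtain T where "root_transport X t u (J t) (J u) T" using transport_V t u by blast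
    then interpret root_transport X t u "J t" "J u" T .
    have "mono_word (ad_word z y N) \<notin> J t" using no by blast
    moreover have "V.eigen (word_weight (rd_b t) (ad_word z y N)) (mono_word (ad_word z y N))"
      using V.ad_word_in z by (intro V.eigen_word) auto
    ultimately show ?thesis
    proof (cases rule: eigen_sign)
      case (1 n)
      have "of_int (k q) = (of_nat (n q) :: complex)" if "q \<in> X" for q
      proof (rule U.b_unique[where c = "\<lambda>q. of_int (k q)" and d = "\<lambda>q. of_nat (n q)", OF _ that])
        fix h assume "h \<in> rd_space u"
        then have h: "h \<in> H0" "h \<in> rd_space t" using Hu H by auto
        show "(\<Sum>q\<in>X. of_int (k q) * rd_b u q h) = (\<Sum>q\<in>X. of_nat (n q) * rd_b u q h)"
          unfolding k[OF h(1), symmetric] 1[OF h(2), symmetric] V.ad_word_weight ..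
      qed
      then have "k q = int (n q)" if "q \<in> X" for q using that by (metis of_int_eq_iff of_int_of_nat_eq)
      then show ?thesis by simp
    next
      case (2 n)
      have "of_int (k q) = (- of_nat (n q) :: complex)" if "q \<in> X" for q
      proof (rule U.b_unique[where c = "\<lambda>q. of_int (k q)" and d = "\<lambda>q. - of_nat (n q)", OF _ that])
        fix h assume "h \<in> rd_space u"
        then have h: "h \<in> H0" "h \<in> rd_space t" using Hu H by auto
        show "(\<Sum>q\<in>X. of_int (k q) * rd_b u q h) = (\<Sum>q\<in>X. - of_nat (n q) * rd_b u q h)"
          unfolding k[OF h(1), symmetric] mult_minus_left sum_negf 2[OF h(2), symmetric] V.ad_word_weight ..
      qed
      then have "k q = - int (n q)" if "q \<in> X" for q
        using that by (metis of_int_eq_iff of_int_of_nat_eq of_int_minus)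
      then show ?thesis by simp
    qed
  qed
  \<comment> \<open>At \<open>w\<close> the string runs along b_w(x), at the reflected vertex along
    its negative; so \<open>N\<close> enters the coordinate at \<open>x\<close> with opposite
    signs.\<close>
  let ?n = "coords w t y" and ?m = "coords ?w t y"
  have up: "(\<forall>q\<in>X. ?n q + (if q = x then int N else 0) \<ge> 0) \<or> (\<forall>q\<in>X. ?n q + (if q = x then int N else 0) \<le> 0)" for N
    using b coords(2)[OF w(1) t z(2)] sum_delta_int[OF x, of "int N"]
    by (intro coherent[OF w(1), of N]) (simp add: distrib_right sum.distrib)
  have down: "(\<forall>q\<in>X. ?m q + (if q = x then - int N else 0) \<ge> 0) \<or> (\<forall>q\<in>X. ?m q + (if q = x then - int N else 0) \<le> 0)" for N
    using b' coords(2)[OF w' t z(2)] sum_delta_int[OF x, of "- int N"]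
    by (intro coherent[OF w', of N]) (simp add: distrib_right sum.distrib)
  have mn: "?m q = ?n q" if "q \<in> X" "q \<noteq> x" for q
  proof -
    have "?m q = (\<Sum>p\<in>X. ?n p * coords ?w w p q)"
      using fun_cong[OF coords_trans[OF w' w(1) t z(2)], of q] .
    also have "\<dots> = (\<Sum>p\<in>X. ?n p * (if p = q then 1 else 0))"
      using coords_r[OF w' V_inv(1)[OF w]] V_inv(2)[OF w] that(2) by (intro sum.cong) auto
    also have "\<dots> = ?n q" using that fin by (simp add: if_distrib[of "\<lambda>u. _ * u"] cong: if_cong)
    finally show ?thesis .
  qed
  \<comment> \<open>b_t(y) is independent of b_t(z) = b_w(x), so its row at \<open>w\<close> is not
    supported at \<open>x\<close> alone.\<close>
  obtain q where q: "q \<in> X" "q \<noteq> x" "?n q \<noteq> 0"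
  proof (rule ccontr)
    assume "\<not> thesis"
    then have nz: "\<And>q. q \<in> X \<Longrightarrow> q \<noteq> x \<Longrightarrow> ?n q = 0" using that by blast
    interpret T: root_datum_on X t using V_facts t by blast
    have yz: "rd_b t y h = of_int (?n x) * rd_b t z h" if h: "h \<in> H0" for h
    proof -
      have "rd_b t y h = (\<Sum>q\<in>X. of_int (if q = x then ?n x else 0) * rd_b w q h)"
        unfolding coords(2)[OF w(1) t z(2) h] using nz by (intro sum.cong) auto
      then show ?thesis using sum_delta_int[OF x] b[OF h] by simp
    qed
    have "(if y = y then 1 else 0 :: complex) = (if y = z then of_int (?n x) else 0)"
      using z yz H T.sum_delta_b[of y 1] T.sum_delta_b[of z "of_int (?n x)"]
      by (intro T.b_unique[where c = "\<lambda>q. if q = y then 1 else 0"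
            and d = "\<lambda>q. if q = z then of_int (?n x) else 0"]) simp_all
    then show False using z(3) by simp
  qed
  \<comment> \<open>Large enough to make the coordinate at \<open>x\<close> positive on one side and
    negative on the other. Coherence then gives the coordinate at \<open>q\<close>, the same on both
    sides, both signs.\<close>
  define N where "N = nat (\<bar>?n x\<bar> + \<bar>?m x\<bar> + 1)"
  have large: "?n x + int N > 0" "?m x - int N < 0" by (auto simp: N_def)
  have "?n q \<ge> 0"
    using up[of N]
  proof
    assume "\<forall>q\<in>X. ?n q + (if q = x then int N else 0) \<ge> 0"
    from bspec[OF this q(1)] show ?thesis using q(2) by simp
  next
    assume "\<forall>q\<in>X. ?n q + (if q = x then int N else 0) \<le> 0"
    from bspec[OF this x] show ?thesis using large(1) by simp
  qed
  moreover have "?m q \<le> 0"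
    using down[of N]
  proof
    assume "\<forall>q\<in>X. ?m q + (if q = x then - int N else 0) \<ge> 0"
    from bspec[OF this x] show ?thesis using large(2) by simp
  next
    assume "\<forall>q\<in>X. ?m q + (if q = x then - int N else 0) \<le> 0"
    from bspec[OF this q(1)] show ?thesis using q(2) by simp
  qed
  ultimately show False using q(3) mn[OF q(1,2)] by simp
qed

text \<open>Isotropy and parity pass from \<open>w\<close> to \<open>t\<close> with the root. The
  integrality conditions do not, since the other simple roots at \<open>t\<close> may be different;
  they come from termination of the strings at \<open>t\<close>.\<close>

lemma reflectable_root:
  assumes t: "t \<in> V" "z \<in> X" and w: "w \<in> V" "reflectable X w x" and C: "coords w t z = coords w w x"
  shows "reflectable X t z"
proof -
  have x: "x \<in> X" using w reflectable_in by blast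
  interpret T: root_datum_on X t using V_facts t by blast
  interpret W: root_datum_on X w using V_facts w by blast
  have H: "rd_space w = H0" "rd_space t = H0" using V_facts w t by auto
  have b: "rd_b t z h = rd_b w x h" if "h \<in> H0" for h
    using coords(2)[OF w(1) t that] coords(2)[OF w(1,1) x that] C by simp
  obtain k where k: "k \<noteq> 0" "rd_a t z = k *\<^sub>C rd_a w x" and p: "rd_p t z = rd_p w x"
    using same_root_data[OF t(1) w(1) t(2) x b] by blast
  have A: "cartan t z z = k * cartan w x x"
    using k b[of "rd_a t z"] T.a_in[OF t(2)] W.a_in[OF x] W.b_linear[OF x] H
    by (simp add: cartan_def)
  obtain T where "root_transport X t w (J t) (J w) T" using transport_V t w by blast
  then interpret root_transport X t w "J t" "J w" T .
  have "(rd_p t z = 0 \<longrightarrow> 2 * cartan t z y / cartan t z z \<in> \<int>\<^sub>\<le>\<^sub>0) \<and> (rd_p t z = 1 \<longrightarrow> cartan t z y / cartan t z z \<in> \<int>\<^sub>\<le>\<^sub>0)"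
    if y: "y \<in> X" "y \<noteq> z" and nz: "cartan t z z \<noteq> 0" for y
  proof -
    obtain N where "mono_word (ad_word z y N) \<in> J t"
      using string_terminates[OF t(1) w t(2) y b] by blast
    then show ?thesis using V.finite_string[OF t(2) y nz] by blast
  qed
  then show ?thesis using t w A k p by (auto simp: reflectable_def)
qed

text \<open>If a_xy = 0, the reflexion at \<open>x\<close> keeps b(y) and negates b(x), which is the
  situation of \<open>weak_symmetry\<close>.\<close>

lemma weak_symmetry_V:
  assumes w: "w \<in> V" "reflectable X w x" and y: "y \<in> X" "cartan w x y = 0"
  shows "cartan w y x = 0"
proof (cases "y = x")
  case False
  have x: "x \<in> X" using w reflectable_in by blast
  let ?w = "reflexion X w x"
  have w': "?w \<in> V" using V_closed w by blast
  interpret W: root_datum_on X w using V_facts w by blast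
  have H: "rd_space w = H0" "rd_space ?w = H0" using V_facts w w' by auto
  obtain T where "root_transport X ?w w (J ?w) (J w) T" using transport_V w w' by blast
  then interpret root_transport X ?w w "J ?w" "J w" T .
  show ?thesis
    using x y False W.reflexion_b[OF x] H
    by (intro weak_symmetry) (auto simp: W.rb_def)
qed (use y in simp)

section \<open>Constancy of the Cartan integers\<close>

lemma cn_inv:
  assumes "w \<in> V" "reflectable X w x" "y \<in> X" "y \<noteq> x"
  shows "cn (reflexion X w x) x y = cn w x y"
proof -
  interpret W: root_datum_on X w using V_facts assms by blast
  show ?thesis unfolding cn_def W.ra_rb_reflexion(2)[OF reflectable_in[OF assms(2)] assms(3)] ..
qed

lemma cn_zero:
  assumes w: "w \<in> V" "x \<noteq> y" "reflectable X w x" "reflectable X w y" and "cn w x y = 0"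
  shows "cn w y x = 0"
proof -
  interpret W: root_datum_on X w using V_facts assms by blast
  have X: "x \<in> X" "y \<in> X" using w reflectable_in by auto
  have "W.rb x y = 0" using cn[OF w(1,3) X(2)] w(2) assms(5) by simp
  then have "cartan w x y = 0" by (auto simp: W.rb_def split: if_splits)
  then have "W.rb y x = 0" using weak_symmetry_V[OF w(1,3) X(2)] by (simp add: W.rb_def)
  then show ?thesis using cn[OF w(1,4) X(1) w(2)] by simp
qed

text \<open>Consecutive integers are coprime, so k / (k - 1) is an integer only for k = 2, where it
  is 2 again.\<close>

lemma nat_ratio:
  fixes k n :: nat
  assumes "k \<ge> 2" "of_nat k / (of_nat k - 1) = (of_nat n :: complex)"
  shows "n = k"
proof -
  have "(of_nat k - 1 :: complex) = of_nat (k - 1)" using assms(1) by (simp add: of_nat_diff)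
  moreover have "(of_nat (k - 1) :: complex) \<noteq> 0" using assms(1) by simp
  ultimately have "(of_nat k :: complex) = of_nat (n * (k - 1))"
    using assms(2) by (simp add: field_simps del: of_nat_diff)
  then have k: "k = n * (k - 1)" by (simp only: of_nat_eq_iff)
  then have "k - 1 dvd k - (k - 1)" by (metis dvd_diff_nat dvd_refl dvd_triv_right)
  then have "k - 1 = 1" using assms(1) by simp
  then show ?thesis using k by simp
qed

text \<open>For anisotropic \<open>x\<close> the Cartan matrix stays. For isotropic \<open>x\<close>
  with a_xy \<noteq> 0, a_yx changes sign and a_yy grows by 2 a_yx: an integer 1 stays 1 while
  \<open>y\<close> passes between isotropic and anisotropic, and k \<ge> 2 becomes k / (k - 1), an
  integer because \<open>y\<close> is reflectable at the new vertex.\<close>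

lemma cn_const:
  assumes w: "w \<in> V" "x \<noteq> y" "reflectable X w x" "reflectable X w y"
    and r: "reflectable X (reflexion X w x) y"
  shows "cn (reflexion X w x) y x = cn w y x"
proof -
  have X: "x \<in> X" "y \<in> X" using w reflectable_in by auto
  let ?w = "reflexion X w x"
  have w': "?w \<in> V" using V_closed w by blast
  interpret W: root_datum_on X w using V_facts w by blast
  interpret W': root_datum_on X ?w using V_facts w' by blast
  have n: "W.rb y x = of_nat (cn w y x)" "W'.rb y x = of_nat (cn ?w y x)"
    using cn[OF w(1,4) X(1) w(2)] cn[OF w' r X(1) w(2)] by auto
  have "W'.rb y x = W.rb y x"
  proof (cases "cartan w x x = 0")
    case False
    then show ?thesis
      using W.cartan_reflexion_anisotropic[OF X(1)] X by (simp add: W.rb_def W'.rb_def)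
  next
    case iso: True
    have A: "cartan ?w y x = - cartan w y x" using W.cartan_reflexion_isotropic[OF X iso] by simp
    have Ay: "cartan ?w y y = cartan w y y + W.rb x y * cartan w y x + W.ra x y * cartan w x y"
      using W.cartan_reflexion(4)[OF X(1,2,2)] w(2) iso by simp
    show ?thesis
    proof (cases "cartan w x y = 0")
      case True
      then have "cartan w y x = 0" using weak_symmetry_V[OF w(1,3) X(2)] by simp
      then show ?thesis using A by (simp add: W.rb_def W'.rb_def)
    next
      case False
      then have nz: "cartan w y x \<noteq> 0" using weak_symmetry_V[OF w(1,4) X(1)] by auto
      have Ay: "cartan ?w y y = cartan w y y + 2 * cartan w y x"
        using Ay False iso by (simp add: W.rb_def W.ra_def)
      show ?thesis
      proof (cases "cartan w y y = 0")
        case True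
        then show ?thesis using A Ay nz by (simp add: W.rb_def W'.rb_def)
      next
        case y: False
        let ?k = "cn w y x"
        have k: "of_nat ?k = - (2 * cartan w y x / cartan w y y)" using n(1) y by (simp add: W.rb_def)
        then have Ak: "2 * cartan w y x = - of_nat ?k * cartan w y y" using y by (simp add: field_simps)
        have Ay': "cartan ?w y y = (1 - of_nat ?k) * cartan w y y"
          unfolding Ay Ak by (simp add: algebra_simps)
        have k0: "?k \<noteq> 0" using Ak nz by (intro notI) simp
        show ?thesis
        proof (cases "?k = 1")
          case True
          then show ?thesis using Ay' A nz n(1) by (simp add: W'.rb_def)
        next
          case False
          then have k2: "?k \<ge> 2" using k0 by simp
          then have k1: "(1 - of_nat ?k :: complex) \<noteq> 0" using False by (metis eq_iff_diff_eq_0 of_nat_1_eq_iff)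
          have "W'.rb y x = 2 * cartan w y x / cartan ?w y y"
            using Ay' A k1 y by (simp add: W'.rb_def)
          also have "\<dots> = - of_nat ?k * cartan w y y / ((1 - of_nat ?k) * cartan w y y)"
            unfolding Ak Ay' ..
          also have "\<dots> = of_nat ?k / (of_nat ?k - 1)"
            using k1 y by (simp add: divide_simps) (simp add: algebra_simps)
          finally have "cn ?w y x = ?k" using nat_ratio[OF k2] n(2) by metis
          then show ?thesis using n by simp
        qed
      qed
    qed
  qed
  then show ?thesis using n by (metis of_nat_eq_iff)
qed

end

section \<open>Rank two symmetrizers: recovering a without scalars\<close>

context admissible_skeleton
begin

abbreviation link :: "'x \<Rightarrow> 'x \<Rightarrow> ('h, 'x) root_datum \<Rightarrow> ('h, 'x) root_datum \<Rightarrow> bool" where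
  "link x y \<equiv> (\<lambda>s t. \<exists>z\<in>{x, y}. reflectable X s z \<and> t = reflexion X s z)\<^sup>*\<^sup>*"

text \<open>The ratio d of a_xy and a_yx symmetrizes the rank two block. It turns the multiple added
  to b(y) into the one added to a(y), \<open>ra = rb / d\<close>, and it survives the
  reflexion.\<close>

lemma symmetrizer_step:
  assumes s: "s \<in> V" "reflectable X s x" and y: "y \<in> X" "x \<noteq> y"
    and d: "d \<noteq> 0" "cartan s x y = d * cartan s y x"
  defines "t \<equiv> reflexion X s x"
  shows "cartan t x y = d * cartan t y x"
    and "\<exists>k. (\<forall>h\<in>H0. rd_b t y h = rd_b s y h + k * rd_b s x h) \<and> rd_a t y = rd_a s y + (k / d) *\<^sub>C rd_a s x"
    and "h \<in> H0 \<Longrightarrow> rd_b t x h = - rd_b s x h" "rd_a t x = - rd_a s x"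
    and "z \<in> X \<Longrightarrow> z \<noteq> x \<Longrightarrow> \<exists>k. rd_a t z = rd_a s z + k *\<^sub>C rd_a s x"
proof -
  interpret S: root_datum_on X s using V_facts s by blast
  have H: "rd_space s = H0" using V_facts s by blast
  have x: "x \<in> X" using s reflectable_in by blast
  have rab: "S.ra x y = S.rb x y / d"
    using d by (auto simp: S.ra_def S.rb_def field_simps)
  show "cartan t x y = d * cartan t y x"
    unfolding t_def S.cartan_reflexion(2)[OF x x y(1) y(2)[symmetric]] S.cartan_reflexion(3)[OF x y(1) x y(2)[symmetric]]
    using rab d by (simp add: field_simps)
  show "\<exists>k. (\<forall>h\<in>H0. rd_b t y h = rd_b s y h + k * rd_b s x h) \<and> rd_a t y = rd_a s y + (k / d) *\<^sub>C rd_a s x"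
    unfolding t_def rab[symmetric] using S.reflexion_b[OF x y(1)] S.reflexion_a[OF x y(1)] y(2) H rab
    by (intro exI[of _ "S.rb x y"]) auto
  show "h \<in> H0 \<Longrightarrow> rd_b t x h = - rd_b s x h" "rd_a t x = - rd_a s x"
    unfolding t_def using S.reflexion_b[OF x x] S.reflexion_a[OF x x] H by auto
  show "z \<in> X \<Longrightarrow> z \<noteq> x \<Longrightarrow> \<exists>k. rd_a t z = rd_a s z + k *\<^sub>C rd_a s x"
    unfolding t_def using S.reflexion_a[OF x] by auto
qed

text \<open>The clauses on \<open>x\<close> and \<open>y\<close> say that the linear map taking
  b_w(x) to a_w(x) and b_w(y) to d a_w(y) takes b_s(x) to a_s(x) and b_s(y) to d a_s(y), so these
  a's are determined by the b's. For other marks only the coefficient 1 of a_w(z) matters.\<close>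

definition sym_coords :: "'x \<Rightarrow> 'x \<Rightarrow> complex \<Rightarrow> ('h, 'x) root_datum \<Rightarrow> ('h, 'x) root_datum \<Rightarrow> bool" where
  "sym_coords x y d w s \<longleftrightarrow> (\<exists>p q p' q'.
     (\<forall>h\<in>H0. rd_b s x h = p * rd_b w x h + q * rd_b w y h)
   \<and> (\<forall>h\<in>H0. rd_b s y h = p' * rd_b w x h + q' * rd_b w y h)
   \<and> rd_a s x = p *\<^sub>C rd_a w x + (q * d) *\<^sub>C rd_a w y
   \<and> rd_a s y = (p' / d) *\<^sub>C rd_a w x + q' *\<^sub>C rd_a w y
   \<and> (\<forall>z\<in>X - {x, y}. \<exists>\<alpha> \<beta>. rd_a s z = rd_a w z + \<alpha> *\<^sub>C rd_a w x + \<beta> *\<^sub>C rd_a w y))"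

text \<open>Exchanging the marks inverts d, so only reflexions at \<open>x\<close> need a direct
  computation.\<close>

lemma sym_coords_swap:
  assumes "d \<noteq> 0"
  shows "sym_coords x y d w s \<longleftrightarrow> sym_coords y x (1 / d) w s"
proof -
  have "sym_coords y x (1 / e) w s" if "sym_coords x y e w s" "e \<noteq> 0" for x y e
  proof -
    obtain p q p' q' where *: "\<forall>h\<in>H0. rd_b s x h = p * rd_b w x h + q * rd_b w y h"
      "\<forall>h\<in>H0. rd_b s y h = p' * rd_b w x h + q' * rd_b w y h"
      "rd_a s x = p *\<^sub>C rd_a w x + (q * e) *\<^sub>C rd_a w y"
      "rd_a s y = (p' / e) *\<^sub>C rd_a w x + q' *\<^sub>C rd_a w y"
      "\<forall>z\<in>X - {x, y}. \<exists>\<alpha> \<beta>. rd_a s z = rd_a w z + \<alpha> *\<^sub>C rd_a w x + \<beta> *\<^sub>C rd_a w y"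
      using \<open>sym_coords x y e w s\<close> unfolding sym_coords_def by blast
    have "\<forall>z\<in>X - {y, x}. \<exists>\<alpha> \<beta>. rd_a s z = rd_a w z + \<alpha> *\<^sub>C rd_a w y + \<beta> *\<^sub>C rd_a w x"
    proof
      fix z assume "z \<in> X - {y, x}"
      then obtain \<alpha> \<beta> where "rd_a s z = rd_a w z + \<alpha> *\<^sub>C rd_a w x + \<beta> *\<^sub>C rd_a w y" using *(5) by blast
      then show "\<exists>\<alpha> \<beta>. rd_a s z = rd_a w z + \<alpha> *\<^sub>C rd_a w y + \<beta> *\<^sub>C rd_a w x"
        by (intro exI[of _ \<beta>] exI[of _ \<alpha>]) (simp add: algebra_simps)
    qed
    then show ?thesis unfolding sym_coords_def using *
      by (intro exI[of _ q'] exI[of _ p'] exI[of _ q] exI[of _ p]) (simp add: add.commute)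
  qed
  from this[of x y d] this[of y x "1 / d"] show ?thesis using assms by auto
qed

lemma sym_coords_step:
  assumes s: "s \<in> V" "reflectable X s x" and y: "y \<in> X" "x \<noteq> y"
    and d: "d \<noteq> 0" "cartan s x y = d * cartan s y x" and sc: "sym_coords x y d w s"
  shows "sym_coords x y d w (reflexion X s x)"
proof -
  note st = symmetrizer_step[OF s y d]
  let ?t = "reflexion X s x"
  obtain p q p' q' where *: "\<forall>h\<in>H0. rd_b s x h = p * rd_b w x h + q * rd_b w y h"
      "\<forall>h\<in>H0. rd_b s y h = p' * rd_b w x h + q' * rd_b w y h"
      "rd_a s x = p *\<^sub>C rd_a w x + (q * d) *\<^sub>C rd_a w y"
      "rd_a s y = (p' / d) *\<^sub>C rd_a w x + q' *\<^sub>C rd_a w y"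
      "\<forall>z\<in>X - {x, y}. \<exists>\<alpha> \<beta>. rd_a s z = rd_a w z + \<alpha> *\<^sub>C rd_a w x + \<beta> *\<^sub>C rd_a w y"
      using sc unfolding sym_coords_def by blast
  obtain k where k: "\<forall>h\<in>H0. rd_b ?t y h = rd_b s y h + k * rd_b s x h" "rd_a ?t y = rd_a s y + (k / d) *\<^sub>C rd_a s x"
    using st(2) by blast
  have z: "\<exists>\<alpha> \<beta>. rd_a ?t z = rd_a w z + \<alpha> *\<^sub>C rd_a w x + \<beta> *\<^sub>C rd_a w y" if z: "z \<in> X - {x, y}" for z
  proof -
    obtain j where j: "rd_a ?t z = rd_a s z + j *\<^sub>C rd_a s x" using st(5)[of z] z by blast
    obtain \<alpha> \<beta> where ab: "rd_a s z = rd_a w z + \<alpha> *\<^sub>C rd_a w x + \<beta> *\<^sub>C rd_a w y" using *(5) z by blast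
    show ?thesis unfolding j ab *(3)
      by (intro exI[of _ "\<alpha> + j * p"] exI[of _ "\<beta> + j * (q * d)"])
        (simp add: scaleC_add_right scaleC_add_left scaleC_scaleC)
  qed
  have "\<forall>h\<in>H0. rd_b ?t x h = - p * rd_b w x h + - q * rd_b w y h"
    using st(3) *(1) by simp
  moreover have "\<forall>h\<in>H0. rd_b ?t y h = (p' + k * p) * rd_b w x h + (q' + k * q) * rd_b w y h"
    using k(1) *(1,2) by (simp add: algebra_simps)
  moreover have "rd_a ?t x = (- p) *\<^sub>C rd_a w x + (- q * d) *\<^sub>C rd_a w y"
    unfolding st(4) *(3) by simp
  moreover have "rd_a ?t y = ((p' + k * p) / d) *\<^sub>C rd_a w x + (q' + k * q) *\<^sub>C rd_a w y"
    unfolding k(2) *(3,4) using d(1)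
    by (simp add: scaleC_add_right scaleC_add_left scaleC_scaleC add_divide_distrib)
  ultimately show ?thesis unfolding sym_coords_def using z by blast
qed

lemma sym_coords_link:
  assumes w: "w \<in> V" "x \<in> X" "y \<in> X" "x \<noteq> y" and d: "d \<noteq> 0" "cartan w x y = d * cartan w y x"
    and l: "link x y w s"
  shows "s \<in> V \<and> cartan s x y = d * cartan s y x \<and> sym_coords x y d w s"
  using l
proof (induction rule: rtranclp_induct)
  case base
  have "sym_coords x y d w w" unfolding sym_coords_def
    by (intro exI[of _ 1] exI[of _ 0] conjI ballI) (auto simp: scaleC_one intro: exI[of _ 0])
  then show ?case using w d by simp
next
  case (step s t)
  then consider "reflectable X s x" "t = reflexion X s x" | "reflectable X s y" "t = reflexion X s y" by blast
  then show ?case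
  proof cases
    case 1
    then show ?thesis using step symmetrizer_step(1)[of s x y d] sym_coords_step[of s x y d w] V_closed w d by auto
  next
    case 2
    have d': "1 / d \<noteq> 0" "cartan s y x = (1 / d) * cartan s x y" using step d by auto
    have "cartan t y x = (1 / d) * cartan t x y"
      using 2 step symmetrizer_step(1)[of s y x "1 / d"] w d' by auto
    moreover have "sym_coords x y d w t"
      using 2 step sym_coords_step[of s y x "1 / d" w] w d' d sym_coords_swap[OF d(1)] by auto
    ultimately show ?thesis using d 2 step V_closed by (simp add: field_simps)
  qed
qed

text \<open>\<open>sym_coords\<close> gives equal a(x) and a(y). For another mark the two a's are
  proportional by \<open>same_root_data\<close>, and both contain a_w(z) with coefficient 1, so the
  factor is 1.\<close>

lemma linked_unique:
  assumes w: "w \<in> V" "x \<noteq> y" "reflectable X w x" "reflectable X w y"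
    and l: "link x y w s" "link x y w s'" and C: "\<And>z. z \<in> X \<Longrightarrow> coords s s' z = coords s s z"
  shows "s = s'"
proof -
  have x: "x \<in> X" "y \<in> X" using w reflectable_in by auto
  \<comment> \<open>By weak symmetry a_xy and a_yx vanish together; if they do, any nonzero
    \<open>d\<close> serves.\<close>
  obtain d where d: "d \<noteq> 0" "cartan w x y = d * cartan w y x"
  proof (cases "cartan w x y = 0")
    case True
    then show ?thesis using weak_symmetry_V[OF w(1,3) x(2)] that[of 1] by simp
  next
    case False
    then have "cartan w y x \<noteq> 0" using weak_symmetry_V[OF w(1,4) x(1)] by auto
    then show ?thesis using False that[of "cartan w x y / cartan w y x"] by simp
  qed
  note S = sym_coords_link[OF w(1) x w(2) d l(1)] and S' = sym_coords_link[OF w(1) x w(2) d l(2)]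
  have V: "s \<in> V" "s' \<in> V" using S S' by auto
  interpret W: root_datum_on X w using V_facts w by blast
  interpret A: root_datum_on X s using V_facts V by blast
  interpret B: root_datum_on X s' using V_facts V by blast
  have H: "rd_space w = H0" "rd_space s = H0" "rd_space s' = H0" using V_facts V w by auto
  have b: "rd_b s' z h = rd_b s z h" if "z \<in> X" "h \<in> H0" for z h
    using coords(2)[OF V that] coords(2)[OF V(1,1) that] C[OF that(1)] by simp
  have two_b: "p = p2 \<and> q = q2"
    if *: "\<And>h. h \<in> H0 \<Longrightarrow> p * rd_b w x h + q * rd_b w y h = p2 * rd_b w x h + q2 * rd_b w y h" for p q p2 q2
  proof -
    have e: "(\<Sum>z\<in>X. (if z = x then u else if z = y then t else 0) * rd_b w z h) = u * rd_b w x h + t * rd_b w y h" for u t h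
    proof -
      have "(\<Sum>z\<in>X. (if z = x then u else if z = y then t else 0) * rd_b w z h)
        = (\<Sum>z\<in>X. (if z = x then u else 0) * rd_b w z h + (if z = y then t else 0) * rd_b w z h)"
        using w(2) by (intro sum.cong) auto
      then show ?thesis by (simp only: sum.distrib W.sum_delta_b[OF x(1)] W.sum_delta_b[OF x(2)])
    qed
    have eq: "(if z = x then p else if z = y then q else 0) = (if z = x then p2 else if z = y then q2 else 0)" if "z \<in> X" for z
    proof (rule W.b_unique[where c = "\<lambda>z. if z = x then p else if z = y then q else 0"
          and d = "\<lambda>z. if z = x then p2 else if z = y then q2 else 0", OF _ that])
      fix h assume "h \<in> rd_space w"
      then have "h \<in> H0" using H by simp
      then show "(\<Sum>z\<in>X. (if z = x then p else if z = y then q else 0) * rd_b w z h)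
        = (\<Sum>z\<in>X. (if z = x then p2 else if z = y then q2 else 0) * rd_b w z h)"
        unfolding e by (rule *)
    qed
    from eq[OF x(1)] eq[OF x(2)] show ?thesis using w(2) by simp
  qed
  obtain p q p' q' where s: "\<forall>h\<in>H0. rd_b s x h = p * rd_b w x h + q * rd_b w y h"
      "\<forall>h\<in>H0. rd_b s y h = p' * rd_b w x h + q' * rd_b w y h"
      "rd_a s x = p *\<^sub>C rd_a w x + (q * d) *\<^sub>C rd_a w y"
      "rd_a s y = (p' / d) *\<^sub>C rd_a w x + q' *\<^sub>C rd_a w y"
      "\<forall>z\<in>X - {x, y}. \<exists>\<alpha> \<beta>. rd_a s z = rd_a w z + \<alpha> *\<^sub>C rd_a w x + \<beta> *\<^sub>C rd_a w y"
    using S unfolding sym_coords_def by blast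
  obtain p2 q2 p2' q2' where s': "\<forall>h\<in>H0. rd_b s' x h = p2 * rd_b w x h + q2 * rd_b w y h"
      "\<forall>h\<in>H0. rd_b s' y h = p2' * rd_b w x h + q2' * rd_b w y h"
      "rd_a s' x = p2 *\<^sub>C rd_a w x + (q2 * d) *\<^sub>C rd_a w y"
      "rd_a s' y = (p2' / d) *\<^sub>C rd_a w x + q2' *\<^sub>C rd_a w y"
      "\<forall>z\<in>X - {x, y}. \<exists>\<alpha> \<beta>. rd_a s' z = rd_a w z + \<alpha> *\<^sub>C rd_a w x + \<beta> *\<^sub>C rd_a w y"
    using S' unfolding sym_coords_def by blast
  have ax: "rd_a s' x = rd_a s x"
    unfolding s(3) s'(3) using two_b[of p q p2 q2] s(1) s'(1) b[OF x(1)] by simp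
  have ay: "rd_a s' y = rd_a s y"
    unfolding s(4) s'(4) using two_b[of p' q' p2' q2'] s(2) s'(2) b[OF x(2)] by simp
  have az: "rd_a s' z = rd_a s z" if z: "z \<in> X - {x, y}" for z
  proof -
    obtain \<alpha> \<beta> where 1: "rd_a s z = rd_a w z + \<alpha> *\<^sub>C rd_a w x + \<beta> *\<^sub>C rd_a w y" using s(5) z by blast
    obtain \<alpha>' \<beta>' where 2: "rd_a s' z = rd_a w z + \<alpha>' *\<^sub>C rd_a w x + \<beta>' *\<^sub>C rd_a w y" using s'(5) z by blast
    obtain k where k: "rd_a s' z = k *\<^sub>C rd_a s z"
      using same_root_data(1)[OF V(2,1), of z z] b z by blast
    have e: "(\<Sum>q\<in>X. (if q = z then c else if q = x then u else if q = y then t else 0) *\<^sub>C rd_a w q)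
      = c *\<^sub>C rd_a w z + u *\<^sub>C rd_a w x + t *\<^sub>C rd_a w y" for c u t
    proof -
      have "(\<Sum>q\<in>X. (if q = z then c else if q = x then u else if q = y then t else 0) *\<^sub>C rd_a w q)
        = (\<Sum>q\<in>X. (if q = z then c else 0) *\<^sub>C rd_a w q + (if q = x then u else 0) *\<^sub>C rd_a w q
            + (if q = y then t else 0) *\<^sub>C rd_a w q)"
        using w(2) z by (intro sum.cong) auto
      then show ?thesis using z
        by (simp only: sum.distrib W.sum_delta_a[OF x(1)] W.sum_delta_a[OF x(2)] W.sum_delta_a[of z] DiffD1)
    qed
    have "(if z = z then 1 else if z = x then \<alpha>' else if z = y then \<beta>' else 0)
      = (if z = z then k else if z = x then k * \<alpha> else if z = y then k * \<beta> else 0)"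
    proof (rule W.a_unique[where c = "\<lambda>q. if q = z then 1 else if q = x then \<alpha>' else if q = y then \<beta>' else 0"
          and d = "\<lambda>q. if q = z then k else if q = x then k * \<alpha> else if q = y then k * \<beta> else 0"])
      show "(\<Sum>q\<in>X. (if q = z then 1 else if q = x then \<alpha>' else if q = y then \<beta>' else 0) *\<^sub>C rd_a w q)
        = (\<Sum>q\<in>X. (if q = z then k else if q = x then k * \<alpha> else if q = y then k * \<beta> else 0) *\<^sub>C rd_a w q)"
        unfolding e using k unfolding 1 2
        by (simp add: scaleC_add_right scaleC_scaleC scaleC_one)
    qed (use z in auto)
    then show ?thesis using k by (simp add: scaleC_one)
  qed
  have "rd_a s' z = rd_a s z" for z
    using ax ay az A.a_ext B.a_ext by (cases "z \<in> X"; cases "z \<in> {x, y}") auto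
  moreover have "rd_b s' z h = rd_b s z h" for z h
    using b A.b_ext B.b_ext A.b_linear(4) B.b_linear(4) H by (cases "z \<in> X"; cases "h \<in> H0") auto
  moreover have "rd_p s' z = rd_p s z" for z
    using same_root_data(2)[OF V(2,1), of z z] b A.p_ext B.p_ext by (cases "z \<in> X") auto
  ultimately show ?thesis using H by (intro root_datum.equality) (auto simp: fun_eq_iff)
qed

sublocale reflexion_graph V X "reflectable X" "reflexion X" cn coords
proof
  show "finite X" by (rule fin)
  show "\<And>w x. reflectable X w x \<Longrightarrow> x \<in> X" by (rule reflectable_in)
  show "\<And>w x. w \<in> V \<Longrightarrow> reflectable X w x \<Longrightarrow> reflexion X w x \<in> V" by (rule V_closed)
  show "\<And>w x. w \<in> V \<Longrightarrow> reflectable X w x \<Longrightarrow> reflectable X (reflexion X w x) x" by (rule V_inv)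
  show "\<And>w x. w \<in> V \<Longrightarrow> reflectable X w x \<Longrightarrow> reflexion X (reflexion X w x) x = w" by (rule V_inv)
  show "\<And>u w. u \<in> V \<Longrightarrow> w \<in> V \<Longrightarrow> (reflexion_step X)\<^sup>*\<^sup>* u w"
    by (rule V_reach)
  show "\<And>u x. u \<in> V \<Longrightarrow> x \<in> X \<Longrightarrow> coords u u x = (\<lambda>y. if y = x then 1 else 0)" by (rule coords_id)
  show "\<And>t w z x. t \<in> V \<Longrightarrow> w \<in> V \<Longrightarrow> z \<in> X \<Longrightarrow> reflectable X w x \<Longrightarrow> coords w t z = coords w w x
      \<Longrightarrow> reflectable X t z" by (rule reflectable_root)
  show "\<And>w x y. w \<in> V \<Longrightarrow> reflectable X w x \<Longrightarrow> y \<in> X \<Longrightarrow> y \<noteq> x \<Longrightarrow> cn (reflexion X w x) x y = cn w x y"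
    by (rule cn_inv)
  show "\<And>w x y. w \<in> V \<Longrightarrow> x \<noteq> y \<Longrightarrow> reflectable X w x \<Longrightarrow> reflectable X w y
      \<Longrightarrow> reflectable X (reflexion X w x) y \<Longrightarrow> cn (reflexion X w x) y x = cn w y x" by (rule cn_const)
  show "\<And>w x y. w \<in> V \<Longrightarrow> x \<noteq> y \<Longrightarrow> reflectable X w x \<Longrightarrow> reflectable X w y \<Longrightarrow> cn w x y = 0
      \<Longrightarrow> cn w y x = 0" by (rule cn_zero)
  show "\<And>w x y s s'. w \<in> V \<Longrightarrow> x \<noteq> y \<Longrightarrow> reflectable X w x \<Longrightarrow> reflectable X w y \<Longrightarrow> link x y w s \<Longrightarrow>
      link x y w s' \<Longrightarrow> (\<And>z. z \<in> X \<Longrightarrow> coords s s' z = coords s s z) \<Longrightarrow> s = s'" by (rule linked_unique)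
qed (fact coords_trans coords_r coords_sign)+

end

text \<open>The kernel attached to a vertex is the preimage of its ideal in the free algebra.
  Skeleton vertices stay in the component, and any two are joined by an arrow inducing the identity
  of \<hh>.\<close>

lemma admissible_skeletonI:
  fixes X :: "'x set" and R0 :: "('h::complex_vector, 'x) root_datum set"
  assumes X: "finite X" and R0: "rg_component X R0" and adm: "admissible X R0" and v: "v \<in> R0"
  shows "\<exists>J. admissible_skeleton X v J"
proof -
  obtain u0 where u0: "R0 = {w. \<exists>\<phi>. rg_arrow X u0 \<phi> w}" using R0 by (auto simp: rg_component_def)
  have root: "w \<in> root_data X" if "w \<in> R0" for w using rg_arrow_root[OF X] that u0 by blast
  have comp: "w \<in> R0" if "(reflexion_step X)\<^sup>*\<^sup>* v w" for w using arrow_component[OF _ that X] v u0 by blast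
  obtain I where adm: "(\<forall>v\<in>R0. graded_ideal (half_baked X v) (I v)
        \<and> (\<forall>h\<in>rd_space v. half_baked_h X v h \<in> I v \<longrightarrow> h = 0))
   \<and> (\<forall>v\<in>R0. \<forall>w \<phi>. rg_arrow X v \<phi> w \<longrightarrow>
        (\<exists>\<Phi>. superalgebra_iso (quotient_superalgebra (half_baked X v) (I v))
                 (quotient_superalgebra (half_baked X w) (I w)) \<Phi>
           \<and> (\<forall>h\<in>rd_space v. \<Phi> (I v +>\<^bsub>half_baked X v\<^esub> half_baked_h X v h)
                = I w +>\<^bsub>half_baked X w\<^esub> half_baked_h X w (\<phi> h))))"
    using adm unfolding admissible_def ..
  have I: "graded_ideal (half_baked X v) (I v)" "\<And>h. h \<in> rd_space v \<Longrightarrow> half_baked_h X v h \<in> I v \<Longrightarrow> h = 0"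
    if "v \<in> R0" for v using bspec[OF conjunct1[OF adm] that] by simp_all
  note iso = conjunct2[OF adm, rule_format]
  have "admissible_skeleton X v (\<lambda>u. class_kernel X u (I u))"
  proof
    show "v \<in> root_data X" using root v by blast
    fix u w assume uw: "(reflexion_step X)\<^sup>*\<^sup>* v u" "(reflexion_step X)\<^sup>*\<^sup>* v w"
    have ur: "u \<in> R0" "w \<in> R0" "u \<in> root_data X" "w \<in> root_data X" using uw comp root by auto
    have "(reflexion_step X)\<^sup>*\<^sup>* u w" using rtranclp_trans[OF skeleton_reach_sym[OF X root[OF v] uw(1)] uw(2)] .
    note arr = skeleton_arrow[OF X ur(3) this]
    obtain \<Phi> where \<Phi>: "superalgebra_iso (quotient_superalgebra (half_baked X u) (I u))
                 (quotient_superalgebra (half_baked X w) (I w)) \<Phi>"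
      "\<forall>h\<in>rd_space u. \<Phi> (I u +>\<^bsub>half_baked X u\<^esub> half_baked_h X u h)
                = I w +>\<^bsub>half_baked X w\<^esub> half_baked_h X w ((\<lambda>h\<in>rd_space u. h) h)"
      using iso[OF ur(1) conjunct1[OF arr]] by blast
    have "lie_transport X u w (class_kernel X u (I u)) (class_kernel X w (I w))
      (\<lambda>t s. t \<in> free_space X u \<and> s \<in> free_space X w \<and> \<Phi> (class_map X u (I u) t) = class_map X w (I w) s)"
      using \<Phi>(2) conjunct2[OF arr]
      by (intro lie_transportI ur I(1) I(2)[OF ur(1)] I(2)[OF ur(2)] \<Phi>(1)) auto
    moreover have "contragredient X z (class_kernel X z (I z))" if "z \<in> R0" for z
      unfolding contragredient_def
      using class_map(3)[OF root[OF that] I(1)[OF that] I(2)[OF that]] X root[OF that]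
      by (simp add: root_datum_on_def)
    ultimately show "\<exists>T. root_transport X u w (class_kernel X u (I u)) (class_kernel X w (I w)) T"
      using ur unfolding root_transport_def by blast
  qed (rule X)
  then show ?thesis by blast
qed

theorem theorem6p1p7:
  fixes X :: "'x set" and R0 :: "('h::complex_vector, 'x) root_datum set"
    and v :: "('h, 'x) root_datum"
  assumes "finite X"
    and "rg_component X R0"
    and "admissible X R0"
    and "v \<in> R0"
  shows "coxeter_graph X (skeleton X v)
    \<and> (\<forall>m u \<phi>. nontrivial_coxeter_loop (skeleton X v) m u \<phi> \<longrightarrow> traversed_once \<phi> \<longrightarrow>
         m \<in> {2, 3, 4, 6})"
proof -
  obtain J where "admissible_skeleton X v J" using admissible_skeletonI[OF assms] by blast
  then interpret admissible_skeleton X v J .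
  have "graph = \<lparr>verts = V, arrows = {(u, x, w). u \<in> V \<and> reflectable X u x \<and> w = reflexion X u x}\<rparr>"
    by (rule graph_def)
  then have "skeleton X v = graph" by (simp add: skeleton_def V_def Let_def)
  moreover have "V \<noteq> {}" unfolding V_def by blast
  ultimately show ?thesis using coxeter_graph coxeter_loop_length by simp
qed

end
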